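(* Let $A$ be a set and let $G=F(A)$ be the free group on $A$ equipped with the standard conjugation-invariant word norm. Then $F(A)$ is independent of scaling, and the homomorphisms $$\rho_{\omega,\mathbf{d}}\colon\hat{\mathcal{C}}(F(A))\to\mathrm{Cone}_\omega(F(A),\mathbf{d}),\qquad[g]\mapsto\{g(d_n)\}_n,$$ are injective (for all non-principal ultrafilters $\omega$ on $\mathbb{N}$ and all scaling sequences $\mathbf{d}=(d_n)$).
   Context: Standard word norm on $F(A)$: $\|g\|$ is the least $n\ge0$ such that $g$ is a product of $n$ conjugates of elements of $A\cup A^{-1}$. Norms. A norm on a group $G$ is a function $\|\cdot\|\colon G\to[0,\infty)$ with $\|g\|=0\iff g=1$, $\|g^{-1}\|=\|g\|$ and $\|gh\|\le\|g\|+\|h\|$; for a pseudonorm one only requires $\|1\|=0$ instead of the first condition. It is conjugation-invariant if $\|hgh^{-1}\|=\|g\|$ for all $g,h$. It induces the bi-invariant (pseudo)metric $d(g,h)=\|g^{-1}h\|$; all metric notions refer to it. The groups $F_{\mathbb{R}}(G)$ and $F(G)$. Let $G$ be any group with a conjugation-invariant norm. $F_{\mathbb{R}}(G)$ is the free product of copies of the additive group $\mathbb{R}$ indexed by the elements $g$ of the set $G$; the element $r$ of the copy indexed by $g$ is written $\overline{g}(r)$. It carries the conjugation-invariant pseudonorm $$\|x\|=\inf\Big\{\sum_{i=1}^n |r_i|\,\|g_i\| : x=\prod_{i=1}^n h_i\,\overline{g_i}(r_i)^{\pm1}h_i^{-1},\ h_i\in F_{\mathbb{R}}(G)\Big\}.$$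 $F(G)\le F_{\mathbb{R}}(G)$ is the subgroup generated by the elements $\overline{g}:=\overline{g}(1)$; it is free on $\{\overline{g}: g\in G\}$. For $t\in\mathbb{R}$, $\psi_t\colon F_{\mathbb{R}}(G)\to F_{\mathbb{R}}(G)$ is the homomorphism with $\psi_t(\overline{g}(r))=\overline{g}(tr)$. $\pi\colon F(G)\to G$ is the homomorphism with $\pi(\overline{g})=g$. Directional asymptotic cone. A scaling set is an unbounded subset $T\subseteq(0,\infty)$; limits over $t\in T$ are taken as $t\to\infty$. A function $f$ from $T$ to a pseudometric space is Cauchy if for every $\epsilon>0$, $d(f(t),f(t'))<\epsilon$ for all sufficiently large $t,t'\in T$. $\mathcal{D}(G,T)$ is the group (pointwise product) of all functions $w\colon T\to F(G)$ such that $t\mapsto\psi_{1/t}(w(t))\in F_{\mathbb{R}}(G)$ is Cauchy, with pseudonorm $\|w\|=\lim_{t\in T}\|\psi_{1/t}(w(t))\|$. $\mathcal{C}(G,T)=\{\pi\circ w: w\in\mathcal{D}(G,T)\}$, a group of functions $T\to G$, with pseudonorm $\|g\|=\inf\{\|w\|: w\in\mathcal{D}(G,T),\ \pi\circ w=g\}$. The directional asymptotic cone $\hat{\mathcal{C}}(G,T)$ is the quotient of $\mathcal{C}(G,T)$ by the normal subgroup of elements of pseudonorm $0$, with the induced conjugation-invariant norm; $[g]$ denotes the class of $g$. Write $\hat{\mathcal{C}}(G)=\hat{\mathcal{C}}(G,(0,\infty))$. Independence of scaling. For scaling sets $T\subseteq T'$ there is a well-defined homomorphism $\hat{\mathcal{C}}(G,T')\to\hat{\mathcal{C}}(G,T)$,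 $[g]\mapsto[g|_T]$. $G$ is independent of scaling if this is an isometry for all scaling sets $T\subseteq T'$. Ultrafilter cone. A scaling sequence is a sequence $\mathbf{d}=(d_n)$ of positive reals with $d_n\to\infty$. For a non-principal ultrafilter $\omega$ on $\mathbb{N}$, $\mathrm{Cone}_\omega(G,\mathbf{d})$ is the group of sequences $(g_n)$ in $G$ with $\limsup_n\|g_n\|/d_n<\infty$ (pointwise product), modulo $(g_n)\sim(h_n)\iff\omega\text{-}\lim_n\|g_n^{-1}h_n\|/d_n=0$, with the norm $\|\{g_n\}\|=\omega\text{-}\lim_n\|g_n\|/d_n$; $\{g_n\}$ denotes the class of $(g_n)$. The map $\rho_{\omega,\mathbf{d}}$ is a well-defined homomorphism. *)

theory Defs
  imports "HOL-Algebra.Algebra" "HOL-Analysis.Analysis"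
begin

definition list_mult :: "('a, 'b) monoid_scheme \<Rightarrow> 'a list \<Rightarrow> 'a" where
  "list_mult G xs = foldr (\<lambda>x y. x \<otimes>\<^bsub>G\<^esub> y) xs \<one>\<^bsub>G\<^esub>"

definition norm_dist :: "('a, 'b) monoid_scheme \<Rightarrow> ('a \<Rightarrow> real) \<Rightarrow> 'a \<Rightarrow> 'a \<Rightarrow> real" where
  "norm_dist G \<nu> g h = \<nu> (inv\<^bsub>G\<^esub> g \<otimes>\<^bsub>G\<^esub> h)"

definition is_isometry ::
  "('a, 'm) monoid_scheme \<Rightarrow> ('a \<Rightarrow> real) \<Rightarrow> ('b, 'n) monoid_scheme \<Rightarrow> ('b \<Rightarrow> real) \<Rightarrow> ('a \<Rightarrow> 'b) \<Rightarrow> bool"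
  where
  "is_isometry G \<nu> H \<mu> f \<longleftrightarrow> bij_betw f (carrier G) (carrier H) \<and>
     (\<forall>x\<in>carrier G. \<forall>y\<in>carrier G. norm_dist H \<mu> (f x) (f y) = norm_dist G \<nu> x y)"


section \<open>Free groups and the word norm\<close>

text \<open>The letter \<open>(a, True)\<close> stands for \<open>a\<close> and \<open>(a, False)\<close> for its inverse. Elements of
  the free group are reduced words, multiplied by concatenation followed by free reduction.\<close>

definition fg_reduced :: "('a \<times> bool) list \<Rightarrow> bool" where
  "fg_reduced w \<longleftrightarrow> successively (\<lambda>x y. \<not> (fst x = fst y \<and> snd x \<noteq> snd y)) w"

fun fg_cons :: "'a \<times> bool \<Rightarrow> ('a \<times> bool) list \<Rightarrow> ('a \<times> bool) list" where
  "fg_cons x [] = [x]"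
| "fg_cons x (y # w) = (if fst x = fst y \<and> snd x \<noteq> snd y then w else x # y # w)"

definition free_group :: "'a set \<Rightarrow> ('a \<times> bool) list monoid" where
  "free_group A =
     \<lparr>carrier = {w. fst ` set w \<subseteq> A \<and> fg_reduced w}, monoid.mult = foldr fg_cons, one = []\<rparr>"

definition word_norm :: "'a set \<Rightarrow> ('a \<times> bool) list \<Rightarrow> real" where
  "word_norm A x = real (LEAST n. \<exists>ws. length ws = n \<and>
     (\<forall>y\<in>set ws. \<exists>h\<in>carrier (free_group A). \<exists>a\<in>A. \<exists>e.
        y = h \<otimes>\<^bsub>free_group A\<^esub> [(a, e)] \<otimes>\<^bsub>free_group A\<^esub> inv\<^bsub>free_group A\<^esub> h) \<and>
     x = list_mult (free_group A) ws)"

lemma fg_cons_cancel: "fg_reduced w \<Longrightarrow> fg_cons (a, \<not> e) (fg_cons (a, e) w) = w"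
proof (cases w)
  case (Cons y v)
  assume "fg_reduced w"
  then show ?thesis
    by (cases y; cases v) (auto simp: fg_reduced_def Cons)
qed simp

lemma fg_reduced_Cons: "fg_reduced (x # w) \<Longrightarrow> fg_reduced w \<and> fg_cons x w = x # w"
  by (cases w) (auto simp: fg_reduced_def)

lemma fg_cons_closed: "fg_reduced w \<Longrightarrow> fg_reduced (fg_cons x w)"
  by (cases w) (auto simp: fg_reduced_def successively_Cons)

lemma fg_cons_set: "fst ` set (fg_cons x w) \<subseteq> insert (fst x) (fst ` set w)"
  by (cases w) auto

lemma fg_foldr_closed:
  assumes "fg_reduced w"
  shows "fg_reduced (foldr fg_cons v w)"
  using assms by (induction v) (simp_all add: fg_cons_closed)

lemma fg_foldr_set: "fst ` set (foldr fg_cons v w) \<subseteq> fst ` set v \<union> fst ` set w"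
proof (induction v)
  case (Cons x v)
  have "fst ` set (fg_cons x (foldr fg_cons v w)) \<subseteq> insert (fst x) (fst ` set (foldr fg_cons v w))"
    by (rule fg_cons_set)
  with Cons show ?case by (simp, blast)
qed simp

lemma fg_foldr_cons:
  assumes "fg_reduced z"
  shows "foldr fg_cons (fg_cons x w) z = fg_cons x (foldr fg_cons w z)"
proof (cases w)
  case (Cons y v)
  have "fg_reduced (foldr fg_cons v z)" by (rule fg_foldr_closed[OF assms])
  from fg_cons_cancel[OF this, of "fst y" "snd y"] show ?thesis
    using Cons by (cases x; cases y) auto
qed simp

lemma fg_foldr_assoc:
  "fg_reduced y \<Longrightarrow> fg_reduced z \<Longrightarrow>
   foldr fg_cons (foldr fg_cons x y) z = foldr fg_cons x (foldr fg_cons y z)"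
  by (induction x) (auto simp: fg_foldr_cons fg_foldr_closed)

lemma fg_foldr_Nil: "fg_reduced x \<Longrightarrow> foldr fg_cons x [] = x"
  by (induction x) (auto dest: fg_reduced_Cons)

lemma fg_foldr_inverse:
  "fg_reduced z \<Longrightarrow> foldr fg_cons (rev (map (\<lambda>(a, e). (a, \<not> e)) x)) (foldr fg_cons x z) = z"
  by (induction x arbitrary: z) (auto simp: fg_cons_cancel fg_foldr_closed)

lemma fg_reduced_inverse:
  "fg_reduced x \<Longrightarrow> fg_reduced (rev (map (\<lambda>(a, e). (a, \<not> e)) x))"
  by (auto simp: fg_reduced_def successively_map successively_rev case_prod_beta
           elim!: successively_mono)

lemma group_free_group: "group (free_group A)"
proof (rule groupI)
  fix x y assume "x \<in> carrier (free_group A)" "y \<in> carrier (free_group A)"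
  then show "x \<otimes>\<^bsub>free_group A\<^esub> y \<in> carrier (free_group A)"
    using fg_foldr_set[of x y] by (simp add: free_group_def fg_foldr_closed) blast
next
  show "\<one>\<^bsub>free_group A\<^esub> \<in> carrier (free_group A)"
    by (simp add: free_group_def fg_reduced_def)
next
  fix x assume x: "x \<in> carrier (free_group A)"
  let ?y = "rev (map (\<lambda>(a, e). (a, \<not> e)) x)"
  have "?y \<in> carrier (free_group A)"
    using x fg_reduced_inverse[of x] by (auto simp: free_group_def)
  moreover have "?y \<otimes>\<^bsub>free_group A\<^esub> x = \<one>\<^bsub>free_group A\<^esub>"
    using x fg_foldr_inverse[of "[]" x]
    by (simp add: free_group_def fg_foldr_Nil) (simp add: fg_reduced_def)
  ultimately show "\<exists>y\<in>carrier (free_group A). y \<otimes>\<^bsub>free_group A\<^esub> x = \<one>\<^bsub>free_group A\<^esub>" ..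
qed (simp_all add: free_group_def fg_foldr_assoc)


section \<open>Free products of copies of the reals\<close>

text \<open>The syllable \<open>(i, r)\<close> stands for the element \<open>r\<close> of the copy of the additive group of the
  reals with index \<open>i\<close>. Elements of the free product are reduced words: no syllable is
  trivial and adjacent syllables come from different copies.\<close>

definition fp_reduced :: "('i \<times> real) list \<Rightarrow> bool" where
  "fp_reduced w \<longleftrightarrow> (\<forall>x\<in>set w. snd x \<noteq> 0) \<and> successively (\<lambda>x y. fst x \<noteq> fst y) w"

fun fp_cons :: "'i \<times> real \<Rightarrow> ('i \<times> real) list \<Rightarrow> ('i \<times> real) list" where
  "fp_cons (i, r) [] = (if r = 0 then [] else [(i, r)])"
| "fp_cons (i, r) ((j, s) # w) =
     (if r = 0 then (j, s) # w
      else if i = j then (if r + s = 0 then w else (i, r + s) # w)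
      else (i, r) # (j, s) # w)"

definition free_product_reals :: "'i set \<Rightarrow> ('i \<times> real) list monoid" where
  "free_product_reals I =
     \<lparr>carrier = {w. fst ` set w \<subseteq> I \<and> fp_reduced w}, monoid.mult = foldr fp_cons, one = []\<rparr>"

definition syllable :: "'i \<Rightarrow> real \<Rightarrow> ('i \<times> real) list" where
  "syllable i r = (if r = 0 then [] else [(i, r)])"

lemma fp_cons_simps [simp]: "fp_cons (i, 0) w = w"
  by (cases w) auto

lemma fp_cons_add:
  assumes "fp_reduced w"
  shows "fp_cons (i, r) (fp_cons (i, s) w) = fp_cons (i, r + s) w"
proof (cases "r = 0 \<or> s = 0")
  case False
  show ?thesis
  proof (cases w)
    case Nil
    with False show ?thesis by simp
  next
    case (Cons y v)
    obtain j t where y: "y = (j, t)" by (cases y)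
    have v: "fp_cons (j, q) v = (j, q) # v" if "q \<noteq> 0" for q
      using assms that by (cases v) (auto simp: Cons y fp_reduced_def)
    show ?thesis
    proof (cases "i = j")
      case True
      show ?thesis
      proof (cases "s + t = 0")
        case st: True
        then have "r + s + t = r" by simp
        with True False st show ?thesis by (simp add: Cons y v)
      next
        case st: False
        have "t \<noteq> 0" using assms by (simp add: Cons y fp_reduced_def)
        then have "r + s \<noteq> 0" if "r + (s + t) = 0" using that by argo
        with True False st show ?thesis by (simp add: Cons y add.assoc)
      qed
    next
      case False
      with \<open>\<not> (r = 0 \<or> s = 0)\<close> show ?thesis by (simp add: Cons y)
    qed
  qed
qed auto

lemma fp_reduced_Cons: "fp_reduced (x # w) \<Longrightarrow> fp_reduced w \<and> fp_cons x w = x # w"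
  by (cases w; cases x) (auto simp: fp_reduced_def)

lemma fp_cons_closed: "fp_reduced w \<Longrightarrow> fp_reduced (fp_cons x w)"
  by (induction x w rule: fp_cons.induct) (auto simp: fp_reduced_def successively_Cons)

lemma fp_cons_set: "fst ` set (fp_cons x w) \<subseteq> insert (fst x) (fst ` set w)"
  by (induction x w rule: fp_cons.induct) auto

lemma fp_foldr_closed:
  assumes "fp_reduced w"
  shows "fp_reduced (foldr fp_cons v w)"
  using assms by (induction v) (simp_all add: fp_cons_closed)

lemma fp_foldr_set: "fst ` set (foldr fp_cons v w) \<subseteq> fst ` set v \<union> fst ` set w"
proof (induction v)
  case (Cons x v)
  have "fst ` set (fp_cons x (foldr fp_cons v w)) \<subseteq> insert (fst x) (fst ` set (foldr fp_cons v w))"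
    by (rule fp_cons_set)
  with Cons show ?case by (simp, blast)
qed simp

lemma fp_foldr_cons:
  assumes "fp_reduced z"
  shows "foldr fp_cons (fp_cons x w) z = fp_cons x (foldr fp_cons w z)"
proof (cases w)
  case Nil
  then show ?thesis by (cases x) auto
next
  case (Cons y v)
  have "fp_reduced (foldr fp_cons v z)" by (rule fp_foldr_closed[OF assms])
  from fp_cons_add[OF this, of "fst y"] show ?thesis
    using Cons by (cases x; cases y) auto
qed

lemma fp_foldr_assoc:
  "fp_reduced y \<Longrightarrow> fp_reduced z \<Longrightarrow>
   foldr fp_cons (foldr fp_cons x y) z = foldr fp_cons x (foldr fp_cons y z)"
  by (induction x) (auto simp: fp_foldr_cons fp_foldr_closed)

lemma fp_foldr_Nil: "fp_reduced x \<Longrightarrow> foldr fp_cons x [] = x"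
  by (induction x) (auto dest: fp_reduced_Cons)

lemma fp_foldr_inverse:
  "fp_reduced z \<Longrightarrow> foldr fp_cons (rev (map (\<lambda>(i, r). (i, - r)) x)) (foldr fp_cons x z) = z"
  by (induction x arbitrary: z) (auto simp: fp_cons_add fp_foldr_closed)

lemma fp_reduced_inverse:
  "fp_reduced x \<Longrightarrow> fp_reduced (rev (map (\<lambda>(i, r). (i, - r)) x))"
  by (auto simp: fp_reduced_def successively_map successively_rev case_prod_beta
           elim!: successively_mono)

lemma group_free_product_reals: "group (free_product_reals I)"
proof (rule groupI)
  fix x y assume "x \<in> carrier (free_product_reals I)" "y \<in> carrier (free_product_reals I)"
  then show "x \<otimes>\<^bsub>free_product_reals I\<^esub> y \<in> carrier (free_product_reals I)"
    using fp_foldr_set[of x y] by (simp add: free_product_reals_def fp_foldr_closed) blast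
next
  show "\<one>\<^bsub>free_product_reals I\<^esub> \<in> carrier (free_product_reals I)"
    by (simp add: free_product_reals_def fp_reduced_def)
next
  fix x assume x: "x \<in> carrier (free_product_reals I)"
  let ?y = "rev (map (\<lambda>(i, r). (i, - r)) x)"
  have "?y \<in> carrier (free_product_reals I)"
    using x fp_reduced_inverse[of x] by (auto simp: free_product_reals_def)
  moreover have "?y \<otimes>\<^bsub>free_product_reals I\<^esub> x = \<one>\<^bsub>free_product_reals I\<^esub>"
    using x fp_foldr_inverse[of "[]" x]
    by (simp add: free_product_reals_def fp_foldr_Nil) (simp add: fp_reduced_def)
  ultimately show "\<exists>y\<in>carrier (free_product_reals I). y \<otimes>\<^bsub>free_product_reals I\<^esub> x = \<one>\<^bsub>free_product_reals I\<^esub>" ..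
qed (simp_all add: free_product_reals_def fp_foldr_assoc)

lemma syllable_closed: "i \<in> I \<Longrightarrow> syllable i r \<in> carrier (free_product_reals I)"
  by (auto simp: syllable_def free_product_reals_def fp_reduced_def)

lemma syllable_add:
  "syllable i r \<otimes>\<^bsub>free_product_reals I\<^esub> syllable i s = syllable i (r + s)"
  by (auto simp: syllable_def free_product_reals_def)

text \<open>Evaluation of a word, given the image \<open>f i r\<close> of each syllable.\<close>

definition fp_lift :: "('b, 'm) monoid_scheme \<Rightarrow> ('i \<Rightarrow> real \<Rightarrow> 'b) \<Rightarrow> ('i \<times> real) list \<Rightarrow> 'b" where
  "fp_lift H f w = list_mult H (map (\<lambda>(i, r). f i r) w)"

lemma fp_lift_mult:
  assumes H: "group H"
    and K: "0 \<in> K" "\<And>r s. r \<in> K \<Longrightarrow> s \<in> K \<Longrightarrow> r + s \<in> K"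
    and f: "\<And>i r. i \<in> I \<Longrightarrow> r \<in> K \<Longrightarrow> f i r \<in> carrier H" "\<And>i. i \<in> I \<Longrightarrow> f i 0 = \<one>\<^bsub>H\<^esub>"
      "\<And>i r s. i \<in> I \<Longrightarrow> r \<in> K \<Longrightarrow> s \<in> K \<Longrightarrow> f i (r + s) = f i r \<otimes>\<^bsub>H\<^esub> f i s"
    and v: "set v \<subseteq> I \<times> K" and w: "set w \<subseteq> I \<times> K"
  shows "set (foldr fp_cons v w) \<subseteq> I \<times> K" "fp_lift H f w \<in> carrier H"
    "fp_lift H f (foldr fp_cons v w) = fp_lift H f v \<otimes>\<^bsub>H\<^esub> fp_lift H f w"
proof -
  interpret group H by (rule H)
  have cl: "fp_lift H f u \<in> carrier H" if "set u \<subseteq> I \<times> K" for u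
    using that by (induction u) (auto simp: fp_lift_def list_mult_def f)
  have 1: "set (fp_cons x u) \<subseteq> I \<times> K" if "x \<in> I \<times> K" "set u \<subseteq> I \<times> K" for x u
    using that by (induction x u rule: fp_cons.induct) (auto simp: K split: if_splits)
  have 2: "fp_lift H f (fp_cons (i, r) u) = f i r \<otimes>\<^bsub>H\<^esub> fp_lift H f u"
    if "i \<in> I" "r \<in> K" "set u \<subseteq> I \<times> K" for i r u
  proof (cases u)
    case Nil
    then show ?thesis using that by (auto simp: fp_lift_def list_mult_def f)
  next
    case (Cons y t)
    obtain j s where y: "y = (j, s)" by (cases y)
    have t: "fp_lift H f t \<in> carrier H" using that Cons by (intro cl) auto
    have js: "j \<in> I" "s \<in> K" using that Cons y by auto
    have lC: "fp_lift H f (z # t') = f (fst z) (snd z) \<otimes>\<^bsub>H\<^esub> fp_lift H f t'" for z t'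
      by (simp add: fp_lift_def list_mult_def case_prod_beta)
    have *: "f i r \<otimes>\<^bsub>H\<^esub> (f i s \<otimes>\<^bsub>H\<^esub> fp_lift H f t) = f i (r + s) \<otimes>\<^bsub>H\<^esub> fp_lift H f t"
      using f(3)[OF that(1,2) js(2)] f(1) that(1,2) js t by (simp add: m_assoc)
    show ?thesis
      using that js t * f(1)[OF js] f(2)[OF that(1)] by (auto simp: Cons y lC)
  qed
  show "set (foldr fp_cons v w) \<subseteq> I \<times> K"
    using v by (induction v) (simp_all add: w 1)
  show "fp_lift H f w \<in> carrier H" by (rule cl[OF w])
  show "fp_lift H f (foldr fp_cons v w) = fp_lift H f v \<otimes>\<^bsub>H\<^esub> fp_lift H f w"
    using v
  proof (induction v)
    case Nil
    then show ?case using cl[OF w] by (simp add: fp_lift_def list_mult_def)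
  next
    case (Cons x v)
    have "set (foldr fp_cons v w) \<subseteq> I \<times> K"
      using Cons.prems by (induction v) (simp_all add: w 1)
    moreover have "fp_lift H f (x # v) = f (fst x) (snd x) \<otimes>\<^bsub>H\<^esub> fp_lift H f v"
      by (simp add: fp_lift_def list_mult_def case_prod_beta)
    ultimately show ?case
      using Cons 2[of "fst x" "snd x" "foldr fp_cons v w"] cl[OF w] cl[of v] f(1)
      by (auto simp: m_assoc)
  qed
qed


section \<open>The groups of formal words over a normed group\<close>

abbreviation FR :: "('a, 'm) monoid_scheme \<Rightarrow> ('a \<times> real) list monoid" where
  "FR G \<equiv> free_product_reals (carrier G)"

definition FR_norm :: "('a, 'm) monoid_scheme \<Rightarrow> ('a \<Rightarrow> real) \<Rightarrow> ('a \<times> real) list \<Rightarrow> real" where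
  "FR_norm G \<nu> x = Inf {(\<Sum>(h, g, r, e)\<leftarrow>ws. \<bar>r\<bar> * \<nu> g) | ws.
     (\<forall>(h, g, r, e)\<in>set ws. h \<in> carrier (FR G) \<and> g \<in> carrier G \<and> e \<in> {1, -1}) \<and>
     x = list_mult (FR G)
       (map (\<lambda>(h, g, r, e). h \<otimes>\<^bsub>FR G\<^esub> (syllable g r [^]\<^bsub>FR G\<^esub> (e::int)) \<otimes>\<^bsub>FR G\<^esub> inv\<^bsub>FR G\<^esub> h) ws)}"

definition FZ :: "('a, 'm) monoid_scheme \<Rightarrow> ('a \<times> real) list monoid" where
  "FZ G = subgroup_generated (FR G) ((\<lambda>g. syllable g 1) ` carrier G)"

definition psi :: "('a, 'm) monoid_scheme \<Rightarrow> real \<Rightarrow> ('a \<times> real) list \<Rightarrow> ('a \<times> real) list" where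
  "psi G t = fp_lift (FR G) (\<lambda>g r. syllable g (t * r))"

text \<open>The exponents of words in \<open>FZ G\<close> are integers, so the floor below merely converts the type;
  nothing is intended outside \<open>FZ G\<close>.\<close>

definition proj :: "('a, 'm) monoid_scheme \<Rightarrow> ('a \<times> real) list \<Rightarrow> 'a" where
  "proj G = fp_lift G (\<lambda>g r. g [^]\<^bsub>G\<^esub> \<lfloor>r\<rfloor>)"

lemma psi_hom: "psi G t \<in> hom (FR G) (FR G)"
  and psi_syllable: "g \<in> carrier G \<Longrightarrow> psi G t (syllable g r) = syllable g (t * r)"
proof -
  interpret F: group "FR G" by (rule group_free_product_reals)
  note L = fp_lift_mult[OF F.group_axioms, of UNIV "carrier G" "\<lambda>g r. syllable g (t * r)"]
  show "psi G t \<in> hom (FR G) (FR G)"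
  proof (rule homI)
    fix x y assume xy: "x \<in> carrier (FR G)" "y \<in> carrier (FR G)"
    then have s: "set x \<subseteq> carrier G \<times> UNIV" "set y \<subseteq> carrier G \<times> UNIV"
      by (auto simp: free_product_reals_def)
    have e: "syllable g (t * 0) = \<one>\<^bsub>FR G\<^esub>" for g by (simp add: syllable_def free_product_reals_def)
    show "psi G t x \<in> carrier (FR G)"
      using L(2)[OF _ _ _ _ _ s(2) s(1)] e
      by (simp add: psi_def syllable_closed syllable_add distrib_left)
    show "psi G t (x \<otimes>\<^bsub>FR G\<^esub> y) = psi G t x \<otimes>\<^bsub>FR G\<^esub> psi G t y"
      using L(3)[OF _ _ _ _ _ s] e
      by (simp add: psi_def syllable_closed syllable_add distrib_left)
         (simp add: free_product_reals_def)
  qed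
  show "psi G t (syllable g r) = syllable g (t * r)" if "g \<in> carrier G"
    using syllable_closed[OF that, of "t * r"]
    by (auto simp: psi_def fp_lift_def list_mult_def syllable_def free_product_reals_def
             split: if_splits)
qed

lemma FZ_integral: "x \<in> carrier (FZ G) \<Longrightarrow> set x \<subseteq> carrier G \<times> \<int>"
proof -
  let ?S = "(\<lambda>g. syllable g 1) ` carrier G"
  have *: "set x \<subseteq> carrier G \<times> \<int>" if "x \<in> generate (FR G) ?S" for x
    using that
  proof induction
    case one
    then show ?case by (simp add: free_product_reals_def)
  next
    case (incl h)
    then show ?case by (auto simp: syllable_def)
  next
    case (inv h)
    then obtain g where g: "g \<in> carrier G" "h = syllable g 1" by auto
    have "inv\<^bsub>FR G\<^esub> h = syllable g (-1)"
      using g by (intro group.inv_equality group_free_product_reals syllable_closed)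
        (simp_all add: syllable_add, simp_all add: syllable_def free_product_reals_def fp_reduced_def)
    then show ?case using g by (auto simp: syllable_def)
  next
    case (eng h1 h2)
    have 1: "set (fp_cons x u) \<subseteq> carrier G \<times> \<int>"
      if "x \<in> carrier G \<times> \<int>" "set u \<subseteq> carrier G \<times> \<int>" for x u
      using that by (induction x u rule: fp_cons.induct) (auto split: if_splits)
    have "set (foldr fp_cons h1 h2) \<subseteq> carrier G \<times> \<int>"
      using eng.IH by (induction h1) (simp_all add: 1)
    then show ?case by (simp add: free_product_reals_def)
  qed
  have "?S \<subseteq> carrier (FR G)" by (auto intro: syllable_closed)
  then show "x \<in> carrier (FZ G) \<Longrightarrow> set x \<subseteq> carrier G \<times> \<int>"
    using * by (simp add: FZ_def carrier_subgroup_generated Int_absorb1)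
qed

lemma proj_hom: "group G \<Longrightarrow> proj G \<in> hom (FZ G) G"
  and proj_syllable: "group G \<Longrightarrow> g \<in> carrier G \<Longrightarrow> proj G (syllable g 1) = g"
proof -
  assume G: "group G"
  interpret group G by (rule G)
  note L = fp_lift_mult[OF G, of "\<int>" "carrier G" "\<lambda>g r. g [^]\<^bsub>G\<^esub> \<lfloor>r\<rfloor>"]
  have add: "g [^]\<^bsub>G\<^esub> \<lfloor>r + s\<rfloor> = g [^]\<^bsub>G\<^esub> \<lfloor>r\<rfloor> \<otimes>\<^bsub>G\<^esub> g [^]\<^bsub>G\<^esub> \<lfloor>s\<rfloor>"
    if "g \<in> carrier G" "r \<in> \<int>" "s \<in> \<int>" for g and r s :: real
    using that by (auto elim!: Ints_cases simp: int_pow_mult simp flip: of_int_add)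
  show "proj G \<in> hom (FZ G) G"
  proof (rule homI)
    fix x y assume "x \<in> carrier (FZ G)" "y \<in> carrier (FZ G)"
    then have s: "set x \<subseteq> carrier G \<times> \<int>" "set y \<subseteq> carrier G \<times> \<int>"
      by (auto dest: FZ_integral)
    show "proj G x \<in> carrier G"
      using L(2)[OF _ _ _ _ _ s(2) s(1)] add by (simp add: proj_def)
    show "proj G (x \<otimes>\<^bsub>FZ G\<^esub> y) = proj G x \<otimes>\<^bsub>G\<^esub> proj G y"
      using L(3)[OF _ _ _ _ _ s] add
      by (simp add: proj_def FZ_def) (simp add: free_product_reals_def)
  qed
  show "proj G (syllable g 1) = g" if "g \<in> carrier G"
    using that by (simp add: proj_def fp_lift_def list_mult_def syllable_def)
qed


section \<open>The directional asymptotic cone\<close>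

definition scaling_set :: "real set \<Rightarrow> bool" where
  "scaling_set T \<longleftrightarrow> T \<subseteq> {0<..} \<and> \<not> bdd_above T"

text \<open>Functions on \<open>T\<close> are represented by extensional functions, as in \<^const>\<open>product_group\<close>.\<close>

definition dir_words ::
  "('a, 'm) monoid_scheme \<Rightarrow> ('a \<Rightarrow> real) \<Rightarrow> real set \<Rightarrow> (real \<Rightarrow> ('a \<times> real) list) monoid" where
  "dir_words G \<nu> T = (product_group T (\<lambda>_. FZ G))
     \<lparr>carrier := {w \<in> T \<rightarrow>\<^sub>E carrier (FZ G).
        \<forall>\<epsilon>>0. \<exists>M. \<forall>t\<in>T. \<forall>t'\<in>T. t \<ge> M \<longrightarrow> t' \<ge> M \<longrightarrow>
          norm_dist (FR G) (FR_norm G \<nu>) (psi G (1 / t) (w t)) (psi G (1 / t') (w t')) < \<epsilon>}\<rparr>"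

definition dir_words_norm ::
  "('a, 'm) monoid_scheme \<Rightarrow> ('a \<Rightarrow> real) \<Rightarrow> real set \<Rightarrow> (real \<Rightarrow> ('a \<times> real) list) \<Rightarrow> real" where
  "dir_words_norm G \<nu> T w = Lim (inf at_top (principal T)) (\<lambda>t. FR_norm G \<nu> (psi G (1 / t) (w t)))"

definition dir_group ::
  "('a, 'm) monoid_scheme \<Rightarrow> ('a \<Rightarrow> real) \<Rightarrow> real set \<Rightarrow> (real \<Rightarrow> 'a) monoid" where
  "dir_group G \<nu> T = (product_group T (\<lambda>_. G))
     \<lparr>carrier := (\<lambda>w. restrict (proj G \<circ> w) T) ` carrier (dir_words G \<nu> T)\<rparr>"

definition dir_norm ::
  "('a, 'm) monoid_scheme \<Rightarrow> ('a \<Rightarrow> real) \<Rightarrow> real set \<Rightarrow> (real \<Rightarrow> 'a) \<Rightarrow> real" where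
  "dir_norm G \<nu> T g = Inf {dir_words_norm G \<nu> T w | w.
     w \<in> carrier (dir_words G \<nu> T) \<and> restrict (proj G \<circ> w) T = g}"

definition dir_null :: "('a, 'm) monoid_scheme \<Rightarrow> ('a \<Rightarrow> real) \<Rightarrow> real set \<Rightarrow> (real \<Rightarrow> 'a) set" where
  "dir_null G \<nu> T = {g \<in> carrier (dir_group G \<nu> T). dir_norm G \<nu> T g = 0}"

definition dir_cone ::
  "('a, 'm) monoid_scheme \<Rightarrow> ('a \<Rightarrow> real) \<Rightarrow> real set \<Rightarrow> (real \<Rightarrow> 'a) set monoid" where
  "dir_cone G \<nu> T = dir_group G \<nu> T Mod dir_null G \<nu> T"

definition dir_class ::
  "('a, 'm) monoid_scheme \<Rightarrow> ('a \<Rightarrow> real) \<Rightarrow> real set \<Rightarrow> (real \<Rightarrow> 'a) \<Rightarrow> (real \<Rightarrow> 'a) set" where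
  "dir_class G \<nu> T g = dir_null G \<nu> T #>\<^bsub>dir_group G \<nu> T\<^esub> g"

text \<open>Maps out of quotients are written as \<^term>\<open>\<lambda>P. the_elem (f ` P)\<close>: the common value of
  \<open>f\<close> on all representatives of the class \<open>P\<close>.\<close>

definition dir_cone_norm ::
  "('a, 'm) monoid_scheme \<Rightarrow> ('a \<Rightarrow> real) \<Rightarrow> real set \<Rightarrow> (real \<Rightarrow> 'a) set \<Rightarrow> real" where
  "dir_cone_norm G \<nu> T P = the_elem (dir_norm G \<nu> T ` P)"

definition dir_restrict ::
  "('a, 'm) monoid_scheme \<Rightarrow> ('a \<Rightarrow> real) \<Rightarrow> real set \<Rightarrow> (real \<Rightarrow> 'a) set \<Rightarrow> (real \<Rightarrow> 'a) set" where
  "dir_restrict G \<nu> T P = the_elem ((\<lambda>g. dir_class G \<nu> T (restrict g T)) ` P)"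

definition independent_of_scaling :: "('a, 'm) monoid_scheme \<Rightarrow> ('a \<Rightarrow> real) \<Rightarrow> bool" where
  "independent_of_scaling G \<nu> \<longleftrightarrow>
     (\<forall>T T'. scaling_set T \<longrightarrow> scaling_set T' \<longrightarrow> T \<subseteq> T' \<longrightarrow>
        is_isometry (dir_cone G \<nu> T') (dir_cone_norm G \<nu> T') (dir_cone G \<nu> T) (dir_cone_norm G \<nu> T)
          (dir_restrict G \<nu> T))"


section \<open>Ultrafilter cones\<close>

definition nonprincipal_ultrafilter :: "'a filter \<Rightarrow> bool" where
  "nonprincipal_ultrafilter \<omega> \<longleftrightarrow> \<omega> \<noteq> bot \<and>
     (\<forall>Q. eventually Q \<omega> \<or> eventually (\<lambda>x. \<not> Q x) \<omega>) \<and> (\<forall>a. \<omega> \<noteq> principal {a})"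

definition scaling_sequence :: "(nat \<Rightarrow> real) \<Rightarrow> bool" where
  "scaling_sequence d \<longleftrightarrow> (\<forall>n. d n > 0) \<and> filterlim d at_top sequentially"

definition linear_seqs ::
  "('a, 'm) monoid_scheme \<Rightarrow> ('a \<Rightarrow> real) \<Rightarrow> (nat \<Rightarrow> real) \<Rightarrow> (nat \<Rightarrow> 'a) monoid" where
  "linear_seqs G \<nu> d = (product_group UNIV (\<lambda>_. G))
     \<lparr>carrier := {g \<in> UNIV \<rightarrow>\<^sub>E carrier G. limsup (\<lambda>n. ereal (\<nu> (g n) / d n)) < \<infinity>}\<rparr>"

definition ultra_norm :: "('a \<Rightarrow> real) \<Rightarrow> nat filter \<Rightarrow> (nat \<Rightarrow> real) \<Rightarrow> (nat \<Rightarrow> 'a) \<Rightarrow> real" where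
  "ultra_norm \<nu> \<omega> d g = Lim \<omega> (\<lambda>n. \<nu> (g n) / d n)"

text \<open>Sequences \<open>g\<close>, \<open>h\<close> are identified when \<open>g\<inverse> h\<close> has limit norm \<open>0\<close>, that is, modulo
  the normal subgroup of sequences with limit norm \<open>0\<close>.\<close>

definition ultra_null ::
  "('a, 'm) monoid_scheme \<Rightarrow> ('a \<Rightarrow> real) \<Rightarrow> nat filter \<Rightarrow> (nat \<Rightarrow> real) \<Rightarrow> (nat \<Rightarrow> 'a) set" where
  "ultra_null G \<nu> \<omega> d = {g \<in> carrier (linear_seqs G \<nu> d). ultra_norm \<nu> \<omega> d g = 0}"

definition ultra_cone ::
  "('a, 'm) monoid_scheme \<Rightarrow> ('a \<Rightarrow> real) \<Rightarrow> nat filter \<Rightarrow> (nat \<Rightarrow> real) \<Rightarrow> (nat \<Rightarrow> 'a) set monoid" where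
  "ultra_cone G \<nu> \<omega> d = linear_seqs G \<nu> d Mod ultra_null G \<nu> \<omega> d"

definition ultra_class ::
  "('a, 'm) monoid_scheme \<Rightarrow> ('a \<Rightarrow> real) \<Rightarrow> nat filter \<Rightarrow> (nat \<Rightarrow> real) \<Rightarrow> (nat \<Rightarrow> 'a) \<Rightarrow> (nat \<Rightarrow> 'a) set" where
  "ultra_class G \<nu> \<omega> d g = ultra_null G \<nu> \<omega> d #>\<^bsub>linear_seqs G \<nu> d\<^esub> g"

definition rho ::
  "('a, 'm) monoid_scheme \<Rightarrow> ('a \<Rightarrow> real) \<Rightarrow> nat filter \<Rightarrow> (nat \<Rightarrow> real) \<Rightarrow> (real \<Rightarrow> 'a) set \<Rightarrow> (nat \<Rightarrow> 'a) set" where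
  "rho G \<nu> \<omega> d P = the_elem ((\<lambda>g. ultra_class G \<nu> \<omega> d (\<lambda>n. g (d n))) ` P)"

end

theory Submission
  imports Defs "HOL-Library.Sublist"
begin

text \<open>
  Both claims come from one fact about the free group \<open>F(A)\<close> (\<open>sublinear_imp_null\<close> together with
  \<open>free_group_straightens\<close>): if \<open>w\<close> is a directional word and the projections of \<open>w(t)\<close> have norm
  \<open>o(t)\<close> along some unbounded set of values \<open>t\<close>, then the projection of \<open>w\<close> is trivial in the
  directional cone. Injectivity of \<open>\<rho>\<close> is the special case of the values \<open>d\<^sub>n\<close> with \<open>n\<close> in a set of
  the ultrafilter. For scaling sets \<open>T \<subseteq> T'\<close>, every directional word over \<open>T\<close> extends to \<open>T'\<close>
  (\<open>Dw_extend\<close>), and two extensions with the same projection over \<open>T\<close> differ by a word whose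
  projection vanishes on \<open>T\<close>, hence by a null element; so restriction is onto and preserves the norm.

  The fact rests on the geometry of long periodic words. After rescaling, \<open>w(t)\<close> is close to a fixed
  product \<open>x\<close> of syllables \<open>g\<^sub>i(r\<^sub>i)\<close>, and its projection is close to the product of the powers of
  \<open>g\<^sub>i\<close> with exponents \<open>\<lfloor>t r\<^sub>i\<rfloor>\<close>. In the word norm of \<open>F(A)\<close>, an element of norm \<open>n\<close> becomes trivial
  after \<open>n\<close> letters are deleted from any word for it, and a trivial word traces a closed path in
  a tree. So a triangle of words splits at a median point into three bigons without any increase of
  the norm (\<open>tripod\<close>), and a polygon whose sides are powers of the \<open>g\<^sub>i\<close> splits into bigons with two
  such sides, up to a bounded error (\<open>polygon\<close>). Everything is thus controlled by the norms of
  elements \<open>g\<^sup>n h\<^sup>m\<close>. If no power of \<open>g\<close> is conjugate to a power of \<open>h\<close>, these norms grow linearly,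
  because counting occurrences of a long power of \<open>g\<close> is a quasimorphism that grows along \<open>g\<close>
  and vanishes along \<open>h\<close> (\<open>incommensurable_separated\<close>).

  Hence one wants to replace each \<open>g\<^sub>i(r\<^sub>i)\<close> by a syllable of a representative \<open>c\<close> of the
  commensurability class of \<open>g\<^sub>i\<close>, and to show that the result is short. The separation constants get
  worse as \<open>x\<close> becomes a better approximation of \<open>w\<close> and involves more classes, so one cannot argue
  with the approximations one at a time. Instead, \<open>x\<close> is kept fixed, and for the finitely many
  representatives \<open>c\<close> that occur for \<open>x\<close> one constructs functions \<open>\<lambda>\<^sub>c\<close> on the whole group that
  are homogeneous on powers, Lipschitz, have disjoint supports and satisfy \<open>\<lambda>\<^sub>c(c) = 1\<close>
  (\<open>homogeneous_bump_functions\<close>). Sending \<open>g(r)\<close> to \<open>c(\<lambda>\<^sub>c(g) r)\<close> defines an endomorphism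
  \<open>\<Lambda>\<close> of the free product of copies of the reals. It is \<open>2\<close>-Lipschitz whatever the representatives
  are; for every element \<open>y\<close>, the norm of \<open>\<Lambda> y\<close> is at most \<open>K\<close> times the growth rate of the projections
  of the multiples of \<open>y\<close>, with \<open>K\<close> independent of \<open>y\<close>; and \<open>\<Lambda> x\<close> has the same projections as \<open>x\<close>
  up to rounding. Applied to ever better approximations \<open>y\<close> of \<open>w\<close>, whose growth rates tend to \<open>0\<close>,
  the second property gives that \<open>\<Lambda> y\<close> is short; the first gives that \<open>\<Lambda> x\<close> is short; and the
  third turns \<open>\<Lambda> x\<close> into a short directional word with the same projection as \<open>w\<close>.
\<close>

section \<open>Conjugation-invariant pseudonorms\<close>

locale conj_pseudonorm = group G for G (structure) +
  fixes \<nu> :: "'a \<Rightarrow> real"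
  assumes nu_one [simp]: "\<nu> \<one> = 0"
    and nu_inv [simp]: "x \<in> carrier G \<Longrightarrow> \<nu> (inv x) = \<nu> x"
    and nu_mult: "x \<in> carrier G \<Longrightarrow> y \<in> carrier G \<Longrightarrow> \<nu> (x \<otimes> y) \<le> \<nu> x + \<nu> y"
    and nu_conj: "h \<in> carrier G \<Longrightarrow> x \<in> carrier G \<Longrightarrow> \<nu> (h \<otimes> x \<otimes> inv h) = \<nu> x"
begin

abbreviation dst :: "'a \<Rightarrow> 'a \<Rightarrow> real" where "dst \<equiv> norm_dist G \<nu>"

lemma nu_nonneg: "x \<in> carrier G \<Longrightarrow> 0 \<le> \<nu> x"
  using nu_mult[of x "inv x"] by simp

lemma nu_commute:
  assumes "x \<in> carrier G" "y \<in> carrier G" shows "\<nu> (x \<otimes> y) = \<nu> (y \<otimes> x)"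
  using nu_conj[of y "x \<otimes> y"] assms by (simp add: m_assoc)

lemma nu_conj': "h \<in> carrier G \<Longrightarrow> x \<in> carrier G \<Longrightarrow> \<nu> (inv h \<otimes> x \<otimes> h) = \<nu> x"
  using nu_conj[of "inv h" x] by simp

lemma dst_alt: "x \<in> carrier G \<Longrightarrow> y \<in> carrier G \<Longrightarrow> dst x y = \<nu> (x \<otimes> inv y)"
  using nu_inv[of "inv x \<otimes> y"] by (simp add: norm_dist_def inv_mult_group nu_commute)

lemma dst_self [simp]: "x \<in> carrier G \<Longrightarrow> dst x x = 0"
  by (simp add: norm_dist_def)

lemma dst_sym: "x \<in> carrier G \<Longrightarrow> y \<in> carrier G \<Longrightarrow> dst x y = dst y x"
  using nu_inv[of "inv x \<otimes> y"] by (simp add: norm_dist_def inv_mult_group)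

lemma dst_nonneg: "x \<in> carrier G \<Longrightarrow> y \<in> carrier G \<Longrightarrow> 0 \<le> dst x y"
  by (simp add: norm_dist_def nu_nonneg)

lemma dst_triangle:
  assumes "x \<in> carrier G" "y \<in> carrier G" "z \<in> carrier G"
  shows "dst x z \<le> dst x y + dst y z"
proof -
  have "inv x \<otimes> z = (inv x \<otimes> y) \<otimes> (inv y \<otimes> z)"
    using assms by (metis inv_closed inv_solve_left m_assoc m_closed)
  then show ?thesis using assms nu_mult by (simp add: norm_dist_def)
qed

lemma dst_one_left [simp]: "x \<in> carrier G \<Longrightarrow> dst \<one> x = \<nu> x"
  by (simp add: norm_dist_def)

lemma nu_le_dst:
  assumes "x \<in> carrier G" "y \<in> carrier G" shows "\<nu> x \<le> \<nu> y + dst x y"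
  using dst_triangle[of \<one> y x] dst_sym[of x y] assms by simp

lemma nu_diff_le: "x \<in> carrier G \<Longrightarrow> y \<in> carrier G \<Longrightarrow> \<bar>\<nu> x - \<nu> y\<bar> \<le> dst x y"
  using nu_le_dst[of x y] nu_le_dst[of y x] dst_sym[of x y] by linarith

lemma dst_mult:
  assumes "a \<in> carrier G" "b \<in> carrier G" "a' \<in> carrier G" "b' \<in> carrier G"
  shows "dst (a \<otimes> b) (a' \<otimes> b') \<le> dst a a' + dst b b'"
proof -
  have "dst (a \<otimes> b) (a' \<otimes> b) = dst a a'"
    using assms nu_conj'[of b "inv a \<otimes> a'"] by (simp add: norm_dist_def inv_mult_group m_assoc)
  moreover have "dst (a' \<otimes> b) (a' \<otimes> b') = dst b b'"
  proof -
    have "inv a' \<otimes> (a' \<otimes> b') = b'" using assms by (simp add: m_assoc [symmetric])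
    then show ?thesis using assms by (simp add: norm_dist_def inv_mult_group m_assoc)
  qed
  ultimately show ?thesis
    using dst_triangle[of "a \<otimes> b" "a' \<otimes> b" "a' \<otimes> b'"] assms by simp
qed

lemma dst_inv: "a \<in> carrier G \<Longrightarrow> b \<in> carrier G \<Longrightarrow> dst (inv a) (inv b) = dst a b"
  using dst_sym[of a b] by (simp add: dst_alt[of b a] norm_dist_def nu_commute)

lemma list_mult_closed: "set xs \<subseteq> carrier G \<Longrightarrow> list_mult G xs \<in> carrier G"
  by (induction xs) (auto simp: list_mult_def)

lemma list_mult_append:
  "set xs \<subseteq> carrier G \<Longrightarrow> set ys \<subseteq> carrier G \<Longrightarrow>
   list_mult G (xs @ ys) = list_mult G xs \<otimes> list_mult G ys"
  using list_mult_closed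
  by (induction xs) (auto simp: list_mult_def m_assoc)

lemma dst_list_mult:
  assumes "\<And>x. x \<in> set xs \<Longrightarrow> f x \<in> carrier G \<and> g x \<in> carrier G \<and> dst (f x) (g x) \<le> b x"
  shows "dst (list_mult G (map f xs)) (list_mult G (map g xs)) \<le> (\<Sum>x\<leftarrow>xs. b x)"
  using assms
proof (induction xs)
  case (Cons x xs)
  have 1: "list_mult G (map f xs) \<in> carrier G" "list_mult G (map g xs) \<in> carrier G"
    using Cons.prems by (auto intro!: list_mult_closed)
  have "dst (f x \<otimes> list_mult G (map f xs)) (g x \<otimes> list_mult G (map g xs))
      \<le> dst (f x) (g x) + dst (list_mult G (map f xs)) (list_mult G (map g xs))"
    using 1 Cons.prems by (intro dst_mult) auto
  also have "\<dots> \<le> b x + (\<Sum>x\<leftarrow>xs. b x)"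
    using Cons by (intro add_mono) auto
  finally show ?case by (simp add: list_mult_def)
qed (simp add: list_mult_def)

lemma dst_pow:
  assumes "x \<in> carrier G" "y \<in> carrier G"
  shows "dst (x [^] (n::nat)) (y [^] n) \<le> real n * dst x y"
proof (induction n)
  case (Suc n)
  then show ?case
    using dst_mult[of "x [^] n" x "y [^] n" y] assms by (simp add: algebra_simps)
qed simp

lemma nu_pow_le: "x \<in> carrier G \<Longrightarrow> \<nu> (x [^] (n::nat)) \<le> real n * \<nu> x"
  using dst_pow[of \<one> x n] by simp

lemma nu_int_pow_le:
  assumes "x \<in> carrier G" shows "\<nu> (x [^] (k::int)) \<le> \<bar>of_int k\<bar> * \<nu> x"
proof (cases "k \<ge> 0")
  case True
  then obtain n where "k = int n" using nonneg_int_cases by blast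
  then show ?thesis using nu_pow_le[OF assms, of n] by (simp add: int_pow_int)
next
  case False
  then obtain n where "k = - int n" by (metis int_cases2 nle_le of_nat_0_le_iff)
  then show ?thesis using nu_pow_le[OF assms, of n] assms by (simp add: int_pow_int int_pow_neg)
qed

lemma nu_insert_le:
  assumes "x \<in> carrier G" "y \<in> carrier G" "z \<in> carrier G"
  shows "\<nu> (x \<otimes> (y \<otimes> z)) \<le> \<nu> (x \<otimes> z) + \<nu> y"
proof -
  have "x \<otimes> (y \<otimes> z) = (x \<otimes> y \<otimes> inv x) \<otimes> (x \<otimes> z)"
    using assms by (simp add: m_assoc) (simp add: m_assoc [symmetric])
  then show ?thesis
    using nu_mult[of "x \<otimes> y \<otimes> inv x" "x \<otimes> z"] nu_conj[of x y] assms by simp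
qed

end


subsection \<open>The quotient by the elements of pseudonorm zero\<close>

context conj_pseudonorm
begin

definition null :: "'a set" where "null = {x \<in> carrier G. \<nu> x = 0}"

lemma null_normal: "null \<lhd> G"
proof -
  have "subgroup null G"
  proof
    fix x y assume "x \<in> null" "y \<in> null"
    then show "x \<otimes> y \<in> null" 
      using nu_mult[of x y] nu_nonneg[of "x \<otimes> y"] by (auto simp: null_def)
  qed (auto simp: null_def)
  then show ?thesis
    unfolding normal_inv_iff by (auto simp: null_def nu_conj)
qed

lemma nu_coset: "x \<in> carrier G \<Longrightarrow> y \<in> null #> x \<Longrightarrow> y \<in> carrier G \<and> \<nu> y = \<nu> x"
proof -
  assume x: "x \<in> carrier G" and "y \<in> null #> x"
  then obtain z where z: "z \<in> carrier G" "\<nu> z = 0" "y = z \<otimes> x"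
    by (auto simp: r_coset_def null_def)
  have "\<nu> y \<le> \<nu> x" using nu_mult[of z x] x z by simp
  moreover have "\<nu> (inv z \<otimes> y) \<le> \<nu> y" using nu_mult[of "inv z" y] x z by simp
  moreover have "inv z \<otimes> y = x" using x z by (simp add: m_assoc [symmetric])
  ultimately show ?thesis using x z by simp
qed

lemma coset_self: "x \<in> carrier G \<Longrightarrow> x \<in> null #> x"
  by (rule rcos_self[OF _ normal_imp_subgroup[OF null_normal]])

lemma coset_norm: "x \<in> carrier G \<Longrightarrow> the_elem (\<nu> ` (null #> x)) = \<nu> x"
  by (rule the_elem_image_unique) (use nu_coset coset_self in blast)+

lemma coset_eq_iff:
  assumes "x \<in> carrier G" "y \<in> carrier G"
  shows "null #> x = null #> y \<longleftrightarrow> dst x y = 0"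
proof -
  have mem: "x \<otimes> inv y \<in> null \<longleftrightarrow> dst x y = 0"
    using assms by (auto simp: null_def dst_alt)
  interpret N: normal null G by (rule null_normal)
  have "null #> x = null #> y \<longleftrightarrow> x \<otimes> inv y \<in> null"
  proof
    assume "null #> x = null #> y"
    then have "x \<in> null #> y" using coset_self assms by auto
    then obtain z where "z \<in> null" "x = z \<otimes> y" by (auto simp: r_coset_def)
    then show "x \<otimes> inv y \<in> null" using assms N.mem_carrier by (simp add: m_assoc)
  next
    assume "x \<otimes> inv y \<in> null"
    moreover have "(x \<otimes> inv y) \<otimes> y = x" using assms by (simp add: m_assoc)
    ultimately have "x \<in> null #> y" using assms by (force simp: r_coset_def)
    then show "null #> x = null #> y"
      using repr_independence[OF _ assms(2) N.is_subgroup] by simp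
  qed
  with mem show ?thesis by blast
qed

lemma quotient_carrier: "carrier (G Mod null) = (\<lambda>x. null #> x) ` carrier G"
  by (auto simp: FactGroup_def RCOSETS_def)

lemma quotient_mult:
  "x \<in> carrier G \<Longrightarrow> y \<in> carrier G \<Longrightarrow>
   (null #> x) <#> (null #> y) = null #> (x \<otimes> y)"
  by (rule normal.rcos_sum[OF null_normal])

lemma quotient_dist:
  assumes "x \<in> carrier G" "y \<in> carrier G"
  shows "norm_dist (G Mod null) (\<lambda>P. the_elem (\<nu> ` P)) (null #> x) (null #> y) = dst x y"
proof -
  interpret N: normal null G by (rule null_normal)
  have "inv\<^bsub>G Mod null\<^esub> (null #> x) = null #> inv x"
    using assms by (subst N.inv_FactGroup) (auto simp: quotient_carrier N.rcos_inv)
  then show ?thesis using assms by (simp add: norm_dist_def quotient_mult coset_norm)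
qed

end

text \<open>The directional and the ultrafilter cones are quotients by null subgroups, and the maps
  between them are induced by maps of representatives; this locale passes from representatives
  to classes.\<close>

locale null_hom = G: conj_pseudonorm G \<nu> + H: conj_pseudonorm H \<mu>
  for G :: "('a, 'm) monoid_scheme" and \<nu> and H :: "('b, 'n) monoid_scheme" and \<mu> +
  fixes f :: "'a \<Rightarrow> 'b"
  assumes hom: "f \<in> hom G H"
    and null_null: "x \<in> carrier G \<Longrightarrow> \<nu> x = 0 \<Longrightarrow> \<mu> (f x) = 0"
begin

definition fquot :: "'a set \<Rightarrow> 'b set" where
  "fquot P = the_elem ((\<lambda>x. H.null #>\<^bsub>H\<^esub> f x) ` P)"

lemma f_closed: "x \<in> carrier G \<Longrightarrow> f x \<in> carrier H"
  using hom by (auto simp: hom_def)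

lemma f_dist: "x \<in> carrier G \<Longrightarrow> y \<in> carrier G \<Longrightarrow> H.dst (f x) (f y) = \<mu> (f (inv\<^bsub>G\<^esub> x \<otimes>\<^bsub>G\<^esub> y))"
proof -
  interpret group_hom G H f using hom by unfold_locales
  assume "x \<in> carrier G" "y \<in> carrier G"
  then show ?thesis by (simp add: norm_dist_def)
qed

lemma fquot_coset:
  assumes "x \<in> carrier G" shows "fquot (G.null #>\<^bsub>G\<^esub> x) = H.null #>\<^bsub>H\<^esub> f x"
  unfolding fquot_def
proof (rule the_elem_image_unique)
  show "G.null #>\<^bsub>G\<^esub> x \<noteq> {}" using G.coset_self[OF assms] by auto
  fix y assume y: "y \<in> G.null #>\<^bsub>G\<^esub> x"
  have y': "y \<in> carrier G" using G.nu_coset[OF assms y] by simp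
  have "G.null #>\<^bsub>G\<^esub> y = G.null #>\<^bsub>G\<^esub> x"
    using G.repr_independence[OF y assms normal_imp_subgroup[OF G.null_normal]] by simp
  then have "\<nu> (inv\<^bsub>G\<^esub> y \<otimes>\<^bsub>G\<^esub> x) = 0" 
    using G.coset_eq_iff y' assms by (simp add: norm_dist_def)
  then have "H.dst (f y) (f x) = 0" using f_dist null_null y' assms by simp
  then show "H.null #>\<^bsub>H\<^esub> f y = H.null #>\<^bsub>H\<^esub> f x"
    using H.coset_eq_iff f_closed y' assms by simp
qed

lemma fquot_hom: "fquot \<in> hom (G Mod G.null) (H Mod H.null)"
proof (rule homI)
  fix P Q assume "P \<in> carrier (G Mod G.null)" "Q \<in> carrier (G Mod G.null)"
  then obtain x y where xy: "x \<in> carrier G" "y \<in> carrier G"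
    "P = G.null #>\<^bsub>G\<^esub> x" "Q = G.null #>\<^bsub>G\<^esub> y" by (auto simp: G.quotient_carrier)
  show "fquot P \<in> carrier (H Mod H.null)"
    using xy f_closed by (auto simp: fquot_coset H.quotient_carrier)
  show "fquot (P \<otimes>\<^bsub>G Mod G.null\<^esub> Q) = fquot P \<otimes>\<^bsub>H Mod H.null\<^esub> fquot Q"
    using xy f_closed hom
    by (simp add: fquot_coset G.quotient_mult H.quotient_mult hom_mult)
qed

lemma fquot_inj:
  assumes "\<And>x. x \<in> carrier G \<Longrightarrow> \<mu> (f x) = 0 \<Longrightarrow> \<nu> x = 0"
  shows "inj_on fquot (carrier (G Mod G.null))"
proof (rule inj_onI)
  fix P Q assume "P \<in> carrier (G Mod G.null)" "Q \<in> carrier (G Mod G.null)"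
    and eq: "fquot P = fquot Q"
  then obtain x y where xy: "x \<in> carrier G" "y \<in> carrier G"
    "P = G.null #>\<^bsub>G\<^esub> x" "Q = G.null #>\<^bsub>G\<^esub> y" by (auto simp: G.quotient_carrier)
  have "H.dst (f x) (f y) = 0" using eq xy H.coset_eq_iff f_closed by (simp add: fquot_coset)
  then have "\<nu> (inv\<^bsub>G\<^esub> x \<otimes>\<^bsub>G\<^esub> y) = 0" using assms f_dist xy by simp
  then show "P = Q" using xy G.coset_eq_iff by (simp add: norm_dist_def)
qed

lemma fquot_isometry:
  assumes iso: "\<And>x. x \<in> carrier G \<Longrightarrow> \<mu> (f x) = \<nu> x"
    and onto: "\<And>y. y \<in> carrier H \<Longrightarrow> \<exists>x\<in>carrier G. H.dst (f x) y = 0"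
  shows "is_isometry (G Mod G.null) (\<lambda>P. the_elem (\<nu> ` P)) (H Mod H.null) (\<lambda>P. the_elem (\<mu> ` P)) fquot"
  unfolding is_isometry_def
proof (intro conjI ballI bij_betw_imageI)
  show "inj_on fquot (carrier (G Mod G.null))" using iso by (intro fquot_inj) simp
  show "fquot ` carrier (G Mod G.null) = carrier (H Mod H.null)"
  proof
    show "fquot ` carrier (G Mod G.null) \<subseteq> carrier (H Mod H.null)"
      using fquot_hom by (auto simp: hom_def)
    show "carrier (H Mod H.null) \<subseteq> fquot ` carrier (G Mod G.null)"
    proof
      fix Q assume "Q \<in> carrier (H Mod H.null)"
      then obtain y where y: "y \<in> carrier H" "Q = H.null #>\<^bsub>H\<^esub> y"
        by (auto simp: H.quotient_carrier)
      obtain x where x: "x \<in> carrier G" "H.dst (f x) y = 0" using onto y by blast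
      then have "fquot (G.null #>\<^bsub>G\<^esub> x) = Q"
        using y H.coset_eq_iff f_closed by (simp add: fquot_coset)
      then show "Q \<in> fquot ` carrier (G Mod G.null)" using x by (auto simp: G.quotient_carrier)
    qed
  qed
next
  fix P Q assume "P \<in> carrier (G Mod G.null)" "Q \<in> carrier (G Mod G.null)"
  then obtain x y where xy: "x \<in> carrier G" "y \<in> carrier G"
    "P = G.null #>\<^bsub>G\<^esub> x" "Q = G.null #>\<^bsub>G\<^esub> y" by (auto simp: G.quotient_carrier)
  show "norm_dist (H Mod H.null) (\<lambda>P. the_elem (\<mu> ` P)) (fquot P) (fquot Q) =
      norm_dist (G Mod G.null) (\<lambda>P. the_elem (\<nu> ` P)) P Q"
    using xy f_closed f_dist iso
    by (simp add: fquot_coset H.quotient_dist G.quotient_dist) (simp add: norm_dist_def)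
qed

end


section \<open>Homogeneous Lipschitz functions\<close>

context conj_pseudonorm
begin

text \<open>The function measures, asymptotically and per unit of \<open>x\<close>, how far the powers of \<open>x\<close> are
  from the ray of positive powers of \<open>c\<close>. For \<open>c = 1\<close> it is the stable norm of \<open>x\<close>, since
  \<open>\<nu>(x\<^sup>n)\<close> is subadditive in \<open>n\<close>.\<close>

definition ray :: "'a \<Rightarrow> 'a \<Rightarrow> real" where
  "ray c x = (INF (n, m)\<in>{1::nat..} \<times> (UNIV::nat set). dst (c [^] m) (x [^] n) / real n)"

abbreviation stable :: "'a \<Rightarrow> real" where "stable \<equiv> ray \<one>"

lemma ray_bdd: "c \<in> carrier G \<Longrightarrow> x \<in> carrier G \<Longrightarrow>
   bdd_below ((\<lambda>(n, m). dst (c [^] m) (x [^] n) / real n) ` ({1::nat..} \<times> (UNIV::nat set)))"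
  by (rule bdd_belowI[of _ 0]) (auto simp: dst_nonneg)

lemma ray_le:
  assumes "c \<in> carrier G" "x \<in> carrier G"
  shows "real n * ray c x \<le> dst (c [^] (m::nat)) (x [^] (n::nat))"
proof (cases "n = 0")
  case False
  have "ray c x \<le> dst (c [^] m) (x [^] n) / real n"
    unfolding ray_def using ray_bdd[OF assms] False
    by (intro cINF_lower2[of _ _ "(n, m)"]) auto
  then show ?thesis using False by (simp add: field_simps)
qed (use assms in \<open>simp add: dst_nonneg\<close>)

lemma ray_approx:
  assumes "ray c x < b"
  obtains n m :: nat where "n \<ge> 1" "dst (c [^] m) (x [^] n) < real n * b"
proof -
  have "\<exists>p\<in>{1::nat..} \<times> (UNIV::nat set). (\<lambda>(n, m). dst (c [^] m) (x [^] n) / real n) p < b"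
  proof (rule ccontr)
    assume "\<not> ?thesis"
    then have "b \<le> ray c x" unfolding ray_def by (intro cINF_greatest) (auto simp: not_less)
    with assms show False by simp
  qed
  then show ?thesis using that by (auto simp: field_simps)
qed

lemma ray_nonneg: "c \<in> carrier G \<Longrightarrow> x \<in> carrier G \<Longrightarrow> 0 \<le> ray c x"
  unfolding ray_def by (rule cINF_greatest) (auto simp: dst_nonneg)

lemma stable_le: "x \<in> carrier G \<Longrightarrow> real n * stable x \<le> \<nu> (x [^] n)"
  using ray_le[of \<one> x n 0] by simp

lemma stable_le_nu: "x \<in> carrier G \<Longrightarrow> stable x \<le> \<nu> x"
  using stable_le[of x 1] by simp

lemma stable_inv: "x \<in> carrier G \<Longrightarrow> stable (inv x) = stable x"
  by (simp add: ray_def nat_pow_inv)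

lemma ray_Lipschitz:
  assumes c: "c \<in> carrier G" and x: "x \<in> carrier G" and y: "y \<in> carrier G"
  shows "ray c x \<le> ray c y + dst x y"
proof (rule field_le_epsilon)
  fix e :: real assume "e > 0"
  then obtain n m where n: "n \<ge> (1::nat)" and *: "dst (c [^] (m::nat)) (y [^] n) < real n * (ray c y + e)"
    using ray_approx[of c y "ray c y + e"] by auto
  have "real n * ray c x \<le> dst (c [^] m) (x [^] n)" by (rule ray_le[OF c x])
  also have "\<dots> \<le> dst (c [^] m) (y [^] n) + dst (y [^] n) (x [^] n)"
    using assms by (intro dst_triangle) auto
  also have "dst (y [^] n) (x [^] n) \<le> real n * dst x y"
    using dst_pow[OF y x, of n] dst_sym[OF x y] by simp
  finally have "real n * ray c x \<le> real n * (ray c y + dst x y + e)"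
    using * by (simp add: algebra_simps)
  then show "ray c x \<le> ray c y + dst x y + e" using n by simp
qed

lemma ray_pow:
  assumes c: "c \<in> carrier G" and x: "x \<in> carrier G"
  shows "ray c (x [^] (k::nat)) = real k * ray c x"
proof (rule antisym)
  show "ray c (x [^] k) \<le> real k * ray c x"
  proof (cases "k = 0")
    case True
    then show ?thesis using ray_le[OF c one_closed, of 1 0] c by simp
  next
    case False
    show ?thesis
    proof (rule field_le_epsilon)
      fix e :: real assume "e > 0"
      with False have "ray c x < ray c x + e / real k" by simp
      then obtain n m where n: "n \<ge> (1::nat)"
        and *: "dst (c [^] (m::nat)) (x [^] n) < real n * (ray c x + e / real k)"
        using ray_approx by blast
      have "real n * ray c (x [^] k) \<le> dst (c [^] (m * k)) ((x [^] k) [^] n)"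
        using c x by (intro ray_le) auto
      also have "\<dots> = dst ((c [^] m) [^] k) ((x [^] n) [^] k)"
        using c x by (simp add: nat_pow_pow mult.commute)
      also have "\<dots> \<le> real k * dst (c [^] m) (x [^] n)" using c x by (intro dst_pow) auto
      also have "\<dots> \<le> real k * (real n * (ray c x + e / real k))"
        using * by (intro mult_left_mono) auto
      also have "\<dots> = real n * (real k * ray c x + e)" using False by (simp add: field_simps)
      finally show "ray c (x [^] k) \<le> real k * ray c x + e" using n by simp
    qed
  qed
  show "real k * ray c x \<le> ray c (x [^] k)"
  proof (rule field_le_epsilon)
    fix e :: real assume "e > 0"
    then obtain n m where n: "n \<ge> (1::nat)"
      and *: "dst (c [^] (m::nat)) ((x [^] k) [^] n) < real n * (ray c (x [^] k) + e)"
      using ray_approx[of c "x [^] k" "ray c (x [^] k) + e"] by auto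
    have "real (k * n) * ray c x \<le> dst (c [^] m) (x [^] (k * n))" by (rule ray_le[OF c x])
    also have "\<dots> \<le> real n * (ray c (x [^] k) + e)" using * x by (simp add: nat_pow_pow)
    finally have "real n * (real k * ray c x) \<le> real n * (ray c (x [^] k) + e)"
      by (simp add: algebra_simps)
    then show "real k * ray c x \<le> ray c (x [^] k) + e" using n by simp
  qed
qed

text \<open>The powers of \<open>x\<close> and of its conjugate stay at bounded distance, while a homogeneous function
  that took different values on them would separate these powers linearly.\<close>

lemma homogeneous_Lipschitz_conj:
  fixes f :: "'a \<Rightarrow> real"
  assumes hom: "\<And>x k. x \<in> carrier G \<Longrightarrow> f (x [^] (k::int)) = of_int k * f x"
    and lip: "\<And>x y. x \<in> carrier G \<Longrightarrow> y \<in> carrier G \<Longrightarrow> \<bar>f x - f y\<bar> \<le> C * dst x y"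
    and h: "h \<in> carrier G" and x: "x \<in> carrier G" and C: "0 \<le> C"
  shows "f (h \<otimes> x \<otimes> inv h) = f x"
proof (rule ccontr)
  let ?y = "h \<otimes> x \<otimes> inv h"
  assume ne: "f ?y \<noteq> f x"
  have pow: "?y [^] n = h \<otimes> x [^] n \<otimes> inv h" for n :: nat
  proof (induction n)
    case (Suc n)
    have "inv h \<otimes> (h \<otimes> (x \<otimes> inv h)) = x \<otimes> inv h" using h x by (simp add: m_assoc [symmetric])
    then show ?case using Suc h x by (simp add: m_assoc)
  qed (use h in simp)
  have bd: "real n * \<bar>f ?y - f x\<bar> \<le> C * (2 * \<nu> h)" for n :: nat
  proof -
    have "real n * \<bar>f ?y - f x\<bar> = \<bar>real n * f ?y - real n * f x\<bar>"
      by (simp add: abs_mult flip: right_diff_distrib)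
    also have "\<dots> = \<bar>f (?y [^] n) - f (x [^] n)\<bar>"
      using hom[of ?y "int n"] hom[of x "int n"] h x by (simp add: int_pow_int)
    also have "\<dots> \<le> C * dst (?y [^] n) (x [^] n)" using h x by (intro lip) auto
    also have "dst (?y [^] n) (x [^] n) \<le> dst h \<one> + dst (x [^] n) (x [^] n) + dst (inv h) \<one>"
      using dst_mult[of "h \<otimes> x [^] n" "inv h" "x [^] n" \<one>] dst_mult[of h "x [^] n" \<one> "x [^] n"] h x
      by (simp add: pow)
    also have "\<dots> = 2 * \<nu> h" using h x dst_sym[of h \<one>] dst_sym[of "inv h" \<one>] by simp
    finally show ?thesis using C by (simp add: mult_left_mono)
  qed
  obtain n :: nat where "real n * \<bar>f ?y - f x\<bar> > C * (2 * \<nu> h)"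
    using reals_Archimedean3[of "\<bar>f ?y - f x\<bar>"] ne by auto
  then show False using bd[of n] by simp
qed

text \<open>The stable norm minus a large multiple of the distance to the ray of \<open>c\<close> is homogeneous and
  Lipschitz, and its positive part is a bump around that ray; subtracting the bump around
  the ray of \<open>c\<inverse>\<close> makes it odd. Rays of separated elements diverge linearly, so for a sufficiently
  large multiple the bumps are disjoint. The bound by the stable norm holds with the same constant
  for every choice of \<open>P\<close>, and this uniformity is what the application needs.\<close>

lemma homogeneous_bump_functions:
  assumes fin: "finite P" and P: "P \<subseteq> carrier G" and pos: "\<And>c. c \<in> P \<Longrightarrow> 0 < stable c"
    and sep: "\<And>c c'. c \<in> P \<Longrightarrow> c' \<in> P \<Longrightarrow> c \<noteq> c' \<Longrightarrow>
       \<exists>\<delta>>0. \<forall>n m. \<delta> * \<bar>of_int n\<bar> \<le> \<nu> (c [^] (n::int) \<otimes> c' [^] (m::int))"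
  obtains lam :: "'a \<Rightarrow> 'a \<Rightarrow> real" and C :: real where "0 \<le> C"
    "\<And>c x k. c \<in> P \<Longrightarrow> x \<in> carrier G \<Longrightarrow> lam c (x [^] (k::int)) = of_int k * lam c x"
    "\<And>c x y. c \<in> P \<Longrightarrow> x \<in> carrier G \<Longrightarrow> y \<in> carrier G \<Longrightarrow> \<bar>lam c x - lam c y\<bar> \<le> C * dst x y"
    "\<And>c. c \<in> P \<Longrightarrow> lam c c = 1"
    "\<And>c x. c \<in> P \<Longrightarrow> x \<in> carrier G \<Longrightarrow> \<bar>lam c x\<bar> * stable c \<le> stable x"
    "\<And>c c' x. c \<in> P \<Longrightarrow> c' \<in> P \<Longrightarrow> c \<noteq> c' \<Longrightarrow> x \<in> carrier G \<Longrightarrow> lam c x = 0 \<or> lam c' x = 0"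
proof -
  obtain \<delta> where \<delta>: "\<And>c c'. c \<in> P \<Longrightarrow> c' \<in> P \<Longrightarrow> c \<noteq> c' \<Longrightarrow> \<delta> c c' > 0 \<and>
       (\<forall>n m. \<delta> c c' * \<bar>of_int n\<bar> \<le> \<nu> (c [^] (n::int) \<otimes> c' [^] (m::int)))"
    using sep by metis
  \<comment> \<open>Chosen so that an element lying in two bumps contradicts the separation constant of their centres.\<close>
  define K where "K = 2 + (\<Sum>(c, c')\<in>P \<times> P. \<bar>8 * \<nu> c / \<delta> c c'\<bar>)"
  have K2: "K \<ge> 2" unfolding K_def by (simp add: sum_nonneg case_prod_beta)
  have K: "8 * \<nu> c \<le> K * \<delta> c c'" if "c \<in> P" "c' \<in> P" "c \<noteq> c'" for c c'
  proof -
    have "\<bar>8 * \<nu> c / \<delta> c c'\<bar> \<le> (\<Sum>(c, c')\<in>P \<times> P. \<bar>8 * \<nu> c / \<delta> c c'\<bar>)"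
      using member_le_sum[of "(c, c')" "P \<times> P" "\<lambda>(c, c'). \<bar>8 * \<nu> c / \<delta> c c'\<bar>"] that fin by auto
    then have "8 * \<nu> c / \<delta> c c' \<le> K" unfolding K_def by linarith
    then show ?thesis using \<delta>[OF that] by (simp add: field_simps)
  qed
  define \<mu> where "\<mu> c x = max 0 (stable x - K * ray c x)" for c x
  define lam where "lam c x = (\<mu> c x - \<mu> c (inv x)) / stable c" for c x
  have mu_pow: "\<mu> c (x [^] (k::nat)) = real k * \<mu> c x" if "c \<in> P" "x \<in> carrier G" for c x k
    using ray_pow[OF subsetD[OF P that(1)] that(2), of k] ray_pow[OF one_closed that(2), of k]
    by (auto simp: \<mu>_def max_mult_distrib_left right_diff_distrib mult.left_commute)
  have lam_pow: "lam c (x [^] (k::nat)) = real k * lam c x" if "c \<in> P" "x \<in> carrier G" for c x k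
    using that mu_pow[of c x k] mu_pow[of c "inv x" k]
    by (simp add: lam_def nat_pow_inv right_diff_distrib)
  have lam_inv: "lam c (inv x) = - lam c x" if "x \<in> carrier G" for c x
    using that by (simp add: lam_def minus_divide_left)
  have mu_lip: "\<bar>\<mu> c x - \<mu> c y\<bar> \<le> (1 + K) * dst x y"
    if "c \<in> P" "x \<in> carrier G" "y \<in> carrier G" for c x y
  proof -
    have c: "c \<in> carrier G" using that P by auto
    have 1: "\<bar>stable x - stable y\<bar> \<le> dst x y" "\<bar>ray c x - ray c y\<bar> \<le> dst x y"
      using ray_Lipschitz[of _ x y] ray_Lipschitz[of _ y x] that c dst_sym[of x y]
      by (auto simp: abs_le_iff algebra_simps)
    have "\<bar>\<mu> c x - \<mu> c y\<bar> \<le> \<bar>stable x - stable y\<bar> + \<bar>K * (ray c x - ray c y)\<bar>"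
      unfolding \<mu>_def right_diff_distrib by linarith
    also have "\<bar>K * (ray c x - ray c y)\<bar> = K * \<bar>ray c x - ray c y\<bar>" using K2 by (simp add: abs_mult)
    also have "\<dots> \<le> K * dst x y" using 1 K2 by (intro mult_left_mono) auto
    finally show ?thesis using 1 by (simp add: algebra_simps)
  qed
  define C where "C = (\<Sum>c\<in>P. 2 * (1 + K) / stable c)"
  have C: "2 * (1 + K) / stable c \<le> C" if "c \<in> P" for c
    unfolding C_def using fin that pos K2 
    by (intro member_le_sum) (auto intro!: divide_nonneg_nonneg less_imp_le)
  show ?thesis
  proof (rule that[of C lam])
    show "0 \<le> C" unfolding C_def using pos K2
      by (intro sum_nonneg divide_nonneg_nonneg) (auto intro: less_imp_le)
  next
    fix c x and k :: int assume cx: "c \<in> P" "x \<in> carrier G"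
    show "lam c (x [^] k) = of_int k * lam c x"
    proof (cases "k \<ge> 0")
      case True
      then obtain n where "k = int n" using nonneg_int_cases by blast
      then show ?thesis using lam_pow[OF cx, of n] by (simp add: int_pow_int)
    next
      case False
      then obtain n where k: "k = - int n" by (metis int_cases2 nle_le of_nat_0_le_iff)
      have "lam c (inv (x [^] n)) = - (real n * lam c x)" using lam_inv lam_pow cx by simp
      then show ?thesis using k cx by (simp add: int_pow_neg int_pow_int)
    qed
  next
    fix c x y assume cxy: "c \<in> P" "x \<in> carrier G" "y \<in> carrier G"
    have "\<bar>lam c x - lam c y\<bar> = \<bar>(\<mu> c x - \<mu> c y) - (\<mu> c (inv x) - \<mu> c (inv y))\<bar> / stable c"
      using pos[OF cxy(1)] by (simp add: lam_def abs_divide flip: diff_divide_distrib)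
    also have "\<dots> \<le> (2 * (1 + K) * dst x y) / stable c"
    proof (rule divide_right_mono)
      show "\<bar>(\<mu> c x - \<mu> c y) - (\<mu> c (inv x) - \<mu> c (inv y))\<bar> \<le> 2 * (1 + K) * dst x y"
        using mu_lip[OF cxy]
          mu_lip[OF cxy(1) inv_closed[OF cxy(2)] inv_closed[OF cxy(3)], unfolded dst_inv[OF cxy(2,3)]]
        by (simp add: algebra_simps)
    qed (use pos[OF cxy(1)] in simp)
    also have "\<dots> \<le> C * dst x y"
      using mult_right_mono[OF C[OF cxy(1)] dst_nonneg[OF cxy(2,3)]] by simp
    finally show "\<bar>lam c x - lam c y\<bar> \<le> C * dst x y" .
  next
    fix c assume cP: "c \<in> P"
    then have c: "c \<in> carrier G" using P by auto
    have "ray c c = 0" using ray_le[OF c c, of 1 1] ray_nonneg[OF c c] c by simp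
    then have 1: "\<mu> c c = stable c" using pos[OF cP] by (simp add: \<mu>_def)
    have "stable c \<le> ray c (inv c)"
    proof (rule field_le_epsilon)
      fix e :: real assume "e > 0"
      then obtain n m where n: "n \<ge> (1::nat)"
        and *: "dst (c [^] (m::nat)) ((inv c) [^] n) < real n * (ray c (inv c) + e)"
        using ray_approx[of c "inv c" "ray c (inv c) + e"] by auto
      have "real n * stable c \<le> real (m + n) * stable c"
        using pos[OF cP] by (intro mult_right_mono) auto
      also have "\<dots> \<le> \<nu> (c [^] (m + n))" by (rule stable_le[OF c])
      also have "\<dots> = dst (c [^] m) ((inv c) [^] n)"
        using c by (simp add: dst_alt nat_pow_inv nat_pow_mult)
      finally have "real n * stable c \<le> real n * (ray c (inv c) + e)" using * by simp
      then show "stable c \<le> ray c (inv c) + e" using n by simp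
    qed
    moreover have "1 * ray c (inv c) \<le> K * ray c (inv c)"
      using K2 c by (intro mult_right_mono ray_nonneg) auto
    ultimately have "\<mu> c (inv c) = 0" using c by (simp add: \<mu>_def stable_inv)
    with 1 show "lam c c = 1" using pos[OF cP] by (simp add: lam_def)
  next
    fix c x assume cx: "c \<in> P" "x \<in> carrier G"
    then have c: "c \<in> carrier G" using P by auto
    have "0 \<le> \<mu> c y \<and> \<mu> c y \<le> stable y" if "y \<in> carrier G" for y
      using that ray_nonneg[OF c that] ray_nonneg[OF one_closed that] K2 by (simp add: \<mu>_def)
    from this[OF cx(2)] this[OF inv_closed[OF cx(2)]]
    have "\<bar>\<mu> c x - \<mu> c (inv x)\<bar> \<le> stable x"
      unfolding stable_inv[OF cx(2)] by linarith
    then show "\<bar>lam c x\<bar> * stable c \<le> stable x" using pos[OF cx(1)] by (simp add: lam_def)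
  next
    fix c c' x assume cP: "c \<in> P" "c' \<in> P" "c \<noteq> c'" and x: "x \<in> carrier G"
    have c: "c \<in> carrier G" "c' \<in> carrier G" using cP P by auto
    have near: "\<exists>(n::nat) (m::int). n \<ge> 1 \<and> dst (a [^] m) (x [^] n) < real n * (stable x / K) \<and> stable x > 0"
      if "a \<in> P" "lam a x \<noteq> 0" for a
    proof -
      have a: "a \<in> carrier G" using that P by auto
      have gen: "\<exists>(n::nat) (m::nat). n \<ge> 1 \<and> dst (a [^] m) (y [^] n) < real n * (stable x / K) \<and> stable x > 0"
        if y: "y \<in> carrier G" "\<mu> a y \<noteq> 0" "stable y = stable x" for y
      proof -
        have 1: "K * ray a y < stable x" using y by (auto simp: \<mu>_def max_def split: if_splits)
        then have 2: "ray a y < stable x / K" using K2 by (simp add: field_simps)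
        have "0 \<le> K * ray a y" using ray_nonneg[OF a y(1)] K2 by simp
        then have "stable x > 0" using 1 by linarith
        moreover obtain n m :: nat where "n \<ge> 1" "dst (a [^] m) (y [^] n) < real n * (stable x / K)"
          by (rule ray_approx[OF 2])
        ultimately show ?thesis by blast
      qed
      have "\<mu> a x \<noteq> 0 \<or> \<mu> a (inv x) \<noteq> 0" using that by (auto simp: lam_def)
      then show ?thesis
      proof
        assume "\<mu> a x \<noteq> 0"
        from gen[OF x this] obtain n m :: nat where "n \<ge> 1"
          "dst (a [^] m) (x [^] n) < real n * (stable x / K) \<and> stable x > 0" by auto
        then show ?thesis by (intro exI[of _ n] exI[of _ "int m"]) (simp add: int_pow_int)
      next
        assume "\<mu> a (inv x) \<noteq> 0"
        from gen[OF _ this] obtain n m :: nat where *: "n \<ge> 1"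
          "dst (a [^] m) (inv x [^] n) < real n * (stable x / K) \<and> stable x > 0"
          using x by (auto simp: stable_inv)
        have "dst (a [^] m) (inv x [^] n) = dst (a [^] (- int m)) (x [^] n)"
          using dst_inv[of "inv (a [^] m)" "x [^] n"] a x
          by (simp add: int_pow_neg int_pow_int nat_pow_inv)
        with * show ?thesis by (intro exI[of _ n] exI[of _ "- int m"]) simp
      qed
    qed
    show "lam c x = 0 \<or> lam c' x = 0"
    proof (rule ccontr)
      assume "\<not> ?thesis"
      then have ne: "lam c x \<noteq> 0" "lam c' x \<noteq> 0" by auto
      let ?t = "stable x"
      obtain n m where nm: "n \<ge> 1" "dst (c [^] (m::int)) (x [^] (n::nat)) < real n * (?t / K)" "?t > 0"
        using near[OF cP(1) ne(1)] by auto
      obtain n' m' where nm': "n' \<ge> 1" "dst (c' [^] (m'::int)) (x [^] (n'::nat)) < real n' * (?t / K)"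
        using near[OF cP(2) ne(2)] by auto
      have up: "dst (c [^] (m * int n')) (x [^] (n * n')) \<le> real n' * (real n * (?t / K))"
        if "c \<in> carrier G" "dst (c [^] m) (x [^] n) < real n * (?t / K)" for c m and n n' :: nat
      proof -
        have "dst (c [^] (m * int n')) (x [^] (n * n')) = dst ((c [^] m) [^] n') ((x [^] n) [^] n')"
          using that x by (simp add: nat_pow_pow int_pow_pow flip: int_pow_int)
        also have "\<dots> \<le> real n' * dst (c [^] m) (x [^] n)" using that x by (intro dst_pow) auto
        also have "\<dots> \<le> real n' * (real n * (?t / K))" using that by (intro mult_left_mono) auto
        finally show ?thesis .
      qed
      let ?N = "real n * real n'"
      have "dst (c [^] (m * int n')) (c' [^] (m' * int n)) \<le>
          dst (c [^] (m * int n')) (x [^] (n * n')) + dst (c' [^] (m' * int n)) (x [^] (n' * n))"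
        using dst_triangle[of "c [^] (m * int n')" "x [^] (n * n')" "c' [^] (m' * int n)"] c x
          dst_sym[of "c' [^] (m' * int n)" "x [^] (n * n')"] by (simp add: mult.commute)
      also have "\<dots> \<le> 2 * (?N * (?t / K))"
      proof -
        have "real n' * (real n * (?t / K)) = ?N * (?t / K)" "real n * (real n' * (?t / K)) = ?N * (?t / K)"
          by simp_all
        then show ?thesis using up[OF c(1) nm(2), of n'] up[OF c(2) nm'(2), of n] by linarith
      qed
      finally have 1: "dst (c [^] (m * int n')) (c' [^] (m' * int n)) \<le> 2 * (?N * (?t / K))" .
      have "dst (c [^] (m * int n')) (c' [^] (m' * int n))
          = \<nu> (c [^] (m * int n') \<otimes> c' [^] (- (m' * int n)))"
        using c by (simp add: dst_alt int_pow_neg)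
      note eq = this
      have 2: "\<delta> c c' * (\<bar>of_int m\<bar> * real n') \<le> 2 * (?N * (?t / K))"
      proof -
        have "\<delta> c c' * \<bar>of_int (m * int n')\<bar>
            \<le> \<nu> (c [^] (m * int n') \<otimes> c' [^] (- (m' * int n)))" using \<delta>[OF cP] by blast
        then show ?thesis using 1 unfolding eq by (simp add: abs_mult)
      qed
      have "real n * ?t \<le> \<nu> (x [^] n)" by (rule stable_le[OF x])
      also have "\<dots> \<le> \<nu> (c [^] m) + dst (c [^] m) (x [^] n)"
        using nu_le_dst[of "x [^] n" "c [^] m"] dst_sym[of "x [^] n" "c [^] m"] c x by simp
      also have "\<nu> (c [^] m) \<le> \<bar>of_int m\<bar> * \<nu> c" by (rule nu_int_pow_le[OF c(1)])
      also have "dst (c [^] m) (x [^] n) \<le> real n * (?t / 2)"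
      proof -
        have "?t / K \<le> ?t / 2" using nm K2 by (intro frac_le) auto
        then have "real n * (?t / K) \<le> real n * (?t / 2)" by (intro mult_left_mono) auto
        then show ?thesis using nm by linarith
      qed
      finally have 3: "real n * ?t \<le> 2 * (\<bar>of_int m\<bar> * \<nu> c)" by (simp add: field_simps)
      have pos': "?N * ?t > 0" using nm nm' by simp
      have d: "\<delta> c c' > 0" using \<delta>[OF cP] by simp
      have "8 * \<nu> c * (\<bar>of_int m\<bar> * real n') \<le> K * (\<delta> c c' * (\<bar>of_int m\<bar> * real n'))"
        using mult_right_mono[OF K[OF cP], of "\<bar>of_int m\<bar> * real n'"] by (simp add: mult.assoc)
      also have "\<dots> \<le> K * (2 * (?N * (?t / K)))" using 2 K2 by (intro mult_left_mono) auto
      also have "\<dots> = 2 * (?N * ?t)" using K2 by simp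
      finally have 4: "4 * \<nu> c * (\<bar>of_int m\<bar> * real n') \<le> ?N * ?t"
        by (simp add: mult_ac)
      have "real n' * (real n * ?t) \<le> real n' * (2 * (\<bar>of_int m\<bar> * \<nu> c))"
        using 3 by (intro mult_left_mono) auto
      then have 5: "?N * ?t \<le> 2 * \<nu> c * (\<bar>of_int m\<bar> * real n')" by (simp add: mult_ac)
      show False using 4 5 pos' by linarith
    qed
  qed
qed

end


section \<open>Norms generated by weighted conjugacy classes\<close>

text \<open>The pseudonorm on the free product and the word norm have the same form: the least total weight
  of a factorization into conjugates of weighted generators.\<close>

locale weighted_set = group K for K (structure) +
  fixes S :: "'a \<Rightarrow> real \<Rightarrow> bool"
  assumes S_closed: "S s c \<Longrightarrow> s \<in> carrier K" and S_nonneg: "S s c \<Longrightarrow> 0 \<le> c"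
    and S_inv: "S s c \<Longrightarrow> S (inv s) c"
begin

inductive conj_cost :: "'a \<Rightarrow> real \<Rightarrow> bool" where
  one: "conj_cost \<one> 0"
| conj: "conj_cost x c \<Longrightarrow> h \<in> carrier K \<Longrightarrow> S s d \<Longrightarrow> conj_cost (h \<otimes> s \<otimes> inv h \<otimes> x) (d + c)"

definition conj_norm :: "'a \<Rightarrow> real" where "conj_norm x = Inf {c. conj_cost x c}"

lemma conj_cost_closed: "conj_cost x c \<Longrightarrow> x \<in> carrier K \<and> 0 \<le> c"
  by (induction rule: conj_cost.induct) (auto simp: S_closed S_nonneg)

lemma conj_cost_mult: "conj_cost x c \<Longrightarrow> conj_cost y d \<Longrightarrow> conj_cost (x \<otimes> y) (c + d)"
proof (induction rule: conj_cost.induct)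
  case one
  then show ?case using conj_cost_closed by simp
next
  case (conj x c h s e)
  then show ?case
    using conj_cost.conj[of "x \<otimes> y" "c + d" h s e] conj_cost_closed[of x] conj_cost_closed[of y]
    by (simp add: m_assoc S_closed add.assoc)
qed

lemma conj_cost_conjugate: "conj_cost x c \<Longrightarrow> k \<in> carrier K \<Longrightarrow> conj_cost (k \<otimes> x \<otimes> inv k) c"
proof (induction rule: conj_cost.induct)
  case one
  then show ?case using conj_cost.one by simp
next
  case (conj x c h s d)
  have x: "x \<in> carrier K" using conj_cost_closed[OF conj.hyps(1)] by simp
  have "inv k \<otimes> (k \<otimes> y) = y" if "y \<in> carrier K" for y
    using conj.prems that by (simp add: m_assoc [symmetric])
  then show ?case
    using conj_cost.conj[OF conj.IH[OF conj.prems], of "k \<otimes> h" s d] conj.hyps(2,3) conj.prems x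
    by (simp add: m_assoc S_closed inv_mult_group)
qed

lemma conj_cost_generator: "S s c \<Longrightarrow> conj_cost s c"
  using conj_cost.conj[OF conj_cost.one one_closed, of s c] by (simp add: S_closed)

lemma conj_cost_inv: "conj_cost x c \<Longrightarrow> conj_cost (inv x) c"
proof (induction rule: conj_cost.induct)
  case one
  then show ?case using conj_cost.one by simp
next
  case (conj x c h s d)
  have x: "x \<in> carrier K" using conj_cost_closed[OF conj.hyps(1)] by simp
  have "conj_cost (inv x \<otimes> (h \<otimes> inv s \<otimes> inv h)) (c + d)"
    by (intro conj_cost_mult conj_cost_conjugate conj_cost_generator S_inv conj)
  then show ?case using conj.hyps(2,3) x
    by (simp add: m_assoc S_closed inv_mult_group add.commute)
qed

lemma conj_norm_le: "conj_cost x c \<Longrightarrow> conj_norm x \<le> c"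
  unfolding conj_norm_def by (rule cInf_lower) (auto intro!: bdd_belowI[of _ 0] dest: conj_cost_closed)

lemma conj_norm_greatest: "\<exists>c. conj_cost x c \<Longrightarrow> (\<And>c. conj_cost x c \<Longrightarrow> b \<le> c) \<Longrightarrow> b \<le> conj_norm x"
  unfolding conj_norm_def by (rule cInf_greatest) auto

lemma conj_norm_pseudonorm:
  assumes ex: "\<And>x. x \<in> carrier K \<Longrightarrow> \<exists>c. conj_cost x c"
  shows "conj_pseudonorm K conj_norm"
proof (intro conj_pseudonorm.intro conj_pseudonorm_axioms.intro)
  show "group K" by (rule group_axioms)
  have "conj_norm \<one> \<le> 0" using conj_norm_le conj_cost.one by blast
  moreover have "0 \<le> conj_norm \<one>"
    using conj_cost_closed by (intro conj_norm_greatest ex) auto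
  ultimately show "conj_norm \<one> = 0" by simp
next
  have le: "conj_norm (inv x) \<le> conj_norm x" if "x \<in> carrier K" for x
    using that conj_cost_inv conj_norm_le by (intro conj_norm_greatest ex) auto
  show "conj_norm (inv x) = conj_norm x" if "x \<in> carrier K" for x
    using le[OF that] le[of "inv x"] that by simp
  fix h
  have le: "conj_norm (h \<otimes> x \<otimes> inv h) \<le> conj_norm x"
    if "h \<in> carrier K" "x \<in> carrier K" for x h
    using that conj_cost_conjugate conj_norm_le by (intro conj_norm_greatest ex) auto
  show "conj_norm (h \<otimes> x \<otimes> inv h) = conj_norm x"
    if hx: "h \<in> carrier K" "x \<in> carrier K" for x
  proof -
    have "inv h \<otimes> (h \<otimes> x \<otimes> inv h) \<otimes> inv (inv h) = x"
      using hx by (simp add: m_assoc) (simp add: m_assoc [symmetric])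
    then show ?thesis using le[OF hx] le[of "inv h" "h \<otimes> x \<otimes> inv h"] hx by simp
  qed
next
  fix x y assume xy: "x \<in> carrier K" "y \<in> carrier K"
  have "conj_norm (x \<otimes> y) - d \<le> conj_norm x" if d: "conj_cost y d" for d
    using xy conj_norm_le[OF conj_cost_mult[OF _ d]]
    by (intro conj_norm_greatest ex) (auto simp: diff_le_eq)
  then have "conj_norm (x \<otimes> y) - conj_norm x \<le> conj_norm y"
    using xy by (intro conj_norm_greatest ex) force+
  then show "conj_norm (x \<otimes> y) \<le> conj_norm x + conj_norm y" by simp
qed

end


section \<open>The pseudonorm on free products of copies of the reals\<close>

lemma fp_mult: "x \<otimes>\<^bsub>free_product_reals I\<^esub> y = foldr fp_cons x y"
  and fp_one: "\<one>\<^bsub>free_product_reals I\<^esub> = []"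
  by (simp_all add: free_product_reals_def)

lemma syllable_zero [simp]: "syllable g 0 = []"
  by (simp add: syllable_def)

lemma fp_inv:
  assumes "x \<in> carrier (free_product_reals I)"
  shows "inv\<^bsub>free_product_reals I\<^esub> x = rev (map (\<lambda>(i, r). (i, - r)) x)"
proof (rule group.inv_equality[OF group_free_product_reals])
  let ?y = "rev (map (\<lambda>(i, r). (i, - r)) x)"
  show "?y \<in> carrier (free_product_reals I)"
    using assms fp_reduced_inverse[of x] by (auto simp: free_product_reals_def)
  show "?y \<otimes>\<^bsub>free_product_reals I\<^esub> x = \<one>\<^bsub>free_product_reals I\<^esub>"
    using assms fp_foldr_inverse[of "[]" x]
    by (simp add: free_product_reals_def fp_foldr_Nil) (simp add: fp_reduced_def)
qed (use assms in auto)

lemma syllable_inv: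
  assumes "g \<in> I" shows "inv\<^bsub>free_product_reals I\<^esub> (syllable g r) = syllable g (- r)"
  using fp_inv[OF syllable_closed[OF assms, of r]] by (simp add: syllable_def)

lemma syllable_pow_sign:
  assumes "g \<in> I" "e \<in> {1, -1 :: int}"
  shows "syllable g r [^]\<^bsub>free_product_reals I\<^esub> e = syllable g (of_int e * r)"
proof -
  interpret group "free_product_reals I" by (rule group_free_product_reals)
  show ?thesis using assms syllable_closed[OF assms(1), of r] syllable_inv[OF assms(1), of r]
    by (auto simp: int_pow_neg int_pow_1)
qed

lemma fp_lift_Nil [simp]: "fp_lift H f [] = \<one>\<^bsub>H\<^esub>"
  and fp_lift_Cons: "fp_lift H f ((i, r) # w) = f i r \<otimes>\<^bsub>H\<^esub> fp_lift H f w"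
  by (simp_all add: fp_lift_def list_mult_def)

lemma fp_lift_self:
  assumes "x \<in> carrier (free_product_reals I)"
  shows "fp_lift (free_product_reals I) syllable x = x"
  using assms
proof (induction x)
  case (Cons y x)
  obtain g r where y: "y = (g, r)" by (cases y)
  have x: "x \<in> carrier (free_product_reals I)" "fp_cons (g, r) x = (g, r) # x" "r \<noteq> 0"
    using Cons.prems fp_reduced_Cons[of y x]
    by (auto simp: free_product_reals_def y fp_reduced_def)
  then show ?case using Cons.IH by (simp add: y fp_lift_Cons fp_mult syllable_def)
qed (simp add: fp_one)

lemma fp_lift_hom:
  assumes H: "group H" and f: "\<And>i r. i \<in> I \<Longrightarrow> f i r \<in> carrier H"
    and add: "\<And>i r s. i \<in> I \<Longrightarrow> f i (r + s) = f i r \<otimes>\<^bsub>H\<^esub> f i s"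
  shows "fp_lift H f \<in> hom (free_product_reals I) H"
    and "\<And>i r. i \<in> I \<Longrightarrow> fp_lift H f (syllable i r) = f i r"
proof -
  interpret group H by (rule H)
  have 0: "f i 0 = \<one>\<^bsub>H\<^esub>" if "i \<in> I" for i
    using add[OF that, of 0 0] f[OF that, of 0] by simp
  note L = fp_lift_mult[OF H, of UNIV I f]
  show "fp_lift H f \<in> hom (free_product_reals I) H"
  proof (rule homI)
    fix x y assume "x \<in> carrier (free_product_reals I)" "y \<in> carrier (free_product_reals I)"
    then have s: "set x \<subseteq> I \<times> UNIV" "set y \<subseteq> I \<times> UNIV" by (auto simp: free_product_reals_def)
    show "fp_lift H f x \<in> carrier H"
      using L(2)[OF _ _ _ _ _ s(2) s(1)] f add 0 by simp
    show "fp_lift H f (x \<otimes>\<^bsub>free_product_reals I\<^esub> y) = fp_lift H f x \<otimes>\<^bsub>H\<^esub> fp_lift H f y"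
      using L(3)[OF _ _ _ _ _ s] f add 0 by (simp add: fp_mult)
  qed
  show "fp_lift H f (syllable i r) = f i r" if "i \<in> I" for i r
    using f[OF that, of r] 0[OF that] by (simp add: syllable_def fp_lift_Cons)
qed

lemma fp_hom_eqI:
  assumes H: "group H" and f: "f \<in> hom (free_product_reals I) H" and g: "g \<in> hom (free_product_reals I) H"
    and eq: "\<And>i r. i \<in> I \<Longrightarrow> f (syllable i r) = g (syllable i r)"
    and x: "x \<in> carrier (free_product_reals I)"
  shows "f x = g x"
proof -
  let ?F = "free_product_reals I"
  interpret F: group ?F by (rule group_free_product_reals)
  interpret H: group H by (rule H)
  interpret f: group_hom ?F H f using f by unfold_locales
  interpret g: group_hom ?F H g using g by unfold_locales
  have *: "fst ` set w \<subseteq> I \<Longrightarrow> fp_lift ?F syllable w \<in> carrier ?F \<and>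
    f (fp_lift ?F syllable w) = g (fp_lift ?F syllable w)" for w
  proof (induction w)
    case (Cons y w)
    then show ?case using eq by (cases y) (auto simp: fp_lift_Cons syllable_closed)
  qed simp
  show ?thesis using *[of x] x fp_lift_self[OF x] by (auto simp: free_product_reals_def)
qed

lemma psi_one: "x \<in> carrier (FR G) \<Longrightarrow> psi G 1 x = x"
  by (rule fp_hom_eqI[OF group_free_product_reals psi_hom, of "\<lambda>x. x"])
    (simp_all add: psi_syllable hom_def)

lemma psi_closed: "x \<in> carrier (FR G) \<Longrightarrow> psi G t x \<in> carrier (FR G)"
  using psi_hom[of G t] by (auto simp: hom_def)

lemma psi_psi: "x \<in> carrier (FR G) \<Longrightarrow> psi G s (psi G t x) = psi G (s * t) x"
proof -
  assume x: "x \<in> carrier (FR G)"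
  have "psi G s \<circ> psi G t \<in> hom (FR G) (FR G)"
    by (rule hom_compose[OF psi_hom psi_hom])
  then have "(psi G s \<circ> psi G t) x = psi G (s * t) x"
    by (rule fp_hom_eqI[OF group_free_product_reals _ psi_hom _ x])
      (simp add: psi_syllable mult.assoc)
  then show ?thesis by simp
qed

definition syllable_weight :: "('a, 'm) monoid_scheme \<Rightarrow> ('a \<Rightarrow> real) \<Rightarrow> ('a \<times> real) list \<Rightarrow> real \<Rightarrow> bool" where
  "syllable_weight G \<nu> s c \<longleftrightarrow> (\<exists>g\<in>carrier G. \<exists>r. s = syllable g r \<and> c = \<bar>r\<bar> * \<nu> g)"

context conj_pseudonorm
begin

lemma FR_weighted_set: "weighted_set (FR G) (syllable_weight G \<nu>)"
proof (intro weighted_set.intro weighted_set_axioms.intro)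
  show "group (FR G)" by (rule group_free_product_reals)
  fix s c assume "syllable_weight G \<nu> s c"
  then obtain g r where g: "g \<in> carrier G" "s = syllable g r" "c = \<bar>r\<bar> * \<nu> g"
    by (auto simp: syllable_weight_def)
  show "s \<in> carrier (FR G)" "0 \<le> c" using g by (auto simp: syllable_closed nu_nonneg)
  show "syllable_weight G \<nu> (inv\<^bsub>FR G\<^esub> s) c"
    unfolding syllable_weight_def using g
    by (intro bexI[of _ g] exI[of _ "- r"]) (auto simp: syllable_inv)
qed

context
begin

interpretation F: weighted_set "FR G" "syllable_weight G \<nu>" by (rule FR_weighted_set)

lemma FR_norm_alt: "FR_norm G \<nu> = F.conj_norm"
proof
  fix x
  let ?m = "\<lambda>(h, g, r, e). h \<otimes>\<^bsub>FR G\<^esub> (syllable g r [^]\<^bsub>FR G\<^esub> (e::int)) \<otimes>\<^bsub>FR G\<^esub> inv\<^bsub>FR G\<^esub> h"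
  let ?ok = "\<lambda>ws. \<forall>(h, g, r, e)\<in>set ws. h \<in> carrier (FR G) \<and> g \<in> carrier G \<and> e \<in> {1, -1}"
  let ?s = "\<lambda>ws. \<Sum>(h, g, r, e)\<leftarrow>ws. \<bar>r\<bar> * \<nu> g"
  have 1: "?ok ws \<Longrightarrow> F.conj_cost (list_mult (FR G) (map ?m ws)) (?s ws)" for ws
  proof (induction ws)
    case Nil
    show ?case using F.conj_cost.one by (simp add: list_mult_def)
  next
    case (Cons y ws)
    obtain h g r e where y: "y = (h, g, r, e)" by (cases y)
    have e: "h \<in> carrier (FR G)" "g \<in> carrier G" "e \<in> {1, -1}" using Cons.prems y by auto
    have IH: "F.conj_cost (list_mult (FR G) (map ?m ws)) (?s ws)" using Cons by auto
    have "syllable_weight G \<nu> (syllable g (of_int e * r)) (\<bar>r\<bar> * \<nu> g)"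
      unfolding syllable_weight_def using e
      by (intro bexI[of _ g] exI[of _ "of_int e * r"]) auto
    from F.conj_cost.conj[OF IH e(1) this] show ?case
      using e syllable_pow_sign[of g "carrier G" e r] by (auto simp: y list_mult_def)
  qed
  have 2: "F.conj_cost x c \<Longrightarrow> \<exists>ws. ?ok ws \<and> x = list_mult (FR G) (map ?m ws) \<and> c = ?s ws" for x c
  proof (induction rule: F.conj_cost.induct)
    case one
    then show ?case by (intro exI[of _ "[]"]) (simp add: list_mult_def)
  next
    case (conj x c h s d)
    then obtain ws where ws: "?ok ws" "x = list_mult (FR G) (map ?m ws)" "c = ?s ws" by blast
    obtain g r where g: "g \<in> carrier G" "s = syllable g r" "d = \<bar>r\<bar> * \<nu> g"
      using conj.hyps by (auto simp: syllable_weight_def)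
    show ?case
      using ws g conj.hyps syllable_pow_sign[of g "carrier G" 1 r]
      by (intro exI[of _ "(h, g, r, 1) # ws"]) (auto simp: list_mult_def)
  qed
  have "{?s ws | ws. ?ok ws \<and> x = list_mult (FR G) (map ?m ws)} = {c. F.conj_cost x c}"
    using 1 2 by blast
  then show "FR_norm G \<nu> x = F.conj_norm x" unfolding FR_norm_def F.conj_norm_def by simp
qed

lemma conj_cost_syllable: "g \<in> carrier G \<Longrightarrow> F.conj_cost (syllable g r) (\<bar>r\<bar> * \<nu> g)"
  by (rule F.conj_cost_generator) (auto simp: syllable_weight_def)

lemma FR_conj_cost_ex: "x \<in> carrier (FR G) \<Longrightarrow> \<exists>c. F.conj_cost x c"
proof -
  assume x: "x \<in> carrier (FR G)"
  have "fst ` set w \<subseteq> carrier G \<Longrightarrow> \<exists>c. F.conj_cost (fp_lift (FR G) syllable w) c" for w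
  proof (induction w)
    case Nil
    then show ?case using F.conj_cost.one by auto
  next
    case (Cons y w)
    obtain g r where y: "y = (g, r)" by (cases y)
    obtain c where "F.conj_cost (fp_lift (FR G) syllable w) c" using Cons by auto
    from F.conj_cost_mult[OF conj_cost_syllable this, of g r] show ?case
      using Cons.prems by (auto simp: y fp_lift_Cons)
  qed
  from this[of x] x show ?thesis
    unfolding fp_lift_self[OF x] by (simp add: free_product_reals_def)
qed

lemma FR_pseudonorm: "conj_pseudonorm (FR G) (FR_norm G \<nu>)"
  unfolding FR_norm_alt by (rule F.conj_norm_pseudonorm) (rule FR_conj_cost_ex)

lemmas FR_norm_le = F.conj_norm_le [folded FR_norm_alt]

lemma FR_norm_greatest:
  assumes "x \<in> carrier (FR G)" "\<And>c. F.conj_cost x c \<Longrightarrow> b \<le> c"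
  shows "b \<le> FR_norm G \<nu> x"
  unfolding FR_norm_alt using FR_conj_cost_ex[OF assms(1)] assms(2) by (rule F.conj_norm_greatest)

lemma FR_norm_syllable: "g \<in> carrier G \<Longrightarrow> FR_norm G \<nu> (syllable g r) \<le> \<bar>r\<bar> * \<nu> g"
  by (rule FR_norm_le[OF conj_cost_syllable])

text \<open>By definition the pseudonorm is the largest conjugation-invariant one that is bounded by
  \<open>\<bar>r\<bar> \<nu>(g)\<close> on each syllable, so Lipschitz bounds need only be checked on syllables.\<close>

lemma FR_hom_Lipschitz:
  assumes K: "conj_pseudonorm K \<mu>" and f: "f \<in> hom (FR G) K"
    and C: "\<And>g r. g \<in> carrier G \<Longrightarrow> \<mu> (f (syllable g r)) \<le> C * (\<bar>r\<bar> * \<nu> g)" "0 \<le> C"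
    and x: "x \<in> carrier (FR G)"
  shows "\<mu> (f x) \<le> C * FR_norm G \<nu> x"
proof -
  interpret K: conj_pseudonorm K \<mu> by (rule K)
  interpret f: group_hom "FR G" K f using f by unfold_locales
  have *: "F.conj_cost y c \<Longrightarrow> \<mu> (f y) \<le> C * c" for y c
  proof (induction rule: F.conj_cost.induct)
    case (conj y c h s' d)
    obtain g r where g: "g \<in> carrier G" "s' = syllable g r" "d = \<bar>r\<bar> * \<nu> g"
      using conj.hyps(3) by (auto simp: syllable_weight_def)
    have y: "y \<in> carrier (FR G)" using F.conj_cost_closed[OF conj.hyps(1)] by simp
    have s: "syllable g r \<in> carrier (FR G)" by (rule syllable_closed[OF g(1)])
    have "\<mu> (f (h \<otimes>\<^bsub>FR G\<^esub> syllable g r \<otimes>\<^bsub>FR G\<^esub> inv\<^bsub>FR G\<^esub> h \<otimes>\<^bsub>FR G\<^esub> y)) \<le> \<mu> (f (syllable g r)) + \<mu> (f y)"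
    proof -
      have cl: "f h \<in> carrier K" "f (syllable g r) \<in> carrier K" "f y \<in> carrier K"
        using conj.hyps(2) y s f.hom_closed by blast+
      have "f (h \<otimes>\<^bsub>FR G\<^esub> syllable g r \<otimes>\<^bsub>FR G\<^esub> inv\<^bsub>FR G\<^esub> h \<otimes>\<^bsub>FR G\<^esub> y)
          = f h \<otimes>\<^bsub>K\<^esub> f (syllable g r) \<otimes>\<^bsub>K\<^esub> inv\<^bsub>K\<^esub> f h \<otimes>\<^bsub>K\<^esub> f y"
        using conj.hyps(2) y s by (simp only: f.hom_mult f.hom_inv F.m_closed F.inv_closed)
      then show ?thesis
        using K.nu_mult[of "f h \<otimes>\<^bsub>K\<^esub> f (syllable g r) \<otimes>\<^bsub>K\<^esub> inv\<^bsub>K\<^esub> f h" "f y"] cl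
        by (simp only: K.nu_conj K.m_closed K.inv_closed)
    qed
    also have "\<dots> \<le> C * (\<bar>r\<bar> * \<nu> g) + C * c" using conj g C by (intro add_mono) auto
    finally show ?case unfolding g(2,3) by (simp add: algebra_simps)
  qed simp
  show ?thesis
  proof (cases "C = 0")
    case True
    obtain c where "F.conj_cost x c" using FR_conj_cost_ex[OF x] by blast
    from *[OF this] show ?thesis using True by simp
  next
    case False
    then have "\<mu> (f x) / C \<le> FR_norm G \<nu> x"
      using C(2) * x by (intro FR_norm_greatest) (auto simp: field_simps)
    then show ?thesis using False C(2) by (simp add: field_simps)
  qed
qed

lemma FR_norm_psi:
  assumes x: "x \<in> carrier (FR G)" and t: "t > 0"
  shows "FR_norm G \<nu> (psi G t x) = t * FR_norm G \<nu> x"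
proof -
  have le: "FR_norm G \<nu> (psi G t x) \<le> t * FR_norm G \<nu> x" if "x \<in> carrier (FR G)" "t > 0" for x t
  proof (rule FR_hom_Lipschitz[OF FR_pseudonorm psi_hom _ _ that(1)])
    fix g r assume "g \<in> carrier G"
    then show "FR_norm G \<nu> (psi G t (syllable g r)) \<le> t * (\<bar>r\<bar> * \<nu> g)"
      using FR_norm_syllable[of g "t * r"] that by (simp add: psi_syllable abs_mult mult.assoc)
  qed (use that in simp)
  have "psi G (1 / t) (psi G t x) = x" using x t by (simp add: psi_psi psi_one)
  then have "FR_norm G \<nu> x \<le> 1 / t * FR_norm G \<nu> (psi G t x)"
    using le[OF psi_closed[OF x, of t], of "1 / t"] t by simp
  then show ?thesis using le[OF x t] t by (simp add: field_simps)
qed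

end


subsection \<open>Integral words\<close>

text \<open>A second description of the pseudonorm, on unreduced lists of syllables: the list is
  emptied by deleting syllables, at the price of their weight, and by merging neighbours with the
  same index, for free. Conjugating elements are invisible here, and a list with integral
  exponents stays integral throughout, which is not clear for factorizations into conjugates
  with real exponents.\<close>

inductive merge_cost :: "('a \<times> real) list \<Rightarrow> real \<Rightarrow> bool" where
  nil: "0 \<le> c \<Longrightarrow> merge_cost [] c"
| del: "merge_cost (u @ v) c \<Longrightarrow> g \<in> carrier G \<Longrightarrow> \<bar>r\<bar> * \<nu> g + c \<le> d \<Longrightarrow> merge_cost (u @ (g, r) # v) d"
| merge: "merge_cost (u @ (g, r + s) # v) c \<Longrightarrow> merge_cost (u @ (g, r) # (g, s) # v) c"

end

lemma append_Cons_eq_append_Cons: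
  "u @ x # v = u' @ y # v' \<longleftrightarrow>
     u = u' \<and> x = y \<and> v = v' \<or> (\<exists>w. u = u' @ y # w \<and> v' = w @ x # v) \<or>
     (\<exists>w. u' = u @ x # w \<and> v = w @ y # v')"
  by (auto simp: append_eq_append_conv2 append_eq_Cons_conv Cons_eq_append_conv)

context conj_pseudonorm
begin

lemma merge_cost_mono: "merge_cost w c \<Longrightarrow> c \<le> d \<Longrightarrow> merge_cost w d"
  by (induction rule: merge_cost.induct) (auto intro: merge_cost.intros)

text \<open>Dropping a trivial syllable and merging two neighbours do not increase the cost, and changing an
  exponent changes it by at most the weight of the change. All three are inductions over the process
  that empties the list.\<close>

lemma merge_cost_drop_zero: "merge_cost w c \<Longrightarrow> w = u @ (g, 0) # v \<Longrightarrow> merge_cost (u @ v) c"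
proof (induction arbitrary: u v rule: merge_cost.induct)
  case (del u' v' c g' r d)
  have c: "c \<le> d" using del nu_nonneg[of g'] by (smt (verit) mult_nonneg_nonneg)
  from del.prems consider "u' = u" "v' = v" | w where "u' = u @ (g, 0) # w" "v = w @ (g', r) # v'"
    | w where "u = u' @ (g', r) # w" "v' = w @ (g, 0) # v"
    unfolding append_Cons_eq_append_Cons by auto
  then show ?case
  proof cases
    case 1
    then show ?thesis using del.hyps c merge_cost_mono by blast
  next
    case 2
    then show ?thesis using del.IH[of u "w @ v'"] del.hyps merge_cost.del[of "u @ w" v'] by simp
  next
    case 3
    then show ?thesis using del.IH[of "u' @ w" v] del.hyps merge_cost.del[of u' "w @ v"] by simp
  qed
next
  case (merge u' g' r s v' c)
  from merge.prems consider "u' = u" "g' = g" "r = 0" "v = (g', s) # v'"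
    | "u = u' @ [(g', r)]" "g' = g" "s = 0" "v' = v"
    | w where "u' = u @ (g, 0) # w" "v = w @ (g', r) # (g', s) # v'"
    | w where "u = u' @ (g', r) # (g', s) # w" "v' = w @ (g, 0) # v"
    unfolding append_Cons_eq_append_Cons by (auto simp: Cons_eq_append_conv)
  then show ?case
  proof cases
    case 3
    then show ?thesis using merge.IH[of u "w @ (g', r + s) # v'"] merge_cost.merge[of "u @ w"] by simp
  next
    case 4
    then show ?thesis
      using merge.IH[of "u' @ (g', r + s) # w" v] merge_cost.merge[of u' g' r s "w @ v"] by simp
  qed (use merge.hyps in auto)
qed simp

lemma merge_cost_change:
  "merge_cost w c \<Longrightarrow> w = u @ (g, r) # v \<Longrightarrow> g \<in> carrier G \<Longrightarrow>
   merge_cost (u @ (g, r + s) # v) (c + \<bar>s\<bar> * \<nu> g)"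
proof (induction arbitrary: u r v rule: merge_cost.induct)
  case (del u' v' c g' r' d)
  from del.prems(1) consider "u' = u" "g' = g" "r' = r" "v' = v"
    | w where "u' = u @ (g, r) # w" "v = w @ (g', r') # v'"
    | w where "u = u' @ (g', r') # w" "v' = w @ (g, r) # v"
    unfolding append_Cons_eq_append_Cons by auto
  then show ?case
  proof cases
    case 1
    have "\<bar>r + s\<bar> * \<nu> g \<le> (\<bar>r\<bar> + \<bar>s\<bar>) * \<nu> g"
      using nu_nonneg[OF del.prems(2)] by (intro mult_right_mono) auto
    then have "\<bar>r + s\<bar> * \<nu> g + c \<le> d + \<bar>s\<bar> * \<nu> g" using del.hyps 1 by (simp add: algebra_simps)
    then show ?thesis using 1 del.hyps merge_cost.del[of u v c g "r + s"] by simp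
  next
    case 2
    then show ?thesis using del.IH[of u r "w @ v'"] del.prems del.hyps
        merge_cost.del[of "u @ (g, r + s) # w" v' "c + \<bar>s\<bar> * \<nu> g" g' r' "d + \<bar>s\<bar> * \<nu> g"] by simp
  next
    case 3
    then show ?thesis using del.IH[of "u' @ w" r v] del.prems del.hyps
        merge_cost.del[of u' "w @ (g, r + s) # v" "c + \<bar>s\<bar> * \<nu> g" g' r' "d + \<bar>s\<bar> * \<nu> g"] by simp
  qed
next
  case (merge u' g' a b v' c)
  from merge.prems(1) consider "u' = u" "g' = g" "r = a" "v = (g', b) # v'"
    | "u = u' @ [(g', a)]" "g' = g" "r = b" "v' = v"
    | w where "u' = u @ (g, r) # w" "v = w @ (g', a) # (g', b) # v'"
    | w where "u = u' @ (g', a) # (g', b) # w" "v' = w @ (g, r) # v"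
    unfolding append_Cons_eq_append_Cons by (auto simp: Cons_eq_append_conv)
  then show ?case
  proof cases
    case 1
    then show ?thesis using merge.IH[of u "a + b" v'] merge.prems merge_cost.merge[of u g "a + s" b v']
      by (simp add: add_ac)
  next
    case 2
    then show ?thesis using merge.IH[of u' "a + b" v'] merge.prems merge_cost.merge[of u' g a "b + s" v']
      by (simp add: add_ac)
  next
    case 3
    then show ?thesis using merge.IH[of u r "w @ (g', a + b) # v'"] merge.prems
        merge_cost.merge[of "u @ (g, r + s) # w"] by simp
  next
    case 4
    then show ?thesis using merge.prems
      merge.IH[of "u' @ (g', a + b) # w" r v] merge_cost.merge[of u' g' a b "w @ (g, r + s) # v"] by simp
  qed
qed simp

lemma merge_cost_merged:
  "merge_cost w c \<Longrightarrow> w = u @ (g, r) # (g, s) # v \<Longrightarrow> g \<in> carrier G \<Longrightarrow>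
   merge_cost (u @ (g, r + s) # v) c"
proof (induction arbitrary: u r s v rule: merge_cost.induct)
  case (del u' v' c g' r' d)
  from del.prems(1) consider "u' = u" "g' = g" "r' = r" "v' = (g, s) # v"
    | "u' = u @ [(g, r)]" "g' = g" "r' = s" "v' = v"
    | w where "u' = u @ (g, r) # (g, s) # w" "v = w @ (g', r') # v'"
    | w where "u = u' @ (g', r') # w" "v' = w @ (g, r) # (g, s) # v"
    unfolding append_Cons_eq_append_Cons by (auto simp: Cons_eq_append_conv append_eq_Cons_conv)
  then show ?case
  proof cases
    case 1
    then have "merge_cost (u @ (g, s + r) # v) (c + \<bar>r\<bar> * \<nu> g)"
      using merge_cost_change[OF del.hyps(1), of u g s v r] del.prems by simp
    then show ?thesis using 1 del.hyps by (auto simp: add_ac intro: merge_cost_mono)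
  next
    case 2
    then have "merge_cost (u @ (g, r + s) # v) (c + \<bar>s\<bar> * \<nu> g)"
      using merge_cost_change[OF del.hyps(1), of u g r v s] del.prems by simp
    then show ?thesis using 2 del.hyps by (auto simp: add_ac intro: merge_cost_mono)
  next
    case 3
    then show ?thesis using del.IH[of u r s "w @ v'"] del.prems del.hyps
        merge_cost.del[of "u @ (g, r + s) # w" v'] by simp
  next
    case 4
    then show ?thesis using del.IH[of "u' @ w" r s v] del.prems del.hyps
        merge_cost.del[of u' "w @ (g, r + s) # v"] by simp
  qed
next
  case (merge u' g' a b v' c)
  from merge.prems(1) consider "u' = u" "g' = g" "a = r" "b = s" "v = v'"
    | "u' = u @ [(g, r)]" "g' = g" "a = s" "v = (g, b) # v'"
    | "u = u' @ [(g, a)]" "g' = g" "b = r" "v' = (g, s) # v"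
    | w where "u' = u @ (g, r) # (g, s) # w" "v = w @ (g', a) # (g', b) # v'"
    | w where "u = u' @ (g', a) # (g', b) # w" "v' = w @ (g, r) # (g, s) # v"
    unfolding append_Cons_eq_append_Cons by (auto simp: Cons_eq_append_conv append_eq_Cons_conv)
  then show ?case
  proof cases
    case 1
    then show ?thesis using merge.hyps by simp
  next
    case 2
    then show ?thesis using merge.IH[of u r "s + b" v'] merge.prems merge_cost.merge[of u g "r + s" b v']
      by (simp add: add_ac)
  next
    case 3
    then show ?thesis using merge.IH[of u' "a + r" s v] merge.prems merge_cost.merge[of u' g a "r + s" v]
      by (simp add: add_ac)
  next
    case 4
    then show ?thesis using merge.IH[of u r s "w @ (g', a + b) # v'"] merge.prems
        merge_cost.merge[of "u @ (g, r + s) # w"] by simp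
  next
    case 5
    then show ?thesis using merge.prems
      merge.IH[of "u' @ (g', a + b) # w" r s v] merge_cost.merge[of u' g' a b "w @ (g, r + s) # v"] by simp
  qed
qed simp

lemma merge_cost_zero: "g \<in> carrier G \<Longrightarrow> merge_cost (u @ (g, 0) # v) c \<longleftrightarrow> merge_cost (u @ v) c"
  using merge_cost_drop_zero[of _ c u g v] merge_cost.del[of u v c g 0 c] by auto

lemma merge_cost_fp_cons:
  assumes "fst x \<in> carrier G"
  shows "merge_cost (u @ fp_cons x w) c \<longleftrightarrow> merge_cost (u @ x # w) c"
proof -
  obtain g r where x: "x = (g, r)" by (cases x)
  have g: "g \<in> carrier G" using assms x by simp
  show ?thesis
  proof (cases w)
    case Nil
    then show ?thesis using merge_cost_zero[OF g, of u "[]"] by (simp add: x)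
  next
    case (Cons y v)
    obtain h s where y: "y = (h, s)" by (cases y)
    have m: "merge_cost (u @ (g, r) # (g, s) # v) c \<longleftrightarrow> merge_cost (u @ (g, r + s) # v) c"
      using merge_cost.merge merge_cost_merged[OF _ refl g] by blast
    have z: "merge_cost (u @ (g, r + s) # v) c \<longleftrightarrow> merge_cost (u @ v) c" if "r + s = 0"
      unfolding that by (rule merge_cost_zero[OF g])
    show ?thesis using m z merge_cost_zero[OF g, of u "(h, s) # v"] by (auto simp: x y Cons)
  qed
qed

lemma merge_cost_foldr:
  "fst ` set v \<subseteq> carrier G \<Longrightarrow> merge_cost (u @ foldr fp_cons v w) c \<longleftrightarrow> merge_cost (u @ v @ w) c"
proof (induction v arbitrary: u)
  case (Cons x v)
  then show ?case using merge_cost_fp_cons[of x u "foldr fp_cons v w" c] Cons.IH[of "u @ [x]"] by simp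
qed simp

lemma merge_cost_insert_inverse:
  "fst ` set h \<subseteq> carrier G \<Longrightarrow> merge_cost (u @ v) c \<Longrightarrow>
   merge_cost (u @ h @ rev (map (\<lambda>(i, r). (i, - r)) h) @ v) c"
proof (induction h arbitrary: u v)
  case (Cons x h)
  obtain g r where x: "x = (g, r)" by (cases x)
  have "merge_cost (u @ (g, r + - r) # v) c" using Cons.prems merge_cost_zero by (simp add: x)
  then have "merge_cost ((u @ [(g, r)]) @ (g, - r) # v) c" using merge_cost.merge by simp
  from Cons.IH[OF _ this] Cons.prems show ?case by (simp add: x)
qed simp

lemma conj_cost_imp_merge_cost: "weighted_set.conj_cost (FR G) (syllable_weight G \<nu>) x c \<Longrightarrow> merge_cost x c"
proof (induction rule: weighted_set.conj_cost.induct[OF FR_weighted_set, consumes 1, case_names one conj])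
  case one
  then show ?case by (simp add: fp_one merge_cost.nil)
next
  case (conj x c h s d)
  obtain g r where g: "g \<in> carrier G" "s = syllable g r" "d = \<bar>r\<bar> * \<nu> g"
    using conj(3) by (auto simp: syllable_weight_def)
  have h: "fst ` set h \<subseteq> carrier G" and x: "fp_reduced x" and hr: "fp_reduced h"
    using conj(1,2) weighted_set.conj_cost_closed[OF FR_weighted_set conj(1)] by (auto simp: free_product_reals_def)
  let ?h = "rev (map (\<lambda>(i, r). (i, - r)) h)"
  have "merge_cost (h @ ?h @ x) c" using merge_cost_insert_inverse[OF h, of "[]" x c] conj(4) by simp
  then have 1: "merge_cost (h @ syllable g r @ ?h @ x) (\<bar>r\<bar> * \<nu> g + c)"
    using merge_cost.del[of h "?h @ x" c g r] g(1) by (simp add: syllable_def)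
  have sr: "fp_reduced (syllable g r)" by (simp add: syllable_def fp_reduced_def)
  have ss: "fst ` set (syllable g r) \<subseteq> carrier G" using g(1) by (simp add: syllable_def)
  have hi: "inv\<^bsub>FR G\<^esub> h = ?h" using conj(2) by (intro fp_inv)
  have hs: "fst ` set ?h \<subseteq> carrier G" "fp_reduced ?h"
    using h fp_reduced_inverse[OF hr] by auto
  have "merge_cost (foldr fp_cons h (foldr fp_cons (syllable g r) (foldr fp_cons ?h x))) (\<bar>r\<bar> * \<nu> g + c)"
    using 1 merge_cost_foldr[OF h, of "[]"] merge_cost_foldr[OF ss, of h]
      merge_cost_foldr[OF hs(1), of "h @ syllable g r"] by simp
  then show ?case
    using x hs sr by (simp add: g(2,3) fp_mult hi fp_foldr_assoc fp_foldr_closed)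
qed

lemma fp_lift_append:
  assumes "\<And>y. y \<in> set u \<union> set v \<Longrightarrow> f (fst y) (snd y) \<in> carrier G"
  shows "fp_lift G f (u @ v) = fp_lift G f u \<otimes> fp_lift G f v \<and> fp_lift G f u \<in> carrier G"
proof -
  have "set (map (\<lambda>(i, r). f i r) u) \<subseteq> carrier G" "set (map (\<lambda>(i, r). f i r) v) \<subseteq> carrier G"
    using assms by fastforce+
  then show ?thesis by (simp add: fp_lift_def list_mult_append list_mult_closed)
qed

lemma merge_cost_integral:
  "merge_cost w c \<Longrightarrow> set w \<subseteq> carrier G \<times> \<int> \<Longrightarrow> \<nu> (proj G w) \<le> c"
proof (induction rule: merge_cost.induct)
  case nil
  then show ?case by (simp add: proj_def)
next
  case (del u v c g r d)
  let ?f = "\<lambda>g r. g [^] \<lfloor>r::real\<rfloor>"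
  have cl: "fp_lift G ?f u \<in> carrier G" "fp_lift G ?f v \<in> carrier G"
    "proj G (u @ v) = fp_lift G ?f u \<otimes> fp_lift G ?f v"
    "proj G (u @ (g, r) # v) = fp_lift G ?f u \<otimes> (g [^] \<lfloor>r\<rfloor> \<otimes> fp_lift G ?f v)"
    using fp_lift_append[of u v ?f] fp_lift_append[of u "(g, r) # v" ?f] fp_lift_append[of v "[]" ?f] del.prems
    by (fastforce simp: proj_def fp_lift_Cons)+
  have "\<nu> (proj G (u @ (g, r) # v)) \<le> \<nu> (proj G (u @ v)) + \<nu> (g [^] \<lfloor>r\<rfloor>)"
    unfolding cl(3,4) using cl(1,2) del.hyps by (intro nu_insert_le) auto
  also have "\<nu> (g [^] \<lfloor>r\<rfloor>) \<le> \<bar>r\<bar> * \<nu> g"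
    using nu_int_pow_le[OF del.hyps(2), of "\<lfloor>r\<rfloor>"] del.prems by (auto elim!: Ints_cases)
  finally show ?case using del by simp
next
  case (merge u g r s v c)
  let ?f = "\<lambda>g r. g [^] \<lfloor>r::real\<rfloor>"
  have rs: "r \<in> \<int>" "s \<in> \<int>" and g: "g \<in> carrier G" using merge.prems by auto
  then have "g [^] \<lfloor>r + s\<rfloor> = g [^] \<lfloor>r\<rfloor> \<otimes> g [^] \<lfloor>s\<rfloor>"
    by (auto elim!: Ints_cases simp: int_pow_mult simp flip: of_int_add)
  moreover have "fp_lift G ?f v \<in> carrier G"
    using fp_lift_append[of v "[]" ?f] merge.prems by fastforce
  ultimately have "proj G (u @ (g, r) # (g, s) # v) = proj G (u @ (g, r + s) # v)"
    using fp_lift_append[of u "(g, r) # (g, s) # v" ?f] fp_lift_append[of u "(g, r + s) # v" ?f] merge.prems g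
    by (force simp: proj_def fp_lift_Cons m_assoc)
  then show ?case using merge rs by auto
qed

text \<open>An optimal factorization of an integral word may use real exponents. Replaying it as a sequence
  of deletions and merges keeps all exponents integral, and each such step is compatible with the
  projection to \<open>G\<close>.\<close>

theorem nu_proj_le:
  assumes x: "x \<in> carrier (FZ G)" shows "\<nu> (proj G x) \<le> FR_norm G \<nu> x"
proof (rule FR_norm_greatest)
  have "(\<lambda>g. syllable g 1) ` carrier G \<subseteq> carrier (FR G)" by (auto intro: syllable_closed)
  then show "x \<in> carrier (FR G)"
    using x group.carrier_subgroup_generated_subset[OF group_free_product_reals]
    unfolding FZ_def by blast
  show "\<nu> (proj G x) \<le> c" if "weighted_set.conj_cost (FR G) (syllable_weight G \<nu>) x c" for c
    using merge_cost_integral[OF conj_cost_imp_merge_cost[OF that] FZ_integral[OF x]] .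
qed

end


section \<open>The word norm of a free group\<close>

definition flip :: "'a \<times> bool \<Rightarrow> 'a \<times> bool" where "flip x = (fst x, \<not> snd x)"

definition winv :: "('a \<times> bool) list \<Rightarrow> ('a \<times> bool) list" where "winv w = rev (map flip w)"

definition red :: "('a \<times> bool) list \<Rightarrow> ('a \<times> bool) list" where "red w = foldr fg_cons w []"

lemma flip_flip [simp]: "flip (flip x) = x"
  and fst_flip [simp]: "fst (flip x) = fst x"
  and flip_neq [simp]: "flip x \<noteq> x" "x \<noteq> flip x"
  by (auto simp: flip_def prod_eq_iff)

lemma winv_simps [simp]: "winv [] = []" "winv (u @ v) = winv v @ winv u" "winv (x # v) = winv v @ [flip x]"
  "winv (winv w) = w" "length (winv w) = length w" "fst ` set (winv w) = fst ` set w"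
  by (auto simp: winv_def rev_map comp_def image_image)

lemma winv_alt: "winv w = rev (map (\<lambda>(a, e). (a, \<not> e)) w)"
  by (simp add: winv_def flip_def case_prod_beta)

declare fg_cons.simps(2) [simp del]

lemma fg_cons_Cons: "fg_cons x (y # w) = (if y = flip x then w else x # y # w)"
  by (auto simp: fg_cons.simps(2) flip_def prod_eq_iff)

lemma fg_reduced_iff: "fg_reduced w \<longleftrightarrow> successively (\<lambda>x y. y \<noteq> flip x) w"
  unfolding fg_reduced_def flip_def by (rule arg_cong[of _ _ "\<lambda>P. successively P w"]) (auto simp: prod_eq_iff fun_eq_iff)

lemma fg_reduced_Nil [simp]: "fg_reduced []"
  by (simp add: fg_reduced_def)

lemma red_reduced [simp]: "fg_reduced (red w)"
  by (simp add: red_def fg_foldr_closed)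

lemma red_Nil [simp]: "red [] = []"
  and red_Cons: "red (x # w) = fg_cons x (red w)"
  and red_append: "red (u @ v) = foldr fg_cons u (red v)"
  by (simp_all add: red_def)

lemma red_id: "fg_reduced w \<Longrightarrow> red w = w"
  by (simp add: red_def fg_foldr_Nil)

lemma red_red [simp]: "red (red w) = red w"
  by (simp add: red_id)

lemma red_append_red [simp]: "red (u @ red v) = red (u @ v)"
  by (simp add: red_append)

lemma red_red_append [simp]: "red (red u @ v) = red (u @ v)"
  using fg_foldr_assoc[of "[]" "red v" u] by (simp add: red_append) (simp add: red_def)

lemma red_winv_left [simp]: "red (winv u @ u @ v) = red v"
  using fg_foldr_inverse[of "red v" u] by (simp add: red_append winv_alt)

lemma red_winv_right [simp]: "red (u @ winv u @ v) = red v"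
  using red_winv_left[of "winv u" v] by simp

lemma red_winv_left' [simp]: "red (winv u @ u) = []" and red_winv_right' [simp]: "red (u @ winv u) = []"
  using red_winv_left[of u "[]"] red_winv_right[of u "[]"] by simp_all

lemma fg_reduced_winv: "fg_reduced w \<Longrightarrow> fg_reduced (winv w)"
  unfolding winv_alt by (rule fg_reduced_inverse)

lemma fg_reduced_append_iff:
  "fg_reduced (u @ v) \<longleftrightarrow> fg_reduced u \<and> fg_reduced v \<and> (u = [] \<or> v = [] \<or> hd v \<noteq> flip (last u))"
  by (auto simp: fg_reduced_iff successively_append_iff)

lemma red_letters: "fst ` set (red w) \<subseteq> fst ` set w"
  using fg_foldr_set[of w "[]"] by (simp add: red_def)

lemma free_group_carrier: "w \<in> carrier (free_group A) \<longleftrightarrow> fst ` set w \<subseteq> A \<and> fg_reduced w"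
  by (simp add: free_group_def)

lemma red_closed: "fst ` set w \<subseteq> A \<Longrightarrow> red w \<in> carrier (free_group A)"
  using red_letters[of w] by (auto simp: free_group_carrier)

lemma free_group_one: "\<one>\<^bsub>free_group A\<^esub> = []"
  by (simp add: free_group_def)

lemma free_group_mult: "y \<in> carrier (free_group A) \<Longrightarrow> x \<otimes>\<^bsub>free_group A\<^esub> y = red (x @ y)"
  by (simp add: free_group_def red_append red_id)

lemma red_mult: "red u \<otimes>\<^bsub>free_group A\<^esub> red v = red (u @ v)"
  using fg_foldr_assoc[of "[]" "red v" u]
  by (simp add: free_group_def red_append) (simp add: red_def)

lemma free_group_inv:
  assumes "x \<in> carrier (free_group A)" shows "inv\<^bsub>free_group A\<^esub> x = winv x"
proof -
  have "winv x \<in> carrier (free_group A)"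
    using assms by (auto simp: free_group_carrier fg_reduced_winv)
  then show ?thesis
    using assms by (intro group.inv_equality[OF group_free_group]) (auto simp: free_group_mult free_group_one)
qed


subsection \<open>Cancellation\<close>

lemma cancellation:
  assumes "fg_reduced u" "fg_reduced v"
  obtains a c b where "u = a @ c" "v = winv c @ b" "fg_reduced (a @ b)"
proof -
  have "\<exists>a c b. u = a @ c \<and> v = winv c @ b \<and> fg_reduced (a @ b)"
    using assms
  proof (induction u arbitrary: v rule: rev_induct)
    case Nil
    then show ?case by (intro exI[of _ "[]"] exI[of _ v]) simp
  next
    case (snoc x u)
    have u: "fg_reduced u" using snoc.prems by (simp add: fg_reduced_append_iff)
    show ?case
    proof (cases "\<exists>v'. v = flip x # v'")
      case True
      then obtain v' where v: "v = flip x # v'" by blast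
      have "fg_reduced v'" using snoc.prems(2) v fg_reduced_Cons by blast
      then obtain a c b where "u = a @ c" "v' = winv c @ b" "fg_reduced (a @ b)"
        using snoc.IH[OF u] by blast
      then show ?thesis using v by (intro exI[of _ a] exI[of _ "c @ [x]"] exI[of _ b]) simp
    next
      case False
      then have "fg_reduced ((u @ [x]) @ v)"
        using snoc.prems by (subst fg_reduced_append_iff) (cases v; auto)
      then show ?thesis by (intro exI[of _ "u @ [x]"] exI[of _ "[]"] exI[of _ v]) simp
    qed
  qed
  then show ?thesis using that by blast
qed

text \<open>A word is a path in the Cayley tree, and \<open>red w\<close> is the geodesic with the same
  endpoints; a path in a tree visits every vertex of the geodesic between its endpoints.\<close>

lemma red_path:
  assumes "red w = r @ s"
  obtains u v where "w = u @ v" "red u = r" "red v = s"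
proof -
  have "\<exists>u v. w = u @ v \<and> red u = r \<and> red v = s"
    using assms
  proof (induction w arbitrary: r)
    case (Cons x w)
    show ?case
    proof (cases "r = []")
      case True
      then show ?thesis using Cons.prems by (intro exI[of _ "[]"] exI[of _ "x # w"]) simp
    next
      case False
      then obtain y r' where r: "r = y # r'" by (cases r) auto
      show ?thesis
      proof (cases "\<exists>w'. red w = flip x # w'")
        case True
        then have "red w = (flip x # r) @ s" using Cons.prems by (auto simp: red_Cons fg_cons_Cons)
        then obtain u v where "w = u @ v" "red u = flip x # r" "red v = s" using Cons.IH by blast
        then show ?thesis
          by (intro exI[of _ "x # u"] exI[of _ v]) (auto simp: red_Cons fg_cons_Cons)
      next
        case False
        then have "red (x # w) = x # red w" by (cases "red w") (auto simp: red_Cons fg_cons_Cons)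
        then have "y = x" "red w = r' @ s" using Cons.prems r by auto
        then obtain u v where uv: "w = u @ v" "red u = r'" "red v = s" using Cons.IH by blast
        have "fg_reduced (x # r')"
          using red_reduced[of "x # w"] \<open>y = x\<close> r fg_reduced_append_iff[of "x # r'" s]
          unfolding Cons.prems by simp
        then have "red (x # u) = r" using uv \<open>y = x\<close> r fg_reduced_Cons[of x r'] by (simp add: red_Cons)
        then show ?thesis using uv by (intro exI[of _ "x # u"] exI[of _ v]) simp
      qed
    qed
  qed simp
  then show ?thesis using that by blast
qed

text \<open>The three words are the sides of a closed triangle in the Cayley tree. All three sides
  pass through the median of its corners, and there they are cut.\<close>

lemma median:
  assumes "red (x @ y @ z) = []"
  obtains x1 x2 y1 y2 z1 z2 where "x = x1 @ x2" "y = y1 @ y2" "z = z1 @ z2"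
    "red (x2 @ y1) = []" "red (y2 @ z1) = []" "red (z2 @ x1) = []"
proof -
  obtain a c b where abc: "red x = a @ c" "red y = winv c @ b" "fg_reduced (a @ b)"
    using cancellation[of "red x" "red y"] by auto
  have "red (x @ y) = red ((a @ c) @ winv c @ b)" using abc by (metis red_append_red red_red_append)
  also have "\<dots> = red (a @ red (c @ winv c @ b))" by (simp only: red_append_red append_assoc)
  also have "\<dots> = a @ b" using abc(3) by (simp add: red_id)
  finally have xy: "red (x @ y) = a @ b" .
  have "red z = red (winv (a @ b) @ (a @ b) @ z)" by (simp only: red_winv_left)
  also have "\<dots> = red (winv (a @ b) @ red (red (x @ y) @ z))" by (simp only: xy red_append_red)
  also have "\<dots> = winv (a @ b)" 
    using assms fg_reduced_winv[OF abc(3)] by (simp add: red_id del: winv_simps)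
  finally have z: "red z = winv b @ winv a" by simp
  obtain x1 x2 where x: "x = x1 @ x2" "red x1 = a" "red x2 = c" by (rule red_path[OF abc(1)])
  obtain y1 y2 where y: "y = y1 @ y2" "red y1 = winv c" "red y2 = b" by (rule red_path[OF abc(2)])
  obtain z1 z2 where z: "z = z1 @ z2" "red z1 = winv b" "red z2 = winv a" by (rule red_path[OF z])
  show ?thesis
  proof (rule that[OF x(1) y(1) z(1)])
    show "red (x2 @ y1) = []" by (metis x(3) y(2) red_append_red red_red_append red_winv_right')
    show "red (y2 @ z1) = []" by (metis y(3) z(2) red_append_red red_red_append red_winv_right')
    show "red (z2 @ x1) = []" by (metis z(3) x(2) red_append_red red_red_append red_winv_left')
  qed
qed


subsection \<open>Deleting letters\<close>

text \<open>The deletion description of the word norm; it does not depend on which word represents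
  an element, so letters may be deleted from any word.\<close>

inductive del_cost :: "('a \<times> bool) list \<Rightarrow> nat \<Rightarrow> bool" where
  nil: "del_cost [] n"
| del: "del_cost (u @ v) n \<Longrightarrow> del_cost (u @ x # v) (Suc n)"
| pair: "del_cost (u @ v) n \<Longrightarrow> del_cost (u @ x # flip x # v) n"

lemma del_cost_Suc: "del_cost w n \<Longrightarrow> del_cost w (Suc n)"
  by (induction rule: del_cost.induct) (auto intro: del_cost.intros)

text \<open>If the dropped letter was removed together with an inverse letter, then that partner is
  now deleted on its own.\<close>

lemma del_cost_drop: "del_cost w n \<Longrightarrow> w = u @ x # v \<Longrightarrow> del_cost (u @ v) (Suc n)"
proof (induction arbitrary: u v rule: del_cost.induct)
  case (del u' v' n y)
  from del.prems consider "u = u'" "v = v'" | w where "u' = u @ x # w" "v = w @ y # v'"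
    | w where "u = u' @ y # w" "v' = w @ x # v"
    unfolding append_Cons_eq_append_Cons by auto
  then show ?case
  proof cases
    case 1
    then show ?thesis using del.hyps del_cost_Suc by blast
  next
    case 2
    then show ?thesis using del.IH[of u "w @ v'"] del_cost.del[of "u @ w" v' "Suc n" y] by simp
  next
    case 3
    then show ?thesis using del.IH[of "u' @ w" v] del_cost.del[of u' "w @ v" "Suc n" y] by simp
  qed
next
  case (pair u' v' n y)
  from pair.prems consider "u = u'" "x = y" "v = flip y # v'" | "u = u' @ [y]" "x = flip y" "v = v'"
    | w where "u' = u @ x # w" "v = w @ y # flip y # v'"
    | w where "u = u' @ y # flip y # w" "v' = w @ x # v"
    unfolding append_Cons_eq_append_Cons by (auto simp: Cons_eq_append_conv)
  then show ?case
  proof cases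
    case 3
    then show ?thesis using pair.IH[of u "w @ v'"] del_cost.pair[of "u @ w" v' "Suc n" y] by simp
  next
    case 4
    then show ?thesis using pair.IH[of "u' @ w" v] del_cost.pair[of u' "w @ v" "Suc n" y] by simp
  qed (use pair.hyps in \<open>auto intro: del_cost.del\<close>)
qed simp

lemma del_cost_unpair: "del_cost w n \<Longrightarrow> w = u @ x # flip x # v \<Longrightarrow> del_cost (u @ v) n"
proof (induction arbitrary: u v x rule: del_cost.induct)
  case (del u' v' n y)
  from del.prems consider "u' = u" "v' = flip x # v" | "u' = u @ [x]" "v' = v"
    | w where "u' = u @ x # flip x # w" "v = w @ y # v'"
    | w where "u = u' @ y # w" "v' = w @ x # flip x # v"
    unfolding append_Cons_eq_append_Cons by (auto simp: Cons_eq_append_conv append_eq_Cons_conv)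
  then show ?case
  proof cases
    case 1
    then show ?thesis using del_cost_drop[OF del.hyps(1), of u "flip x" v] by simp
  next
    case 2
    then show ?thesis using del_cost_drop[OF del.hyps(1), of u x v] by simp
  next
    case 3
    then show ?thesis using del.IH[of u x "w @ v'"] del_cost.del[of "u @ w" v' n y] by simp
  next
    case 4
    then show ?thesis using del.IH[of "u' @ w" x v] del_cost.del[of u' "w @ v" n y] by simp
  qed
next
  case (pair u' v' n y)
  from pair.prems consider "u' = u" "v' = v" | "u' = u @ [x]" "y = flip x" "v = x # v'"
    | "u = u' @ [y]" "x = flip y" "v' = y # v"
    | w where "u' = u @ x # flip x # w" "v = w @ y # flip y # v'"
    | w where "u = u' @ y # flip y # w" "v' = w @ x # flip x # v"
    unfolding append_Cons_eq_append_Cons by (auto simp: Cons_eq_append_conv append_eq_Cons_conv)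
  then show ?case
  proof cases
    case 4
    then show ?thesis using pair.IH[of u x "w @ v'"] del_cost.pair[of "u @ w" v' n y] by simp
  next
    case 5
    then show ?thesis using pair.IH[of "u' @ w" x v] del_cost.pair[of u' "w @ v" n y] by simp
  qed (use pair.hyps in auto)
qed simp

lemma del_cost_pair_iff: "del_cost (u @ x # flip x # v) n \<longleftrightarrow> del_cost (u @ v) n"
  using del_cost_unpair del_cost.pair by blast

lemma del_cost_red: "del_cost (u @ red w) n \<longleftrightarrow> del_cost (u @ w) n"
proof (induction w arbitrary: u)
  case (Cons x w)
  have "del_cost (u @ fg_cons x r) n \<longleftrightarrow> del_cost (u @ x # r) n" for r
  proof (cases r)
    case (Cons y r')
    then show ?thesis by (simp add: fg_cons_Cons del_cost_pair_iff)
  qed simp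
  then show ?case using Cons.IH[of "u @ [x]"] by (simp add: red_Cons)
qed simp

lemma del_cost_insert_inverse: "del_cost (u @ v) n \<Longrightarrow> del_cost (u @ h @ winv h @ v) n"
proof (induction h arbitrary: u v)
  case (Cons x h)
  have "del_cost ((u @ [x]) @ flip x # v) n" using Cons.prems del_cost.pair by simp
  from Cons.IH[OF this] show ?case by simp
qed simp

lemma del_cost_subseq:
  "del_cost w n \<Longrightarrow> \<exists>s. subseq s w \<and> red s = [] \<and> length w \<le> length s + n"
proof (induction rule: del_cost.induct)
  case (nil n)
  show ?case by (intro exI[of _ "[]"]) simp
next
  case (del u v n x)
  then obtain s where s: "subseq s (u @ v)" "red s = []" "length (u @ v) \<le> length s + n" by blast
  have "subseq (u @ v) (u @ x # v)" by (simp add: subseq_append' list_emb_Cons)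
  with s show ?case by (intro exI[of _ s]) (auto intro: subseq_order.trans)
next
  case (pair u v n x)
  then obtain s where s: "subseq s (u @ v)" "red s = []" "length (u @ v) \<le> length s + n" by blast
  then obtain s1 s2 where s12: "s = s1 @ s2" "subseq s1 u" "subseq s2 v" by (auto elim: subseq_appendE)
  have "red (s1 @ x # flip x # s2) = red (s1 @ red ([x] @ winv [x] @ s2))" by simp
  also have "\<dots> = []" using s s12 by (simp only: red_winv_right red_append_red)
  finally show ?case using s s12
    by (intro exI[of _ "s1 @ x # flip x # s2"]) (auto intro: list_emb_append_mono)
qed


subsection \<open>The word norm as a conjugation-invariant norm\<close>

definition letter_weight :: "'a set \<Rightarrow> ('a \<times> bool) list \<Rightarrow> real \<Rightarrow> bool" where
  "letter_weight A s c \<longleftrightarrow> (\<exists>a\<in>A. \<exists>e. s = [(a, e)]) \<and> c = 1"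

lemma letter_weighted_set: "weighted_set (free_group A) (letter_weight A)"
proof (intro weighted_set.intro weighted_set_axioms.intro)
  show "group (free_group A)" by (rule group_free_group)
  fix s c assume "letter_weight A s c"
  then obtain a e where a: "a \<in> A" "s = [(a, e)]" "c = 1" by (auto simp: letter_weight_def)
  then show s: "s \<in> carrier (free_group A)" and "0 \<le> c"
    by (auto simp: free_group_carrier fg_reduced_def)
  show "letter_weight A (inv\<^bsub>free_group A\<^esub> s) c"
    using a free_group_inv[OF s] by (auto simp: letter_weight_def flip_def)
qed

context
  fixes A :: "'a set"
begin

interpretation W: weighted_set "free_group A" "letter_weight A" by (rule letter_weighted_set)

lemma letters_conj_cost: "fst ` set w \<subseteq> A \<Longrightarrow> W.conj_cost (red w) (real (length w))"
proof (induction w)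
  case Nil
  then show ?case using W.conj_cost.one by (simp add: free_group_one)
next
  case (Cons x w)
  have "letter_weight A [x] 1" using Cons.prems by (cases x) (auto simp: letter_weight_def)
  from W.conj_cost_mult[OF W.conj_cost_generator[OF this] Cons.IH]
  show ?case using Cons.prems red_closed[of w A]
    by (simp add: free_group_mult red_Cons red_append[of "[x]", simplified] red_id)
qed

lemma conj_cost_imp_del_cost: "W.conj_cost x c \<Longrightarrow> \<exists>n. c = real n \<and> del_cost x n"
proof (induction rule: W.conj_cost.induct)
  case one
  then show ?case by (intro exI[of _ 0]) (simp add: free_group_one del_cost.nil)
next
  case (conj x c h s d)
  then obtain n a e where n: "c = real n" "del_cost x n" and s: "s = [(a, e)]" "d = 1" "a \<in> A"
    by (auto simp: letter_weight_def)
  have x: "x \<in> carrier (free_group A)" using W.conj_cost_closed[OF conj.hyps(1)] by simp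
  have 1: "h \<otimes>\<^bsub>free_group A\<^esub> s \<otimes>\<^bsub>free_group A\<^esub> inv\<^bsub>free_group A\<^esub> h \<otimes>\<^bsub>free_group A\<^esub> x = red (h @ s @ winv h @ x)"
    using x conj.hyps(2) W.S_closed[OF conj.hyps(3)] W.inv_closed[OF conj.hyps(2)]
    by (simp add: W.m_assoc free_group_mult free_group_inv)
  have "del_cost (h @ winv h @ x) n" using del_cost_insert_inverse[of "[]" x n h] n by simp
  then have "del_cost (h @ s @ winv h @ x) (Suc n)"
    using del_cost.del[of h "winv h @ x" n] s by simp
  then have "del_cost (red (h @ s @ winv h @ x)) (Suc n)"
    using del_cost_red[of "[]" "h @ s @ winv h @ x" "Suc n"] by simp
  then show ?case unfolding 1 using n s by (intro exI[of _ "Suc n"]) simp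
qed

lemma word_norm_eq:
  assumes "x \<in> carrier (free_group A)" shows "word_norm A x = W.conj_norm x"
proof -
  let ?F = "free_group A"
  let ?P = "\<lambda>x n. \<exists>ws. length ws = n \<and>
     (\<forall>y\<in>set ws. \<exists>h\<in>carrier ?F. \<exists>a\<in>A. \<exists>e. y = h \<otimes>\<^bsub>?F\<^esub> [(a, e)] \<otimes>\<^bsub>?F\<^esub> inv\<^bsub>?F\<^esub> h) \<and>
     x = list_mult ?F ws"
  have 1: "(\<forall>y\<in>set ws. \<exists>h\<in>carrier ?F. \<exists>a\<in>A. \<exists>e. y = h \<otimes>\<^bsub>?F\<^esub> [(a, e)] \<otimes>\<^bsub>?F\<^esub> inv\<^bsub>?F\<^esub> h) \<Longrightarrow>
      W.conj_cost (list_mult ?F ws) (real (length ws))" for ws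
  proof (induction ws)
    case Nil
    then show ?case using W.conj_cost.one by (simp add: list_mult_def)
  next
    case (Cons y ws)
    then obtain h a e where y: "h \<in> carrier ?F" "a \<in> A" "y = h \<otimes>\<^bsub>?F\<^esub> [(a, e)] \<otimes>\<^bsub>?F\<^esub> inv\<^bsub>?F\<^esub> h"
      by auto
    have "letter_weight A [(a, e)] 1" using y by (auto simp: letter_weight_def)
    from W.conj_cost.conj[OF Cons.IH y(1) this] show ?case using Cons.prems y by (simp add: list_mult_def)
  qed
  have 2: "W.conj_cost x c \<Longrightarrow> \<exists>n. c = real n \<and> ?P x n" for x c
  proof (induction rule: W.conj_cost.induct)
    case one
    then show ?case by (intro exI[of _ 0]) (simp add: list_mult_def)
  next
    case (conj x c h s d)
    then obtain n ws where ws: "c = real n" "length ws = n"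
      "\<forall>y\<in>set ws. \<exists>h\<in>carrier ?F. \<exists>a\<in>A. \<exists>e. y = h \<otimes>\<^bsub>?F\<^esub> [(a, e)] \<otimes>\<^bsub>?F\<^esub> inv\<^bsub>?F\<^esub> h"
      "x = list_mult ?F ws" by blast
    obtain a e where s: "a \<in> A" "s = [(a, e)]" "d = 1" using conj.hyps by (auto simp: letter_weight_def)
    show ?case
      using ws s conj.hyps(2)
      by (intro exI[of _ "Suc n"] conjI exI[of _ "(h \<otimes>\<^bsub>?F\<^esub> s \<otimes>\<^bsub>?F\<^esub> inv\<^bsub>?F\<^esub> h) # ws"])
        (auto simp: list_mult_def)
  qed
  have eq: "{c. W.conj_cost x c} = real ` {n. ?P x n}"
    using 1 2[of x] by fastforce
  have x: "red x = x" "fst ` set x \<subseteq> A" using assms by (auto simp: free_group_carrier red_id)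
  have "\<exists>n. ?P x n" using 2[OF letters_conj_cost[OF x(2), unfolded x(1)]] by blast
  then have least: "?P x (LEAST n. ?P x n)" by (rule LeastI_ex)
  have "Inf (real ` {n. ?P x n}) = real (LEAST n. ?P x n)"
  proof (rule cInf_eq_minimum)
    show "real (LEAST n. ?P x n) \<in> real ` {n. ?P x n}" using least by blast
    show "real (LEAST n. ?P x n) \<le> y" if y: "y \<in> real ` {n. ?P x n}" for y
    proof -
      obtain n where "y = real n" "?P x n" using y by blast
      then show ?thesis using Least_le[of "?P x" n] by simp
    qed
  qed
  then show ?thesis unfolding W.conj_norm_def eq word_norm_def by simp
qed

lemma word_norm_pseudonorm: "conj_pseudonorm (free_group A) (word_norm A)"
proof -
  have "\<exists>c. W.conj_cost x c" if "x \<in> carrier (free_group A)" for x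
    using letters_conj_cost[of x] that by (auto simp: free_group_carrier red_id)
  then interpret N: conj_pseudonorm "free_group A" W.conj_norm by (rule W.conj_norm_pseudonorm)
  show ?thesis
    by unfold_locales (simp_all add: word_norm_eq N.nu_mult N.nu_conj)
qed

lemma word_norm_greatest:
  assumes x: "x \<in> carrier (free_group A)" and "\<And>c. W.conj_cost x c \<Longrightarrow> b \<le> c"
  shows "b \<le> word_norm A x"
  unfolding word_norm_eq[OF x] using letters_conj_cost[of x] x assms(2)
  by (intro W.conj_norm_greatest) (auto simp: free_group_carrier red_id)

interpretation N: conj_pseudonorm "free_group A" "word_norm A" by (rule word_norm_pseudonorm)

lemma word_norm_letters:
  assumes "fst ` set w \<subseteq> A" shows "word_norm A (red w) \<le> real (length w)"
  unfolding word_norm_eq[OF red_closed[OF assms]] by (rule W.conj_norm_le[OF letters_conj_cost[OF assms]])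

text \<open>A factorization into \<open>n\<close> conjugates of letters gives a word from which \<open>n\<close> letters can be
  deleted, and the number of deletions does not depend on the word.\<close>

lemma word_norm_trivial_subseq:
  assumes "fst ` set w \<subseteq> A"
  obtains s where "subseq s w" "red s = []" "real (length w) \<le> real (length s) + word_norm A (red w)"
proof (rule ccontr)
  assume *: "\<not> thesis"
  have "word_norm A (red w) + 1 \<le> word_norm A (red w)"
  proof (rule word_norm_greatest[OF red_closed[OF assms]])
    fix c assume "W.conj_cost (red w) c"
    then obtain n where n: "c = real n" "del_cost (red w) n" using conj_cost_imp_del_cost by blast
    have "del_cost w n" using n(2) del_cost_red[of "[]" w n] by simp
    then obtain s where "subseq s w" "red s = []" "length w \<le> length s + n"
      using del_cost_subseq by blast
    with * that have "\<not> (real (length w) \<le> real (length s) + word_norm A (red w))" by blast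
    then have "word_norm A (red w) < real n" using \<open>length w \<le> length s + n\<close> by linarith
    moreover obtain m where "word_norm A (red w) = real m" unfolding word_norm_def by blast
    ultimately have "m < n" by simp
    then show "word_norm A (red w) + 1 \<le> c" using n \<open>word_norm A (red w) = real m\<close> by simp
  qed
  then show False by simp
qed

lemma subseq_letters: "subseq s w \<Longrightarrow> fst ` set s \<subseteq> fst ` set w"
  using list_emb_set[of "(=)" s w] by blast

lemma dst_subseq:
  "subseq s w \<Longrightarrow> fst ` set w \<subseteq> A \<Longrightarrow> N.dst (red s) (red w) \<le> real (length w) - real (length s)"
proof (induction rule: list_emb.induct)
  case (list_emb_Nil w)
  then show ?case using word_norm_letters[of w] red_closed[of w] N.dst_one_left[of "red w"]
    by (simp add: free_group_one)
next
  case (list_emb_Cons s w y)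
  have s: "fst ` set s \<subseteq> A" using subseq_letters[OF list_emb_Cons.hyps] list_emb_Cons.prems by auto
  have y: "red (y # w) = red [y] \<otimes>\<^bsub>free_group A\<^esub> red w" "red [y] \<in> carrier (free_group A)"
    "word_norm A (red [y]) \<le> 1"
    using list_emb_Cons.prems word_norm_letters[of "[y]"] by (auto simp: red_mult intro!: red_closed)
  have "N.dst (\<one>\<^bsub>free_group A\<^esub> \<otimes>\<^bsub>free_group A\<^esub> red s) (red [y] \<otimes>\<^bsub>free_group A\<^esub> red w) \<le> N.dst \<one>\<^bsub>free_group A\<^esub> (red [y]) + N.dst (red s) (red w)"
    using y(2) list_emb_Cons.prems s by (intro N.dst_mult red_closed W.one_closed) auto
  moreover have "N.dst (red s) (red w) \<le> real (length w) - real (length s)"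
    using list_emb_Cons.IH list_emb_Cons.prems by simp
  ultimately show ?case unfolding y(1) using y(2,3) red_closed[OF s] by simp
next
  case (list_emb_Cons2 x y s w)
  have s: "fst ` set s \<subseteq> A" using subseq_letters[OF list_emb_Cons2.hyps(2)] list_emb_Cons2.prems by auto
  have y: "red (y # v) = red [y] \<otimes>\<^bsub>free_group A\<^esub> red v" "red [y] \<in> carrier (free_group A)" for v
    using list_emb_Cons2.prems by (auto simp: red_mult intro!: red_closed)
  have "N.dst (red [y] \<otimes>\<^bsub>free_group A\<^esub> red s) (red [y] \<otimes>\<^bsub>free_group A\<^esub> red w) \<le> N.dst (red [y]) (red [y]) + N.dst (red s) (red w)"
    using y(2) list_emb_Cons2.prems s by (intro N.dst_mult red_closed) auto
  moreover have "N.dst (red s) (red w) \<le> real (length w) - real (length s)"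
    using list_emb_Cons2.IH list_emb_Cons2.prems by simp
  moreover have "N.dst (red [y]) (red [y]) = 0" by (rule N.dst_self[OF y(2)])
  ultimately show ?case
    unfolding list_emb_Cons2.hyps(1) y(1)[of s] y(1)[of w] by simp
qed

text \<open>Delete letters until the product is trivial, cut the remaining triangle at its median,
  and put the deleted letters back; each of them is charged to one of the three bigons only.\<close>

theorem tripod:
  assumes "fst ` set (x @ y @ z) \<subseteq> A"
  obtains x1 x2 y1 y2 z1 z2 where "x = x1 @ x2" "y = y1 @ y2" "z = z1 @ z2"
    "word_norm A (red (x2 @ y1)) + word_norm A (red (y2 @ z1)) + word_norm A (red (z2 @ x1))
      \<le> word_norm A (red (x @ y @ z))"
proof -
  obtain s where s: "subseq s (x @ y @ z)" "red s = []"
    "real (length (x @ y @ z)) \<le> real (length s) + word_norm A (red (x @ y @ z))"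
    by (rule word_norm_trivial_subseq[OF assms])
  obtain sx sy sz where sxyz: "s = sx @ sy @ sz" "subseq sx x" "subseq sy y" "subseq sz z"
    using s(1) by (auto elim!: subseq_appendE)
  obtain x1' x2' y1' y2' z1' z2' where m: "sx = x1' @ x2'" "sy = y1' @ y2'" "sz = z1' @ z2'"
    "red (x2' @ y1') = []" "red (y2' @ z1') = []" "red (z2' @ x1') = []"
    by (rule median[OF s(2)[unfolded sxyz(1)]])
  obtain x1 x2 where x: "x = x1 @ x2" "subseq x1' x1" "subseq x2' x2"
    using list_emb_appendD[OF sxyz(2)[unfolded m(1)]] by blast
  obtain y1 y2 where y: "y = y1 @ y2" "subseq y1' y1" "subseq y2' y2"
    using list_emb_appendD[OF sxyz(3)[unfolded m(2)]] by blast
  obtain z1 z2 where z: "z = z1 @ z2" "subseq z1' z1" "subseq z2' z2"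
    using list_emb_appendD[OF sxyz(4)[unfolded m(3)]] by blast
  have le: "word_norm A (red (u @ v)) \<le> real (length (u @ v)) - real (length (u' @ v'))"
    if "subseq u' u" "subseq v' v" "red (u' @ v') = []" "fst ` set (u @ v) \<subseteq> A" for u v u' v'
    using dst_subseq[OF list_emb_append_mono[OF that(1,2)] that(4)] that(3,4)
      N.dst_one_left[of "red (u @ v)"] red_closed[of "u @ v" A] by (simp add: free_group_one)
  show ?thesis
  proof (rule that[OF x(1) y(1) z(1)])
    show "word_norm A (red (x2 @ y1)) + word_norm A (red (y2 @ z1)) + word_norm A (red (z2 @ x1))
      \<le> word_norm A (red (x @ y @ z))"
      using le[OF x(3) y(2) m(4)] le[OF y(3) z(2) m(5)] le[OF z(3) x(2) m(6)] assms s(3)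
      by (auto simp: x y z sxyz m image_Un)
  qed
qed

end


section \<open>Counting subwords\<close>

fun occ :: "'b list \<Rightarrow> 'b list \<Rightarrow> nat" where
  "occ u [] = 0"
| "occ u (x # w) = (if prefix u (x # w) then 1 else 0) + occ u w"

lemma occ_append_ge: "occ u v + occ u w \<le> occ u (v @ w)"
proof (induction v)
  case (Cons x v)
  then show ?case using prefix_prefix[of u "x # v" w] by auto
qed simp

text \<open>Only occurrences that start in \<open>v\<close> and reach into \<open>w\<close> are new.\<close>

lemma occ_append_le: "occ u (v @ w) \<le> occ u v + occ u w + min (length v) (length u)"
proof (induction v)
  case (Cons x v)
  have "prefix u (x # v)" if "prefix u (x # v @ w)" "length u \<le> Suc (length v)"
    using that prefix_length_prefix[of u "(x # v) @ w" "x # v"] by simp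
  then show ?case using Cons by (auto simp: min_def split: if_splits)
qed simp

lemma occ_snoc: "u \<noteq> [] \<Longrightarrow> occ u (w @ [x]) = occ u w + (if suffix u (w @ [x]) then 1 else 0)"
proof (induction w)
  case Nil
  then show ?case by (cases u) (auto simp: suffix_Cons)
next
  case (Cons y w)
  have "prefix u (y # w @ [x]) \<longleftrightarrow> prefix u (y # w) \<or> u = y # w @ [x]"
    using prefix_snoc[of u "y # w" x] by auto
  moreover have "suffix u (y # w @ [x]) \<longleftrightarrow> suffix u (w @ [x]) \<or> u = y # w @ [x]"
    using suffix_Cons[of u y "w @ [x]"] by auto
  moreover have "\<not> prefix u (y # w)" "\<not> suffix u (w @ [x])" if "u = y # w @ [x]"
    using prefix_length_le[of u "y # w"] suffix_length_le[of u "w @ [x]"] that by auto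
  ultimately show ?case using Cons by auto
qed

lemma occ_winv:
  assumes "u \<noteq> []" shows "occ (winv u) (winv w) = occ u w"
proof (induction w)
  case (Cons x w)
  have *: "suffix (winv v) (winv w)" if "prefix v w" for v w
    using that by (auto simp: prefix_def suffix_def)
  have **: "prefix (winv v) (winv w)" if "suffix v w" for v w
    using that by (auto simp: prefix_def suffix_def)
  have "suffix (winv u) (winv (x # w)) \<longleftrightarrow> prefix u (x # w)"
    using *[of u "x # w"] **[of "winv u" "winv (x # w)"] unfolding winv_simps(4) by blast
  moreover have "winv u \<noteq> []" using assms by (metis winv_simps(1,4))
  then have "occ (winv u) (winv (x # w)) =
      occ (winv u) (winv w) + (if suffix (winv u) (winv (x # w)) then 1 else 0)"
    unfolding winv_simps(3) by (rule occ_snoc)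
  ultimately show ?case using Cons.IH by (simp only: occ.simps add.commute)
qed simp

lemma occ_factor: "occ u w \<noteq> 0 \<Longrightarrow> \<exists>p q. w = p @ u @ q"
proof (induction w)
  case (Cons x w)
  show ?case
  proof (cases "prefix u (x # w)")
    case True
    then have "\<exists>q. x # w = [] @ u @ q" by (simp add: prefix_def)
    then show ?thesis by (rule exI)
  next
    case False
    then obtain p q where "w = p @ u @ q" using Cons by auto
    then have "x # w = (x # p) @ u @ q" by simp
    then show ?thesis by blast
  qed
qed simp

definition word_pow :: "nat \<Rightarrow> 'b list \<Rightarrow> 'b list" where "word_pow n r = concat (replicate n r)"

lemma word_pow_simps [simp]: "word_pow 0 r = []" "word_pow (Suc n) r = r @ word_pow n r" "word_pow n [] = []" "length (word_pow n r) = n * length r"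
  by (induction n) (auto simp: word_pow_def)

lemma word_pow_add: "word_pow (m + n) r = word_pow m r @ word_pow n r"
  by (induction m) auto

lemma word_pow_snoc: "word_pow n r @ r = r @ word_pow n r"
  by (induction n) auto

lemma winv_word_pow: "winv (word_pow n r) = word_pow n (winv r)"
  by (induction n) (auto simp: word_pow_snoc)

lemma word_pow_set: "f ` set (word_pow n r) \<subseteq> f ` set r"
  by (induction n) auto

lemma word_pow_eq_Nil: "word_pow n r = [] \<longleftrightarrow> n = 0 \<or> r = []"
  by (cases n) auto

lemma word_pow_nth: "i < n * length r \<Longrightarrow> word_pow n r ! i = r ! (i mod length r)"
proof (induction n arbitrary: i)
  case (Suc n)
  show ?case
  proof (cases "i < length r")
    case False
    then have "word_pow n r ! (i - length r) = r ! ((i - length r) mod length r)" using Suc by auto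
    then show ?thesis using False by (simp add: nth_append le_mod_geq)
  qed (simp add: nth_append)
qed simp

text \<open>The letters of a power of \<open>s\<close> depend only on the position modulo the length of \<open>s\<close>.\<close>

lemma periodic_factor:
  assumes "word_pow m s = p @ v @ q" "length v = j * length s"
  shows "v = word_pow j (rotate (length p) s)"
proof (rule nth_equalityI)
  show "length v = length (word_pow j (rotate (length p) s))" using assms by simp
  fix i assume i: "i < length v"
  then have s: "length s > 0" using assms(2) by (cases s) auto
  have len: "length p + i < m * length s"
    using arg_cong[OF assms(1), of length] i by simp
  have "v ! i = word_pow m s ! (length p + i)" using i by (simp add: assms(1) nth_append)
  also have "\<dots> = s ! ((length p + i mod length s) mod length s)" using word_pow_nth[OF len] by (simp add: mod_add_right_eq)
  also have "\<dots> = rotate (length p) s ! (i mod length s)" using s by (simp add: nth_rotate)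
  also have "\<dots> = word_pow j (rotate (length p) s) ! i" using i assms(2) word_pow_nth[of i j "rotate (length p) s"] by simp
  finally show "v ! i = word_pow j (rotate (length p) s) ! i" .
qed

lemma occ_word_pow_ge: "r \<noteq> [] \<Longrightarrow> n \<le> occ (word_pow N r) (word_pow n r) + N"
proof (induction n)
  case (Suc n)
  obtain x r' where r: "r = x # r'" using Suc.prems by (cases r) auto
  have 1: "occ (word_pow N r) (word_pow n r) \<le> occ (word_pow N r) (r' @ word_pow n r)"
    using occ_append_ge[of "word_pow N r" r' "word_pow n r"] by linarith
  have 2: "prefix (word_pow N r) (word_pow (Suc n) r)" if "N \<le> Suc n"
    using word_pow_add[of N "Suc n - N" r] that by (auto simp: prefix_def)
  have "occ (word_pow N r) (word_pow (Suc n) r) = (if prefix (word_pow N r) (word_pow (Suc n) r) then 1 else 0) + occ (word_pow N r) (r' @ word_pow n r)"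
    by (simp add: r)
  then show ?case using 1 2 Suc by (cases "N \<le> Suc n") auto
qed simp


subsection \<open>A quasimorphism on the free group\<close>

text \<open>Brooks' counting quasimorphism.\<close>

definition brooks :: "('a \<times> bool) list \<Rightarrow> ('a \<times> bool) list \<Rightarrow> real" where
  "brooks u w = real (occ u w) - real (occ (winv u) w)"

lemma brooks_append: "\<bar>brooks u (v @ w) - brooks u v - brooks u w\<bar> \<le> real (length u)"
  using occ_append_ge[of u v w] occ_append_le[of u v w]
    occ_append_ge[of "winv u" v w] occ_append_le[of "winv u" v w]
  unfolding brooks_def by simp

lemma brooks_winv:
  assumes "u \<noteq> []" shows "brooks u (winv w) = - brooks u w"
proof -
  have "winv u \<noteq> []" using assms by (metis winv_simps(1,4))
  then show ?thesis using occ_winv[OF assms, of w] occ_winv[of "winv u" w] by (simp add: brooks_def)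
qed

text \<open>Write the two factors as \<open>a c\<close> and \<open>c\<inverse> b\<close> with \<open>a b\<close> reduced: the contributions of \<open>c\<close> and
  \<open>c\<inverse>\<close> cancel, and each of the three concatenations changes the count by at most the length
  of the counted word.\<close>

lemma brooks_red:
  assumes "u \<noteq> []" "fg_reduced x" "fg_reduced y"
  shows "\<bar>brooks u (red (x @ y)) - brooks u x - brooks u y\<bar> \<le> 3 * real (length u)"
proof -
  obtain a c b where abc: "x = a @ c" "y = winv c @ b" "fg_reduced (a @ b)"
    using cancellation[OF assms(2,3)] .
  have "red (x @ y) = red (a @ red (c @ winv c @ b))" unfolding abc by (simp only: red_append_red append_assoc)
  also have "\<dots> = a @ b" using abc(3) by (simp add: red_id)
  finally have "red (x @ y) = a @ b" .
  then show ?thesis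
    using brooks_append[of u a c] brooks_append[of u "winv c" b] brooks_append[of u a b]
      brooks_winv[OF assms(1), of c] abc(1,2) by simp
qed

lemma brooks_conj:
  assumes "u \<noteq> []" "fg_reduced h" "fg_reduced x"
  shows "\<bar>brooks u (red (h @ x @ winv h)) - brooks u x\<bar> \<le> 6 * real (length u)"
  using brooks_red[OF assms(1,2) red_reduced[of "x @ winv h"]] 
    brooks_red[OF assms(1,3) fg_reduced_winv[OF assms(2)]] brooks_winv[OF assms(1), of h]
  by simp

lemma brooks_le_word_norm:
  assumes u: "u \<noteq> []" and x: "x \<in> carrier (free_group A)"
  shows "\<bar>brooks u x\<bar> \<le> 10 * real (length u) * word_norm A x"
proof -
  interpret W: weighted_set "free_group A" "letter_weight A" by (rule letter_weighted_set)
  let ?L = "real (length u)"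
  have L: "?L \<ge> 1" using u by (cases u) auto
  \<comment> \<open>Each factor costs \<open>3 ?L\<close> for the product, \<open>6 ?L\<close> for the conjugation and at most \<open>1 \<le> ?L\<close> for the letter.\<close>
  have *: "W.conj_cost x c \<Longrightarrow> \<bar>brooks u x\<bar> \<le> 10 * ?L * c" for x c
  proof (induction rule: W.conj_cost.induct)
    case one
    then show ?case by (simp add: free_group_one brooks_def)
  next
    case (conj x c h s d)
    obtain a e where s: "s = [(a, e)]" "d = 1" using conj.hyps(3) by (auto simp: letter_weight_def)
    have r: "fg_reduced x" "fg_reduced h" "fg_reduced s"
      using conj.hyps(2) W.conj_cost_closed[OF conj.hyps(1)] W.S_closed[OF conj.hyps(3)]
      by (auto simp: free_group_carrier)
    have eq: "h \<otimes>\<^bsub>free_group A\<^esub> s \<otimes>\<^bsub>free_group A\<^esub> inv\<^bsub>free_group A\<^esub> h \<otimes>\<^bsub>free_group A\<^esub> x = red (red (h @ s @ winv h) @ x)"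
      using conj.hyps(2) W.conj_cost_closed[OF conj.hyps(1)] W.S_closed[OF conj.hyps(3)] W.inv_closed[OF conj.hyps(2)]
      by (simp add: W.m_assoc free_group_mult free_group_inv)
    have "\<bar>brooks u s\<bar> \<le> 1" by (auto simp: brooks_def s)
    moreover have "10 * ?L * (d + c) = 10 * ?L + 10 * ?L * c" by (simp add: s algebra_simps)
    ultimately show ?case
      using brooks_red[OF u red_reduced r(1), of "h @ s @ winv h"] brooks_conj[OF u r(2,3)] conj.IH L
      unfolding eq by linarith
  qed
  have "\<bar>brooks u x\<bar> / (10 * ?L) \<le> word_norm A x"
  proof (rule word_norm_greatest[OF x])
    show "\<bar>brooks u x\<bar> / (10 * ?L) \<le> c" if "W.conj_cost x c" for c
    proof -
      have "\<bar>brooks u x\<bar> \<le> c * (10 * ?L)" using *[OF that] by (simp only: mult.commute[of c])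
      moreover have "10 * ?L > 0" using L by linarith
      ultimately show ?thesis by (simp only: pos_divide_le_eq)
    qed
  qed
  moreover have "10 * ?L > 0" using L by linarith
  ultimately show ?thesis by (simp only: pos_divide_le_eq mult.commute)
qed


section \<open>Separation of incommensurable elements\<close>

text \<open>The exponent \<open>b\<close> may be negative or zero; for nontrivial \<open>x\<close> in a free group it cannot be zero,
  and the relation is then symmetric.\<close>

definition commensurable :: "('a, 'm) monoid_scheme \<Rightarrow> 'a \<Rightarrow> 'a \<Rightarrow> bool" where
  "commensurable G x y \<longleftrightarrow> (\<exists>a::nat. \<exists>b::int. \<exists>h\<in>carrier G. 1 \<le> a \<and>
     x [^]\<^bsub>G\<^esub> a = h \<otimes>\<^bsub>G\<^esub> y [^]\<^bsub>G\<^esub> b \<otimes>\<^bsub>G\<^esub> inv\<^bsub>G\<^esub> h)"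

lemma cyclic_reduction:
  assumes "fg_reduced p"
  obtains k r where "p = k @ r @ winv k" "\<And>n. fg_reduced (word_pow n r)"
proof -
  have "\<exists>k r. p = k @ r @ winv k \<and> fg_reduced (r @ r)"
    using assms
  proof (induction p rule: length_induct)
    case (1 p)
    show ?case
    proof (cases "fg_reduced (p @ p)")
      case True
      then show ?thesis by (intro exI[of _ "[]"] exI[of _ p]) simp
    next
      case False
      then have ne: "p \<noteq> []" and hd: "hd p = flip (last p)" using 1(2) by (auto simp: fg_reduced_append_iff)
      then obtain x p' where p: "p = x # p'" by (cases p) auto
      then have p': "p' \<noteq> []" using hd by auto
      then obtain m y where m: "p' = m @ [y]" by (metis append_butlast_last_id)
      have y: "y = flip x" using hd p m by simp
      have "fg_reduced ([x] @ m @ [flip x])" using 1(2) by (simp add: p m y)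
      then have "fg_reduced m" unfolding fg_reduced_append_iff by simp
      then obtain k r where "m = k @ r @ winv k" "fg_reduced (r @ r)"
        using 1(1)[rule_format, of m] p m by auto
      then show ?thesis by (intro exI[of _ "x # k"] exI[of _ r]) (simp add: p m y)
    qed
  qed
  then obtain k r where kr: "p = k @ r @ winv k" "fg_reduced (r @ r)" by blast
  have "fg_reduced (word_pow n r) \<and> fg_reduced (r @ word_pow n r)" for n
  proof (induction n)
    case (Suc n)
    have "r @ r @ word_pow n r = (r @ r) @ word_pow n r" by simp
    show ?case
    proof (cases "r = []")
      case False
      have "fg_reduced (r @ word_pow (Suc n) r)"
        using kr(2) Suc False by (simp add: fg_reduced_append_iff[of r])
      then show ?thesis using Suc by simp
    qed simp
  qed (use kr(2) in \<open>auto simp: fg_reduced_append_iff\<close>)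
  then show ?thesis using that kr by blast
qed

text \<open>The middle of such a word would be a letter equal to its own inverse or two cancelling
  letters.\<close>

lemma winv_fixed: "fg_reduced a \<Longrightarrow> winv a = a \<Longrightarrow> a = []"
proof (induction a rule: length_induct)
  case (1 a)
  show ?case
  proof (rule ccontr)
    assume "a \<noteq> []"
    then obtain x a' where a: "a = x # a'" by (cases a) auto
    show False
    proof (cases "a' = []")
      case True
      then show False using 1 a by simp
    next
      case False
      then obtain m y where m: "a' = m @ [y]" by (metis append_butlast_last_id)
      then have y: "y = flip x" "winv m = m" using 1(3) a by auto
      have "fg_reduced ([x] @ m @ [flip x])" using 1(2) by (simp add: a m y)
      moreover from this have "fg_reduced m" unfolding fg_reduced_append_iff by simp
      then have "m = []" using 1(1) y(2) a m by auto
      ultimately show False by (simp add: fg_reduced_iff)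
    qed
  qed
qed

lemma word_pow_inj: "word_pow n r = word_pow n s \<Longrightarrow> length r = length s \<Longrightarrow> n \<ge> 1 \<Longrightarrow> r = s"
  by (cases n) auto

text \<open>If \<open>r = a b\<close> and \<open>b a\<close> is the inverse word of \<open>r\<close>, then \<open>a\<close> and \<open>b\<close> are their own inverse words.
  So a power of \<open>r\<close> never contains the inverse of a long power of \<open>r\<close>.\<close>

lemma inverse_not_rotation:
  assumes "fg_reduced r" "winv r = rotate k r" shows "r = []"
proof -
  define a b where "a = take (k mod length r) r" and "b = drop (k mod length r) r"
  have ab: "r = a @ b" "rotate k r = b @ a" by (simp_all add: a_def b_def rotate_drop_take)
  have "winv (a @ b) = b @ a" using assms(2) ab by metis
  then have "winv b = b" "winv a = a" by simp_all
  moreover have "fg_reduced a" "fg_reduced b" using assms(1) unfolding ab(1) by (simp_all add: fg_reduced_append_iff)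
  ultimately show ?thesis using winv_fixed ab by auto
qed

context
  fixes A :: "'a set"
begin

private abbreviation (input) F where "F \<equiv> free_group A"

interpretation N: conj_pseudonorm F "word_norm A" by (rule word_norm_pseudonorm)

lemma red_pow: "fst ` set w \<subseteq> A \<Longrightarrow> red w [^]\<^bsub>F\<^esub> n = red (word_pow n w)"
proof (induction n)
  case 0
  then show ?case by (simp add: free_group_one)
next
  case (Suc n)
  then show ?case by (simp add: red_mult word_pow_snoc)
qed

lemma conj_red:
  assumes "fst ` set h \<subseteq> A" "fst ` set w \<subseteq> A"
  shows "red (h @ w @ winv h) = red h \<otimes>\<^bsub>F\<^esub> red w \<otimes>\<^bsub>F\<^esub> inv\<^bsub>F\<^esub> red h"
proof -
  have "inv\<^bsub>F\<^esub> red h = red (winv h)"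
  proof (rule N.inv_equality)
    show "red (winv h) \<otimes>\<^bsub>F\<^esub> red h = \<one>\<^bsub>F\<^esub>" by (simp add: red_mult free_group_one)
  qed (use assms in \<open>simp_all add: red_closed\<close>)
  then show ?thesis by (simp add: red_mult)
qed

lemma conj_reduced:
  "h \<in> carrier F \<Longrightarrow> x \<in> carrier F \<Longrightarrow> h \<otimes>\<^bsub>F\<^esub> x \<otimes>\<^bsub>F\<^esub> inv\<^bsub>F\<^esub> h = red (h @ x @ winv h)"
  using conj_red[of h x] by (simp add: free_group_carrier red_id)

lemma conj_nat_pow:
  assumes "h \<in> carrier F" "x \<in> carrier F"
  shows "(h \<otimes>\<^bsub>F\<^esub> x \<otimes>\<^bsub>F\<^esub> inv\<^bsub>F\<^esub> h) [^]\<^bsub>F\<^esub> (n::nat) = h \<otimes>\<^bsub>F\<^esub> x [^]\<^bsub>F\<^esub> n \<otimes>\<^bsub>F\<^esub> inv\<^bsub>F\<^esub> h"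
proof (induction n)
  case (Suc n)
  have "inv\<^bsub>F\<^esub> h \<otimes>\<^bsub>F\<^esub> (h \<otimes>\<^bsub>F\<^esub> y) = y" if "y \<in> carrier F" for y
    using assms that by (simp add: N.m_assoc [symmetric])
  then show ?case using Suc assms by (simp add: N.m_assoc)
qed (use assms in simp)

lemma conj_int_pow:
  assumes "h \<in> carrier F" "x \<in> carrier F"
  shows "(h \<otimes>\<^bsub>F\<^esub> x \<otimes>\<^bsub>F\<^esub> inv\<^bsub>F\<^esub> h) [^]\<^bsub>F\<^esub> (n::int) = h \<otimes>\<^bsub>F\<^esub> x [^]\<^bsub>F\<^esub> n \<otimes>\<^bsub>F\<^esub> inv\<^bsub>F\<^esub> h"
proof (cases n rule: int_cases2)
  case (nonneg k)
  then show ?thesis using conj_nat_pow[OF assms, of k] by (simp add: int_pow_int)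
next
  case (nonpos k)
  then show ?thesis using conj_nat_pow[OF assms, of k] assms
    by (simp add: int_pow_int N.int_pow_neg N.inv_mult_group N.m_assoc)
qed

lemma rotation_conj:
  assumes "fst ` set s \<subseteq> A"
  obtains h where "h \<in> carrier F" "red (rotate k s) = h \<otimes>\<^bsub>F\<^esub> red s \<otimes>\<^bsub>F\<^esub> inv\<^bsub>F\<^esub> h"
proof -
  define a b where "a = take (k mod length s) s" and "b = drop (k mod length s) s"
  have ab: "s = a @ b" "rotate k s = b @ a" by (simp_all add: a_def b_def rotate_drop_take)
  have "red (winv a @ s @ winv (winv a)) = red (b @ a)"
    by (simp add: ab)
  moreover have "fst ` set (winv a) \<subseteq> A" using assms ab by auto
  ultimately show ?thesis using that[OF red_closed[of "winv a"]] conj_red[of "winv a" s] assms ab by simp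
qed

text \<open>A factor of length \<open>\<bar>r\<bar> \<bar>s\<bar>\<close> of a power of \<open>s\<close> is a power of a rotation of \<open>s\<close>. If it were also
  the \<open>\<bar>s\<bar>\<close>-th power of \<open>r\<close> or of its inverse, then \<open>r\<close> and \<open>s\<close> would be commensurable.\<close>

lemma incommensurable_no_factor:
  assumes r: "fst ` set r \<subseteq> A" "r \<noteq> []" and s: "fst ` set s \<subseteq> A"
    and nc: "\<not> commensurable F (red r) (red s)" and N: "N = max 1 (length s)"
    and v: "v = word_pow N r \<or> v = winv (word_pow N r)"
  shows "occ v (word_pow m s) = 0"
proof (rule ccontr)
  assume "occ v (word_pow m s) \<noteq> 0"
  then obtain p q where pq: "word_pow m s = p @ v @ q" using occ_factor by blast
  have "length v = N * length r" using v by auto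
  then have "v \<noteq> []" using r N by auto
  then have sn: "s \<noteq> []" using pq by auto
  \<comment> \<open>The maximum with \<open>1\<close> in \<open>N\<close> only matters when \<open>s\<close> is empty.\<close>
  then have N': "N = length s" using N by (cases s) auto
  have "length v = length r * length s" using v N' by auto
  from periodic_factor[OF pq this] have veq: "v = word_pow (length r) (rotate (length p) s)" .
  obtain h where h: "h \<in> carrier F" "red (rotate (length p) s) = h \<otimes>\<^bsub>F\<^esub> red s \<otimes>\<^bsub>F\<^esub> inv\<^bsub>F\<^esub> h"
    using rotation_conj[OF s] .
  have rv: "red v = h \<otimes>\<^bsub>F\<^esub> red s [^]\<^bsub>F\<^esub> length r \<otimes>\<^bsub>F\<^esub> inv\<^bsub>F\<^esub> h"
    using red_pow[of "rotate (length p) s" "length r"] s h conj_nat_pow[OF h(1) red_closed[OF s]]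
    by (simp add: veq)
  have rN: "red (word_pow N r) = red r [^]\<^bsub>F\<^esub> N" by (rule red_pow[OF r(1), symmetric])
  have "\<exists>b::int. red r [^]\<^bsub>F\<^esub> N = h \<otimes>\<^bsub>F\<^esub> red s [^]\<^bsub>F\<^esub> b \<otimes>\<^bsub>F\<^esub> inv\<^bsub>F\<^esub> h"
    using v
  proof
    assume "v = word_pow N r"
    then show ?thesis using rv rN by (intro exI[of _ "int (length r)"]) (simp add: int_pow_int)
  next
    assume v: "v = winv (word_pow N r)"
    have "red v \<otimes>\<^bsub>F\<^esub> red (word_pow N r) = \<one>\<^bsub>F\<^esub>" by (simp add: v red_mult free_group_one)
    moreover have "fst ` set (word_pow N r) \<subseteq> A" using r(1) word_pow_set[of fst N r] by blast
    then have cl: "red v \<in> carrier F" "red (word_pow N r) \<in> carrier F" by (simp_all add: v red_closed)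
    ultimately have "red (word_pow N r) = inv\<^bsub>F\<^esub> red v" 
      using N.inv_equality[of "red v" "red (word_pow N r)"] N.inv_inv by metis
    then show ?thesis using rv rN h(1) red_closed[OF s]
      by (intro exI[of _ "- int (length r)"]) (simp add: N.int_pow_neg int_pow_int N.inv_mult_group N.m_assoc)
  qed
  then show False using nc h(1) N unfolding commensurable_def by (metis max.cobounded1)
qed

text \<open>Count occurrences of a high power of the cyclic reduction of \<open>p\<close>. The count grows like \<open>n\<close> on
  \<open>p\<^sup>n\<close>, is bounded on powers of \<open>q\<close>, and is Lipschitz for the word norm. This yields a linear lower
  bound up to an additive constant, which is removed by replacing \<open>n\<close> and \<open>m\<close> by large multiples.\<close>

theorem incommensurable_separated:
  assumes p: "p \<in> carrier F" "p \<noteq> \<one>\<^bsub>F\<^esub>" and q: "q \<in> carrier F" and nc: "\<not> commensurable F p q"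
  shows "\<exists>\<delta>>0. \<forall>n m. \<delta> * \<bar>of_int n\<bar> \<le> word_norm A (p [^]\<^bsub>F\<^esub> (n::int) \<otimes>\<^bsub>F\<^esub> q [^]\<^bsub>F\<^esub> (m::int))"
proof -
  obtain k r where kr: "p = k @ r @ winv k" "\<And>n. fg_reduced (word_pow n r)"
    using cyclic_reduction p by (auto simp: free_group_carrier)
  obtain l s where ls: "q = l @ s @ winv l" "\<And>n. fg_reduced (word_pow n s)"
    using cyclic_reduction q by (auto simp: free_group_carrier)
  have lets: "fst ` set k \<subseteq> A" "fst ` set r \<subseteq> A" "fst ` set l \<subseteq> A" "fst ` set s \<subseteq> A"
    using p q by (auto simp: free_group_carrier kr ls image_Un)
  have "red p = p" using p(1) by (simp add: free_group_carrier red_id)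
  then have "r \<noteq> []" using p(2) by (auto simp: kr(1) free_group_one)
  then have r: "r \<noteq> []" "red r = r" "r \<in> carrier F"
    using kr(2)[of 1] lets(2) by (auto simp: free_group_carrier red_id)
  have s: "red s = s" "s \<in> carrier F" using ls(2)[of 1] lets(4) by (auto simp: free_group_carrier red_id)
  have kl: "red k = k" "red l = l" "k \<in> carrier F" "l \<in> carrier F"
    using p q lets by (auto simp: free_group_carrier kr ls fg_reduced_append_iff red_id)
  have pe: "p = k \<otimes>\<^bsub>F\<^esub> r \<otimes>\<^bsub>F\<^esub> inv\<^bsub>F\<^esub> k" and qe: "q = l \<otimes>\<^bsub>F\<^esub> s \<otimes>\<^bsub>F\<^esub> inv\<^bsub>F\<^esub> l"
    using conj_red[OF lets(1,2)] conj_red[OF lets(3,4)] p(1) q kl r(2) s(1)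
    by (simp_all add: free_group_carrier red_id flip: kr(1) ls(1))
  have nc': "\<not> commensurable F (red r) (red s)"
  proof
    assume "commensurable F (red r) (red s)"
    then obtain a b h where ab: "1 \<le> a" "h \<in> carrier F"
      "r [^]\<^bsub>F\<^esub> (a::nat) = h \<otimes>\<^bsub>F\<^esub> s [^]\<^bsub>F\<^esub> (b::int) \<otimes>\<^bsub>F\<^esub> inv\<^bsub>F\<^esub> h"
      unfolding commensurable_def r s by blast
    let ?h = "k \<otimes>\<^bsub>F\<^esub> h \<otimes>\<^bsub>F\<^esub> inv\<^bsub>F\<^esub> l"
    have "inv\<^bsub>F\<^esub> l \<otimes>\<^bsub>F\<^esub> (l \<otimes>\<^bsub>F\<^esub> y) = y" if "y \<in> carrier F" for y
      using kl that by (simp add: N.m_assoc [symmetric])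
    moreover have "p [^]\<^bsub>F\<^esub> a = k \<otimes>\<^bsub>F\<^esub> r [^]\<^bsub>F\<^esub> a \<otimes>\<^bsub>F\<^esub> inv\<^bsub>F\<^esub> k"
      unfolding pe by (rule conj_nat_pow[OF kl(3) r(3)])
    moreover have "q [^]\<^bsub>F\<^esub> b = l \<otimes>\<^bsub>F\<^esub> s [^]\<^bsub>F\<^esub> b \<otimes>\<^bsub>F\<^esub> inv\<^bsub>F\<^esub> l"
      unfolding qe by (rule conj_int_pow[OF kl(4) s(2)])
    ultimately have "p [^]\<^bsub>F\<^esub> a = ?h \<otimes>\<^bsub>F\<^esub> q [^]\<^bsub>F\<^esub> b \<otimes>\<^bsub>F\<^esub> inv\<^bsub>F\<^esub> ?h"
      using ab kl r(3) s(2) by (simp add: N.m_assoc N.inv_mult_group)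
    moreover have "?h \<in> carrier F" using ab kl by simp
    ultimately show False using nc ab(1) unfolding commensurable_def by blast
  qed
  define N where "N = max 1 (length s)"
  define u where "u = word_pow N r"
  have u: "u \<noteq> []" using r by (auto simp: u_def N_def word_pow_eq_Nil)
  let ?L = "real (length u)"
  have bs: "brooks u (word_pow m s) = 0" for m
    using incommensurable_no_factor[OF lets(2) r(1) lets(4) nc' N_def] by (simp add: brooks_def u_def)
  have br: "brooks u (word_pow n r) \<ge> real n - real N" for n
  proof -
    have "occ (winv u) (word_pow n r) = 0"
    proof (rule ccontr)
      assume "occ (winv u) (word_pow n r) \<noteq> 0"
      then obtain a b where ab: "word_pow n r = a @ winv u @ b" using occ_factor by blast
      have "winv u = word_pow N (rotate (length a) r)" by (rule periodic_factor[OF ab]) (simp add: u_def)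
      then have "winv r = rotate (length a) r"
        using word_pow_inj[of N "winv r"] by (simp add: u_def winv_word_pow N_def)
      then show False using inverse_not_rotation[of r "length a"] r kr(2)[of 1] by simp
    qed
    then show ?thesis using occ_word_pow_ge[OF r(1), of n N] by (simp add: brooks_def u_def)
  qed
  have pow_int: "x [^]\<^bsub>F\<^esub> (n::int) = (if n \<ge> 0 then word_pow (nat n) x else winv (word_pow (nat (- n)) x))"
    if "x \<in> carrier F" "red x = x" "\<And>n. fg_reduced (word_pow n x)" for x n
  proof -
    have nat: "x [^]\<^bsub>F\<^esub> (j::nat) = word_pow j x" for j
      using red_pow[of x j] that by (simp add: free_group_carrier red_id)
    show ?thesis
    proof (cases n rule: int_cases2)
      case (nonneg j)
      then show ?thesis using nat[of j] by (simp add: int_pow_int)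
    next
      case (nonpos j)
      have "word_pow j x \<in> carrier F" using nat[of j] that(1) by (metis N.nat_pow_closed)
      then show ?thesis using nonpos nat[of j] that(1)
        by (simp add: int_pow_int N.int_pow_neg free_group_inv)
    qed
  qed
  have lower: "\<bar>of_int n\<bar> - (real N + 15 * ?L) \<le> 10 * ?L * word_norm A (p [^]\<^bsub>F\<^esub> n \<otimes>\<^bsub>F\<^esub> q [^]\<^bsub>F\<^esub> m)" for n m :: int
  proof -
    have pn: "p [^]\<^bsub>F\<^esub> n = red (k @ r [^]\<^bsub>F\<^esub> n @ winv k)" and qm: "q [^]\<^bsub>F\<^esub> m = red (l @ s [^]\<^bsub>F\<^esub> m @ winv l)"
      using conj_int_pow[OF kl(3) r(3), of n] conj_reduced[OF kl(3), of "r [^]\<^bsub>F\<^esub> n"]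
        conj_int_pow[OF kl(4) s(2), of m] conj_reduced[OF kl(4), of "s [^]\<^bsub>F\<^esub> m"] r(3) s(2)
      unfolding pe qe by simp_all
    have cl: "p [^]\<^bsub>F\<^esub> n \<in> carrier F" "q [^]\<^bsub>F\<^esub> m \<in> carrier F" "r [^]\<^bsub>F\<^esub> n \<in> carrier F" "s [^]\<^bsub>F\<^esub> m \<in> carrier F"
      using p q r s by auto
    then have rd: "fg_reduced (p [^]\<^bsub>F\<^esub> n)" "fg_reduced (q [^]\<^bsub>F\<^esub> m)" "fg_reduced (r [^]\<^bsub>F\<^esub> n)" "fg_reduced (s [^]\<^bsub>F\<^esub> m)"
      "fg_reduced k" "fg_reduced l" using kl by (auto simp: free_group_carrier)
    have 1: "\<bar>of_int n\<bar> - real N \<le> \<bar>brooks u (r [^]\<^bsub>F\<^esub> n)\<bar>"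
      using br[of "nat n"] br[of "nat (- n)"] by (auto simp: pow_int[OF r(3,2) kr(2)] brooks_winv[OF u])
    have 2: "brooks u (s [^]\<^bsub>F\<^esub> m) = 0"
      by (simp add: pow_int[OF s(2,1) ls(2)] brooks_winv[OF u] bs)
    have "\<bar>brooks u (red (p [^]\<^bsub>F\<^esub> n @ q [^]\<^bsub>F\<^esub> m))\<bar> \<ge> \<bar>brooks u (r [^]\<^bsub>F\<^esub> n)\<bar> - 15 * ?L"
    proof -
      have "\<bar>a\<bar> - 15 * L \<le> \<bar>x\<bar>" if "\<bar>x - y - z\<bar> \<le> 3 * L" "\<bar>y - a\<bar> \<le> 6 * L" "\<bar>z - 0\<bar> \<le> 6 * L"
        for x y z a L :: real using that by linarith
      from this[OF brooks_red[OF u rd(1,2)] brooks_conj[OF u rd(5,3), folded pn]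
          brooks_conj[OF u rd(6,4), folded qm, unfolded 2]]
      show ?thesis .
    qed
    moreover have "p [^]\<^bsub>F\<^esub> n \<otimes>\<^bsub>F\<^esub> q [^]\<^bsub>F\<^esub> m = red (p [^]\<^bsub>F\<^esub> n @ q [^]\<^bsub>F\<^esub> m)"
      using cl by (simp add: free_group_mult)
    moreover have "\<bar>brooks u (p [^]\<^bsub>F\<^esub> n \<otimes>\<^bsub>F\<^esub> q [^]\<^bsub>F\<^esub> m)\<bar> \<le> 10 * ?L * word_norm A (p [^]\<^bsub>F\<^esub> n \<otimes>\<^bsub>F\<^esub> q [^]\<^bsub>F\<^esub> m)"
      using cl by (intro brooks_le_word_norm[OF u]) auto
    ultimately show ?thesis using 1 by simp
  qed
  have L: "?L > 0" using u by simp
  \<comment> \<open>The norm of \<open>p^(jn) q^(jm)\<close> is at most \<open>j\<close> times that of \<open>p^n q^m\<close>, so the additive constant disappears.\<close>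
  have hom: "\<bar>of_int n\<bar> \<le> 10 * ?L * word_norm A (p [^]\<^bsub>F\<^esub> n \<otimes>\<^bsub>F\<^esub> q [^]\<^bsub>F\<^esub> m)" for n m :: int
  proof (rule ccontr)
    let ?w = "word_norm A (p [^]\<^bsub>F\<^esub> n \<otimes>\<^bsub>F\<^esub> q [^]\<^bsub>F\<^esub> m)"
    assume "\<not> ?thesis"
    then have pos: "\<bar>of_int n\<bar> - 10 * ?L * ?w > 0" by simp
    have bd: "real j * (\<bar>of_int n\<bar> - 10 * ?L * ?w) \<le> real N + 15 * ?L" for j :: nat
    proof -
      have dw: "word_norm A (p [^]\<^bsub>F\<^esub> a \<otimes>\<^bsub>F\<^esub> q [^]\<^bsub>F\<^esub> b) = N.dst (p [^]\<^bsub>F\<^esub> (- a)) (q [^]\<^bsub>F\<^esub> b)" for a b :: int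
        using p q by (simp add: norm_dist_def N.int_pow_neg)
      have "p [^]\<^bsub>F\<^esub> (- (n * int j)) = (p [^]\<^bsub>F\<^esub> (- n)) [^]\<^bsub>F\<^esub> j" "q [^]\<^bsub>F\<^esub> (m * int j) = (q [^]\<^bsub>F\<^esub> m) [^]\<^bsub>F\<^esub> j"
        using p q by (simp_all add: N.int_pow_pow flip: int_pow_int)
      then have "word_norm A (p [^]\<^bsub>F\<^esub> (n * int j) \<otimes>\<^bsub>F\<^esub> q [^]\<^bsub>F\<^esub> (m * int j)) \<le> real j * ?w"
        unfolding dw using N.dst_pow[of "p [^]\<^bsub>F\<^esub> (- n)" "q [^]\<^bsub>F\<^esub> m" j] p q by simp
      then have "10 * ?L * word_norm A (p [^]\<^bsub>F\<^esub> (n * int j) \<otimes>\<^bsub>F\<^esub> q [^]\<^bsub>F\<^esub> (m * int j)) \<le> 10 * ?L * (real j * ?w)"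
        using L by (intro mult_left_mono) auto
      then show ?thesis using lower[of "n * int j" "m * int j"] by (simp add: abs_mult algebra_simps)
    qed
    obtain j :: nat where "real j * (\<bar>of_int n\<bar> - 10 * ?L * ?w) > real N + 15 * ?L"
      using reals_Archimedean3[OF pos] by blast
    then show False using bd[of j] by simp
  qed
  show ?thesis
    using L hom by (intro exI[of _ "1 / (10 * ?L)"]) (auto simp: field_simps)
qed

text \<open>No positive power of \<open>p\<close> is trivial, so \<open>p\<close> is not commensurable to \<open>1\<close>, and separation applies with
  \<open>q = 1\<close>.\<close>

lemma stable_pos:
  assumes p: "p \<in> carrier F" "p \<noteq> \<one>\<^bsub>F\<^esub>" shows "0 < N.stable p"
proof -
  obtain k r where kr: "p = k @ r @ winv k" "\<And>n. fg_reduced (word_pow n r)"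
    using cyclic_reduction p by (auto simp: free_group_carrier)
  have lets: "fst ` set k \<subseteq> A" "fst ` set r \<subseteq> A" using p by (auto simp: free_group_carrier kr image_Un)
  have "red p = p" using p(1) by (simp add: free_group_carrier red_id)
  then have r: "r \<noteq> []" using p(2) by (auto simp: kr(1) free_group_one)
  have "\<not> commensurable F p \<one>\<^bsub>F\<^esub>"
  proof
    assume "commensurable F p \<one>\<^bsub>F\<^esub>"
    then obtain a where a: "1 \<le> a" "p [^]\<^bsub>F\<^esub> (a::nat) = \<one>\<^bsub>F\<^esub>" by (auto simp: commensurable_def)
    have kc: "red k \<in> carrier F" "red r \<in> carrier F" using lets by (auto intro: red_closed)
    have "p = red k \<otimes>\<^bsub>F\<^esub> red r \<otimes>\<^bsub>F\<^esub> inv\<^bsub>F\<^esub> red k"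
      using conj_red[OF lets] p(1) by (simp add: free_group_carrier red_id flip: kr(1))
    then have "red k \<otimes>\<^bsub>F\<^esub> red r [^]\<^bsub>F\<^esub> a \<otimes>\<^bsub>F\<^esub> inv\<^bsub>F\<^esub> red k = \<one>\<^bsub>F\<^esub>"
      using conj_nat_pow[OF kc] a by simp
    then have "red r [^]\<^bsub>F\<^esub> a = \<one>\<^bsub>F\<^esub>"
      using kc by (metis N.inv_solve_right' N.l_cancel_one' N.m_closed N.nat_pow_closed N.one_closed N.l_one)
    then have "word_pow a r = []" using red_pow[OF lets(2), of a] red_id[OF kr(2)[of a]] by (simp add: free_group_one)
    then show False using a(1) r by (simp add: word_pow_eq_Nil)
  qed
  then obtain \<delta> where \<delta>: "\<delta> > 0" "\<And>n m. \<delta> * \<bar>of_int n\<bar> \<le> word_norm A (p [^]\<^bsub>F\<^esub> (n::int) \<otimes>\<^bsub>F\<^esub> \<one>\<^bsub>F\<^esub> [^]\<^bsub>F\<^esub> (m::int))"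
    using incommensurable_separated[OF p N.one_closed] by blast
  have "\<delta> \<le> N.stable p"
    unfolding N.ray_def
  proof (rule cINF_greatest)
    fix y assume "y \<in> {1::nat..} \<times> (UNIV::nat set)"
    then obtain n m where y: "y = (n, m)" "n \<ge> 1" by auto
    have "\<delta> * real n \<le> word_norm A (p [^]\<^bsub>F\<^esub> n)" using \<delta>(2)[of "int n" 0] p by (simp add: int_pow_int)
    then show "\<delta> \<le> (case y of (n, m) \<Rightarrow> N.dst (\<one>\<^bsub>F\<^esub> [^]\<^bsub>F\<^esub> m) (p [^]\<^bsub>F\<^esub> n) / real n)"
      using y p by (simp add: field_simps)
  qed simp
  then show ?thesis using \<delta>(1) by simp
qed

end


section \<open>Rounding\<close>

definition floor_word :: "('a, 'm) monoid_scheme \<Rightarrow> real \<Rightarrow> ('a \<times> real) list \<Rightarrow> ('a \<times> real) list" where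
  "floor_word G t = fp_lift (FR G) (\<lambda>g r. syllable g (of_int \<lfloor>t * r\<rfloor>))"

lemma FZ_carrier_subset: "carrier (FZ G) \<subseteq> carrier (FR G)"
  unfolding FZ_def by (rule group.carrier_subgroup_generated_subset[OF group_free_product_reals])

lemma FZ_group: "group (FZ G)"
  unfolding FZ_def by (rule group.group_subgroup_generated[OF group_free_product_reals])

lemma FZ_mult: "x \<otimes>\<^bsub>FZ G\<^esub> y = x \<otimes>\<^bsub>FR G\<^esub> y" and FZ_one: "\<one>\<^bsub>FZ G\<^esub> = \<one>\<^bsub>FR G\<^esub>"
  by (simp_all add: FZ_def)

lemma FZ_inv: "x \<in> carrier (FZ G) \<Longrightarrow> inv\<^bsub>FZ G\<^esub> x = inv\<^bsub>FR G\<^esub> x"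
  unfolding FZ_def by (rule group.inv_subgroup_generated[OF group_free_product_reals])

lemma FZ_closed:
  "x \<in> carrier (FZ G) \<Longrightarrow> y \<in> carrier (FZ G) \<Longrightarrow> x \<otimes>\<^bsub>FR G\<^esub> y \<in> carrier (FZ G)"
  "x \<in> carrier (FZ G) \<Longrightarrow> inv\<^bsub>FR G\<^esub> x \<in> carrier (FZ G)"
  "\<one>\<^bsub>FR G\<^esub> \<in> carrier (FZ G)"
  using FZ_mult[of G x y] FZ_inv[of x G] FZ_one[of G] group.is_monoid[OF FZ_group, of G]
    monoid.m_closed[of "FZ G" x y] group.inv_closed[OF FZ_group, of x G] monoid.one_closed[of "FZ G"]
  by auto

lemma syllable_FZ: "g \<in> carrier G \<Longrightarrow> syllable g (of_int k) \<in> carrier (FZ G)"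
proof -
  assume g: "g \<in> carrier G"
  interpret F: group "FR G" by (rule group_free_product_reals)
  have "syllable g 1 \<in> carrier (FZ G)"
    unfolding FZ_def carrier_subgroup_generated
    using g syllable_closed[OF g, of 1] by (intro generate.incl) auto
  moreover have "syllable g (real n) = syllable g 1 [^]\<^bsub>FR G\<^esub> n" for n :: nat
  proof (induction n)
    case (Suc n)
    have "syllable g (real n) \<otimes>\<^bsub>FR G\<^esub> syllable g 1 = syllable g (real n + 1)" by (rule syllable_add)
    then show ?case using Suc by (simp add: add.commute)
  qed (simp add: fp_one)
  moreover have "syllable g 1 [^]\<^bsub>FR G\<^esub> (n::nat) \<in> carrier (FZ G)" if "syllable g 1 \<in> carrier (FZ G)" for n
    by (induction n) (auto intro: FZ_closed that)
  ultimately have nat: "syllable g (real n) \<in> carrier (FZ G)" for n :: nat by simp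
  show ?thesis
  proof (cases k rule: int_cases2)
    case (nonneg n)
    then show ?thesis using nat[of n] by simp
  next
    case (nonpos n)
    then show ?thesis using FZ_closed(2)[OF nat[of n]] g by (simp add: syllable_inv)
  qed
qed

lemma proj_syllable_int:
  assumes "group G" "g \<in> carrier G" shows "proj G (syllable g (of_int k)) = g [^]\<^bsub>G\<^esub> k"
proof -
  interpret group G by fact
  show ?thesis using assms(2) by (auto simp: syllable_def proj_def fp_lift_Cons)
qed

context conj_pseudonorm
begin

lemma proj_closed: "x \<in> carrier (FZ G) \<Longrightarrow> proj G x \<in> carrier G"
  using proj_hom[OF group_axioms] by (auto simp: hom_def)

lemma proj_mult: "x \<in> carrier (FZ G) \<Longrightarrow> y \<in> carrier (FZ G) \<Longrightarrow> proj G (x \<otimes>\<^bsub>FR G\<^esub> y) = proj G x \<otimes> proj G y"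
  using hom_mult[OF proj_hom[OF group_axioms], of x y] by (simp add: FZ_mult)

lemma proj_one: "proj G \<one>\<^bsub>FR G\<^esub> = \<one>"
  by (simp add: proj_def fp_one)

lemma proj_inv: "x \<in> carrier (FZ G) \<Longrightarrow> proj G (inv\<^bsub>FR G\<^esub> x) = inv proj G x"
  using group_hom.hom_inv[of "FZ G" G "proj G" x] FZ_group[of G] proj_hom[OF group_axioms]
  by (simp add: group_hom_def group_hom_axioms_def FZ_inv group_axioms)

context
begin

interpretation R: conj_pseudonorm "FR G" "FR_norm G \<nu>" by (rule FR_pseudonorm)

lemma fp_lift_FZ:
  assumes "\<And>y. y \<in> set x \<Longrightarrow> f (fst y) (snd y) \<in> carrier (FZ G) \<and> proj G (f (fst y) (snd y)) = k (fst y) (snd y)"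
  shows "fp_lift (FR G) f x \<in> carrier (FZ G) \<and> proj G (fp_lift (FR G) f x) = fp_lift G k x"
  using assms
proof (induction x)
  case Nil
  then show ?case using FZ_closed(3) proj_one by (simp add: fp_one)
next
  case (Cons y x)
  obtain g r where y: "y = (g, r)" by (cases y)
  show ?case using Cons by (auto simp: y fp_lift_Cons FZ_closed proj_mult)
qed

lemma dst_fp_lift:
  assumes "\<And>y. y \<in> set x \<Longrightarrow> f (fst y) (snd y) \<in> carrier (FR G) \<and> f' (fst y) (snd y) \<in> carrier (FR G) \<and>
     R.dst (f (fst y) (snd y)) (f' (fst y) (snd y)) \<le> b y"
  shows "R.dst (fp_lift (FR G) f x) (fp_lift (FR G) f' x) \<le> (\<Sum>y\<leftarrow>x. b y)"
  unfolding fp_lift_def using assms by (intro R.dst_list_mult) (auto simp: case_prod_beta)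

lemma letters_of_FR: "x \<in> carrier (FR G) \<Longrightarrow> y \<in> set x \<Longrightarrow> fst y \<in> carrier G"
  by (auto simp: free_product_reals_def)

lemma floor_word_FZ:
  assumes "x \<in> carrier (FR G)"
  shows "floor_word G t x \<in> carrier (FZ G)" and "proj G (floor_word G t x) = fp_lift G (\<lambda>g r. g [^] \<lfloor>t * r\<rfloor>) x"
  using fp_lift_FZ[of x "\<lambda>g r. syllable g (of_int \<lfloor>t * r\<rfloor>)" "\<lambda>g r. g [^] \<lfloor>t * r\<rfloor>"] letters_of_FR[OF assms]
  by (auto simp: floor_word_def syllable_FZ proj_syllable_int[OF group_axioms])

lemma dst_syllable:
  assumes "g \<in> carrier G" shows "R.dst (syllable g r) (syllable g s) \<le> \<bar>r - s\<bar> * \<nu> g"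
  using FR_norm_syllable[OF assms, of "s - r"] assms
  by (simp add: norm_dist_def syllable_inv syllable_add abs_minus_commute)

lemma dst_floor_word_psi:
  assumes "x \<in> carrier (FR G)"
  shows "R.dst (floor_word G t x) (psi G t x) \<le> (\<Sum>y\<leftarrow>x. \<nu> (fst y))"
  unfolding floor_word_def psi_def
proof (rule dst_fp_lift)
  fix y assume "y \<in> set x"
  then have g: "fst y \<in> carrier G" by (rule letters_of_FR[OF assms])
  have "R.dst (syllable (fst y) (of_int \<lfloor>t * snd y\<rfloor>)) (syllable (fst y) (t * snd y))
      \<le> \<bar>of_int \<lfloor>t * snd y\<rfloor> - t * snd y\<bar> * \<nu> (fst y)" by (rule dst_syllable[OF g])
  also have "\<dots> \<le> 1 * \<nu> (fst y)"
  proof (rule mult_right_mono)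
    show "\<bar>of_int \<lfloor>t * snd y\<rfloor> - t * snd y\<bar> \<le> 1"
      using floor_correct[of "t * snd y"] by linarith
  qed (use g nu_nonneg in auto)
  finally show "syllable (fst y) (of_int \<lfloor>t * snd y\<rfloor>) \<in> carrier (FR G) \<and>
      syllable (fst y) (t * snd y) \<in> carrier (FR G) \<and>
      R.dst (syllable (fst y) (of_int \<lfloor>t * snd y\<rfloor>)) (syllable (fst y) (t * snd y)) \<le> \<nu> (fst y)"
    using g by (simp add: syllable_closed)
qed

end

text \<open>An endomorphism that straightens \<open>x\<close> has three properties. It is \<open>2\<close>-Lipschitz, a constant that
  must not depend on \<open>x\<close>. The norm of each \<open>\<Lambda> y\<close> is bounded by \<open>K\<close> times the growth rate of the
  projections of the multiples of \<open>y\<close>. Finally, \<open>\<Lambda> x\<close> can be rounded to integral words with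
  the same projections as the roundings of \<open>x\<close> itself.\<close>

definition straightens :: "(('a \<times> real) list \<Rightarrow> ('a \<times> real) list) \<Rightarrow> real \<Rightarrow> ('a \<times> real) list \<Rightarrow> bool" where
  "straightens \<Lambda> K x \<longleftrightarrow> \<Lambda> \<in> hom (FR G) (FR G) \<and>
     (\<forall>y\<in>carrier (FR G). FR_norm G \<nu> (\<Lambda> y) \<le> 2 * FR_norm G \<nu> y) \<and> 0 \<le> K \<and>
     (\<forall>y\<in>carrier (FR G). \<exists>B. \<forall>t>0. t * FR_norm G \<nu> (\<Lambda> y) \<le> K * \<nu> (proj G (floor_word G t y)) + B) \<and>
     (\<exists>w B. \<forall>t>0. w t \<in> carrier (FZ G) \<and> proj G (w t) = proj G (floor_word G t x) \<and>
        norm_dist (FR G) (FR_norm G \<nu>) (w t) (psi G t (\<Lambda> x)) \<le> B)"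

end


section \<open>Straightening in free groups\<close>

text \<open>A cut inside a power is moved to the end of the preceding period; the part \<open>u'\<close> of a period
  that is cut off is prepended to the rest, which then is a power again.\<close>

lemma word_pow_split:
  assumes "word_pow n g = u @ v"
  obtains a b u' where "a + b = n" "u = word_pow a g @ u'" "u' @ v = word_pow b g" "length u' \<le> length g"
proof -
  have "\<exists>a b u'. a + b = n \<and> u = word_pow a g @ u' \<and> u' @ v = word_pow b g \<and> length u' \<le> length g"
    using assms
  proof (induction n arbitrary: u)
    case (Suc n)
    show ?case
    proof (cases "length u \<le> length g")
      case True
      then show ?thesis using Suc.prems by (intro exI[of _ 0] exI[of _ "Suc n"] exI[of _ u]) simp
    next
      case False
      have "g @ word_pow n g = u @ v" using Suc.prems by simp
      then obtain u1 where u1: "u = g @ u1" "word_pow n g = u1 @ v"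
        using False by (auto simp: append_eq_append_conv2)
      then obtain a b u' where "a + b = n" "u1 = word_pow a g @ u'" "u' @ v = word_pow b g" "length u' \<le> length g"
        using Suc.IH by blast
      then show ?thesis using u1 by (intro exI[of _ "Suc a"] exI[of _ b] exI[of _ u']) simp
    qed
  qed simp
  then show ?thesis using that by blast
qed

definition power_word :: "(('a \<times> bool) list \<times> nat) list \<Rightarrow> ('a \<times> bool) list" where
  "power_word ps = concat (map (\<lambda>(g, n). word_pow n g) ps)"

lemma power_word_simps [simp]: "power_word [] = []" "power_word ((g, n) # ps) = word_pow n g @ power_word ps" "power_word (ps @ qs) = power_word ps @ power_word qs"
  by (simp_all add: power_word_def)

lemma power_word_split:
  assumes "power_word ps = u @ v" "ps \<noteq> []"
  obtains ps1 g a b ps2 u' where "ps = ps1 @ (g, a + b) # ps2" "u = power_word ps1 @ word_pow a g @ u'"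
    "u' @ v = word_pow b g @ power_word ps2" "length u' \<le> length g"
proof -
  have "\<exists>ps1 g a b ps2 u'. ps = ps1 @ (g, a + b) # ps2 \<and> u = power_word ps1 @ word_pow a g @ u' \<and>
    u' @ v = word_pow b g @ power_word ps2 \<and> length u' \<le> length g"
    using assms
  proof (induction ps arbitrary: u)
    case (Cons p ps)
    obtain g n where p: "p = (g, n)" by (cases p)
    have "word_pow n g @ power_word ps = u @ v" using Cons.prems by (simp add: p)
    then consider v1 where "word_pow n g = u @ v1" "v = v1 @ power_word ps"
      | u1 where "u = word_pow n g @ u1" "power_word ps = u1 @ v" "ps \<noteq> []"
      by (cases "ps = []") (auto simp: append_eq_append_conv2)
    then show ?case
    proof cases
      case 1
      obtain a b u' where "a + b = n" "u = word_pow a g @ u'" "u' @ v1 = word_pow b g" "length u' \<le> length g"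
        using word_pow_split[OF 1(1)] .
      then show ?thesis using 1
        by (intro exI[of _ "[]"] exI[of _ g] exI[of _ a] exI[of _ b] exI[of _ ps] exI[of _ u'])
          (auto simp: p simp flip: append_assoc)
    next
      case 2
      then obtain ps1 h a b ps2 u' where "ps = ps1 @ (h, a + b) # ps2" "u1 = power_word ps1 @ word_pow a h @ u'"
        "u' @ v = word_pow b h @ power_word ps2" "length u' \<le> length h" using Cons.IH by blast
      then show ?thesis using 2
        by (intro exI[of _ "(g, n) # ps1"] exI[of _ h] exI[of _ a] exI[of _ b] exI[of _ ps2] exI[of _ u'])
          (auto simp: p)
    qed
  qed simp
  then show ?thesis using that by blast
qed

context
  fixes A :: "'a set"
begin

private abbreviation (input) FA where "FA \<equiv> free_group A"
private abbreviation (input) wn where "wn \<equiv> word_norm A"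

interpretation N: conj_pseudonorm FA wn by (rule word_norm_pseudonorm)
interpretation R: conj_pseudonorm "FR FA" "FR_norm FA wn" by (rule N.FR_pseudonorm)

lemma commensurable_sym:
  assumes "commensurable FA x y" "x \<in> carrier FA" "x \<noteq> \<one>\<^bsub>FA\<^esub>" "y \<in> carrier FA"
  shows "commensurable FA y x"
proof -
  obtain a b h where ab: "1 \<le> (a::nat)" "h \<in> carrier FA" "x [^]\<^bsub>FA\<^esub> a = h \<otimes>\<^bsub>FA\<^esub> y [^]\<^bsub>FA\<^esub> (b::int) \<otimes>\<^bsub>FA\<^esub> inv\<^bsub>FA\<^esub> h"
    using assms(1) unfolding commensurable_def by blast
  have "real a * N.stable x > 0" using stable_pos[OF assms(2,3)] ab(1) by simp
  then have "wn (x [^]\<^bsub>FA\<^esub> a) > 0" using N.stable_le[OF assms(2), of a] by linarith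
  then have b: "b \<noteq> 0" using ab(2,3) by auto
  have y: "y [^]\<^bsub>FA\<^esub> b = inv\<^bsub>FA\<^esub> h \<otimes>\<^bsub>FA\<^esub> x [^]\<^bsub>FA\<^esub> a \<otimes>\<^bsub>FA\<^esub> inv\<^bsub>FA\<^esub> (inv\<^bsub>FA\<^esub> h)"
    using ab assms(2,4) by (simp add: N.m_assoc) (simp add: N.m_assoc [symmetric])
  show ?thesis
  proof (cases "b > 0")
    case True
    have "y [^]\<^bsub>FA\<^esub> nat b = inv\<^bsub>FA\<^esub> h \<otimes>\<^bsub>FA\<^esub> x [^]\<^bsub>FA\<^esub> int a \<otimes>\<^bsub>FA\<^esub> inv\<^bsub>FA\<^esub> (inv\<^bsub>FA\<^esub> h)"
      using y True by (simp flip: int_pow_int)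
    then show ?thesis unfolding commensurable_def using True ab(2)
      by (intro exI[of _ "nat b"] exI[of _ "int a"] bexI[of _ "inv\<^bsub>FA\<^esub> h"]) auto
  next
    case False
    have "y [^]\<^bsub>FA\<^esub> (- b) = inv\<^bsub>FA\<^esub> (inv\<^bsub>FA\<^esub> h \<otimes>\<^bsub>FA\<^esub> x [^]\<^bsub>FA\<^esub> a \<otimes>\<^bsub>FA\<^esub> inv\<^bsub>FA\<^esub> (inv\<^bsub>FA\<^esub> h))"
      using y assms(4) by (simp add: N.int_pow_neg)
    also have "\<dots> = inv\<^bsub>FA\<^esub> h \<otimes>\<^bsub>FA\<^esub> x [^]\<^bsub>FA\<^esub> (- int a) \<otimes>\<^bsub>FA\<^esub> inv\<^bsub>FA\<^esub> (inv\<^bsub>FA\<^esub> h)"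
      using ab(2) assms(2) by (simp add: N.inv_mult_group N.int_pow_neg int_pow_int N.m_assoc)
    finally have "y [^]\<^bsub>FA\<^esub> nat (- b) = inv\<^bsub>FA\<^esub> h \<otimes>\<^bsub>FA\<^esub> x [^]\<^bsub>FA\<^esub> (- int a) \<otimes>\<^bsub>FA\<^esub> inv\<^bsub>FA\<^esub> (inv\<^bsub>FA\<^esub> h)"
      using False by (simp flip: int_pow_int)
    then show ?thesis unfolding commensurable_def using False b ab(2)
      by (intro exI[of _ "nat (- b)"] exI[of _ "- int a"] bexI[of _ "inv\<^bsub>FA\<^esub> h"]) auto
  qed
qed

lemma commensurable_pow:
  assumes "commensurable FA (x [^]\<^bsub>FA\<^esub> (m::nat)) y" "x \<in> carrier FA" "m \<ge> 1" shows "commensurable FA x y"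
proof -
  obtain a b h where ab: "1 \<le> (a::nat)" "h \<in> carrier FA"
    "(x [^]\<^bsub>FA\<^esub> m) [^]\<^bsub>FA\<^esub> a = h \<otimes>\<^bsub>FA\<^esub> y [^]\<^bsub>FA\<^esub> (b::int) \<otimes>\<^bsub>FA\<^esub> inv\<^bsub>FA\<^esub> h"
    using assms(1) unfolding commensurable_def by blast
  then show ?thesis unfolding commensurable_def using assms(2,3)
    by (intro exI[of _ "m * a"] exI[of _ b] bexI[of _ h]) (auto simp: N.nat_pow_pow)
qed

text \<open>Passing to a power of a representative brings its norm close to its stable norm; the factor \<open>2\<close>
  below is any constant larger than \<open>1\<close>.\<close>

lemma representatives:
  assumes "finite S" "S \<subseteq> carrier FA"
  shows "\<exists>P. finite P \<and> P \<subseteq> carrier FA - {\<one>\<^bsub>FA\<^esub>} \<and> (\<forall>c\<in>P. wn c \<le> 2 * N.stable c) \<and>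
    (\<forall>c\<in>P. \<forall>c'\<in>P. c \<noteq> c' \<longrightarrow> \<not> commensurable FA c c') \<and> (\<forall>g\<in>S. g \<noteq> \<one>\<^bsub>FA\<^esub> \<longrightarrow> (\<exists>c\<in>P. commensurable FA g c))"
  using assms
proof (induction S rule: finite_induct)
  case (insert g S)
  then obtain P where P: "finite P" "P \<subseteq> carrier FA - {\<one>\<^bsub>FA\<^esub>}" "\<forall>c\<in>P. wn c \<le> 2 * N.stable c"
    "\<forall>c\<in>P. \<forall>c'\<in>P. c \<noteq> c' \<longrightarrow> \<not> commensurable FA c c'" "\<forall>g\<in>S. g \<noteq> \<one>\<^bsub>FA\<^esub> \<longrightarrow> (\<exists>c\<in>P. commensurable FA g c)" by auto
  show ?case
  proof (cases "g = \<one>\<^bsub>FA\<^esub> \<or> (\<exists>c\<in>P. commensurable FA g c)")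
    case True
    then show ?thesis using P by (intro exI[of _ P]) auto
  next
    case False
    have g: "g \<in> carrier FA" "g \<noteq> \<one>\<^bsub>FA\<^esub>" using insert.prems False by auto
    note pos = stable_pos[OF g]
    obtain m k where m: "m \<ge> (1::nat)" "N.dst (\<one>\<^bsub>FA\<^esub> [^]\<^bsub>FA\<^esub> (k::nat)) (g [^]\<^bsub>FA\<^esub> m) < real m * (2 * N.stable g)"
      using N.ray_approx[of "\<one>\<^bsub>FA\<^esub>" g "2 * N.stable g"] pos by auto
    define c where "c = g [^]\<^bsub>FA\<^esub> m"
    have c: "c \<in> carrier FA" "N.stable c = real m * N.stable g" using g by (auto simp: c_def N.ray_pow)
    have c1: "c \<noteq> \<one>\<^bsub>FA\<^esub>"
    proof
      assume "c = \<one>\<^bsub>FA\<^esub>"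
      then have "N.stable c \<le> 0" using N.stable_le_nu[OF c(1)] by simp
      then show False using c(2) pos m(1) by (simp add: mult_le_0_iff)
    qed
    have nc: "\<not> commensurable FA c c'" if "c' \<in> P" for c'
      using commensurable_pow[of g m c'] that False g m(1) by (auto simp: c_def)
    have nc': "\<not> commensurable FA c' c" if "c' \<in> P" for c'
      using commensurable_sym[of c' c] nc[OF that] that P(2) c(1) by auto
    have gc: "commensurable FA g c" unfolding commensurable_def using m(1) c(1)
      by (intro exI[of _ m] exI[of _ "1::int"] bexI[of _ "\<one>\<^bsub>FA\<^esub>"]) (auto simp: c_def N.int_pow_1 g)
    show ?thesis
      using P c c1 nc nc' gc m(2) g by (intro exI[of _ "insert c P"]) (auto simp: c_def)
  qed
qed auto

text \<open>The syllable \<open>g(r)\<close> is to be replaced by \<open>cc g\<close> with exponent \<open>lam g * r\<close>, where \<open>cc g\<close> is the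
  representative whose bump function does not vanish at \<open>g\<close>, if there is one; otherwise \<open>lam g = 0\<close>.
  The second property is the Lipschitz property of the bump functions, applied to \<open>g\<^sup>n\<close> and the
  inverse of \<open>h\<^sup>m\<close>: if \<open>g\<close> and \<open>h\<close> have different representatives, then the function of one
  representative vanishes on the other element. The third one determines \<open>lam\<close> on \<open>S\<close>, because
  homogeneous Lipschitz functions are invariant under conjugation.\<close>

lemma straightening_data:
  assumes S: "finite S" "S \<subseteq> carrier FA"
  obtains cc lam K where "0 \<le> (K::real)"
    "\<And>g. g \<in> carrier FA \<Longrightarrow> cc g \<in> carrier FA \<and> \<bar>lam g\<bar> * wn (cc g) \<le> 2 * wn g"
    "\<And>g h n m. g \<in> carrier FA \<Longrightarrow> h \<in> carrier FA \<Longrightarrow>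
       FR_norm FA wn (syllable (cc g) (lam g * real n) \<otimes>\<^bsub>FR FA\<^esub> syllable (cc h) (lam h * real m))
         \<le> K * wn (g [^]\<^bsub>FA\<^esub> n \<otimes>\<^bsub>FA\<^esub> h [^]\<^bsub>FA\<^esub> m)"
    "\<And>g. g \<in> S \<Longrightarrow> \<exists>a\<ge>1. \<exists>b. \<exists>h\<in>carrier FA. lam g * real a = of_int b \<and>
       g [^]\<^bsub>FA\<^esub> (a::nat) = h \<otimes>\<^bsub>FA\<^esub> cc g [^]\<^bsub>FA\<^esub> (b::int) \<otimes>\<^bsub>FA\<^esub> inv\<^bsub>FA\<^esub> h"
    "\<And>g r. g \<in> carrier FA \<Longrightarrow> syllable (cc (inv\<^bsub>FA\<^esub> g)) (lam (inv\<^bsub>FA\<^esub> g) * r) = syllable (cc g) (lam g * - r)"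
proof -
  from representatives[OF S] obtain P where P': "finite P" "P \<subseteq> carrier FA - {\<one>\<^bsub>FA\<^esub>}"
    "\<forall>c\<in>P. wn c \<le> 2 * N.stable c" "\<forall>c\<in>P. \<forall>c'\<in>P. c \<noteq> c' \<longrightarrow> \<not> commensurable FA c c'"
    "\<forall>g\<in>S. g \<noteq> \<one>\<^bsub>FA\<^esub> \<longrightarrow> (\<exists>c\<in>P. commensurable FA g c)"
    by (elim exE conjE) (rule that)
  note P = P'(1,2) P'(3-5)[rule_format]
  have PF: "P \<subseteq> carrier FA" using P(2) by auto
  have pos: "0 < N.stable c" if "c \<in> P" for c using stable_pos that P(2) by auto
  have sep: "\<exists>\<delta>>0. \<forall>n m. \<delta> * \<bar>of_int n\<bar> \<le> wn (c [^]\<^bsub>FA\<^esub> (n::int) \<otimes>\<^bsub>FA\<^esub> c' [^]\<^bsub>FA\<^esub> (m::int))"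
    if "c \<in> P" "c' \<in> P" "c \<noteq> c'" for c c'
    using that P(2) P(4)[OF that] by (intro incommensurable_separated) auto
  obtain l C where C: "0 \<le> C"
    and lp: "\<And>c x k. c \<in> P \<Longrightarrow> x \<in> carrier FA \<Longrightarrow> l c (x [^]\<^bsub>FA\<^esub> (k::int)) = of_int k * l c x"
    and ll: "\<And>c x y. c \<in> P \<Longrightarrow> x \<in> carrier FA \<Longrightarrow> y \<in> carrier FA \<Longrightarrow> \<bar>l c x - l c y\<bar> \<le> C * N.dst x y"
    and lc: "\<And>c. c \<in> P \<Longrightarrow> l c c = 1"
    and ls: "\<And>c x. c \<in> P \<Longrightarrow> x \<in> carrier FA \<Longrightarrow> \<bar>l c x\<bar> * N.stable c \<le> N.stable x"
    and ld: "\<And>c c' x. c \<in> P \<Longrightarrow> c' \<in> P \<Longrightarrow> c \<noteq> c' \<Longrightarrow> x \<in> carrier FA \<Longrightarrow> l c x = 0 \<or> l c' x = 0"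
    by (rule N.homogeneous_bump_functions[OF P(1) PF pos sep]) (assumption | rule that)+
  define E where "E g \<longleftrightarrow> (\<exists>c. c \<in> P \<and> l c g \<noteq> 0)" for g
  define cc where "cc g = (if E g then SOME c. c \<in> P \<and> l c g \<noteq> 0 else \<one>\<^bsub>FA\<^esub>)" for g
  define lam where "lam g = (if E g then l (cc g) g else 0)" for g
  have ccE: "cc g \<in> P \<and> l (cc g) g \<noteq> 0 \<and> lam g = l (cc g) g" if "E g" for g
    using someI_ex[of "\<lambda>c. c \<in> P \<and> l c g \<noteq> 0"] that by (auto simp: cc_def lam_def E_def)
  have nE: "lam g = 0" "l c g = 0" if "\<not> E g" "c \<in> P" for g c
    using that by (auto simp: lam_def E_def)
  have ccF: "cc g \<in> carrier FA" for g
    using ccE[of g] PF by (cases "E g") (auto simp: cc_def)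
  have linv: "l c (inv\<^bsub>FA\<^esub> g) = - l c g" if "c \<in> P" "g \<in> carrier FA" for c g
    using lp[OF that, of "-1"] that(2) by (simp add: N.int_pow_neg N.int_pow_1)
  define M where "M = (\<Sum>c\<in>P. wn c)"
  have M: "wn c \<le> M" if "c \<in> P" for c
    unfolding M_def using that P(1) PF N.nu_nonneg by (intro member_le_sum) auto
  have M0: "0 \<le> M" unfolding M_def using PF N.nu_nonneg by (intro sum_nonneg) auto
  have pair: "\<bar>real n * l c g + real m * l c h\<bar> \<le> C * wn (g [^]\<^bsub>FA\<^esub> n \<otimes>\<^bsub>FA\<^esub> h [^]\<^bsub>FA\<^esub> m)"
    if "c \<in> P" "g \<in> carrier FA" "h \<in> carrier FA" for c g h n m
  proof -
    have "l c (g [^]\<^bsub>FA\<^esub> n) - l c (inv\<^bsub>FA\<^esub> (h [^]\<^bsub>FA\<^esub> m)) = real n * l c g + real m * l c h"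
      using that lp[OF that(1,2), of "int n"] lp[OF that(1,3), of "int m"] linv[OF that(1), of "h [^]\<^bsub>FA\<^esub> m"]
      by (simp add: int_pow_int)
    moreover have "N.dst (g [^]\<^bsub>FA\<^esub> n) (inv\<^bsub>FA\<^esub> (h [^]\<^bsub>FA\<^esub> m)) = wn (g [^]\<^bsub>FA\<^esub> n \<otimes>\<^bsub>FA\<^esub> h [^]\<^bsub>FA\<^esub> m)"
      using that by (simp add: N.dst_alt)
    ultimately show ?thesis using ll[OF that(1), of "g [^]\<^bsub>FA\<^esub> n" "inv\<^bsub>FA\<^esub> (h [^]\<^bsub>FA\<^esub> m)"] that by simp
  qed
  have sy: "FR_norm FA wn (syllable c r) \<le> \<bar>r\<bar> * wn c" if "c \<in> carrier FA" for c r
    by (rule N.FR_norm_syllable[OF that])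
  show ?thesis
  proof (rule that[of "2 * C * M" cc lam])
    show "0 \<le> 2 * C * M" using C M0 by simp
  next
    fix g assume g: "g \<in> carrier FA"
    have "\<bar>lam g\<bar> * wn (cc g) \<le> 2 * wn g"
    proof (cases "E g")
      case True
      have "\<bar>lam g\<bar> * wn (cc g) \<le> \<bar>lam g\<bar> * (2 * N.stable (cc g))"
        using P(3) ccE[OF True] by (intro mult_left_mono) auto
      also have "\<dots> \<le> 2 * N.stable g" using ls[of "cc g" g] ccE[OF True] g by simp
      also have "\<dots> \<le> 2 * wn g" using N.stable_le_nu[OF g] by simp
      finally show ?thesis .
    qed (use g N.nu_nonneg in \<open>simp add: lam_def\<close>)
    then show "cc g \<in> carrier FA \<and> \<bar>lam g\<bar> * wn (cc g) \<le> 2 * wn g" using ccF by simp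
  next
    fix g h and n m :: nat assume gh: "g \<in> carrier FA" "h \<in> carrier FA"
    let ?w = "wn (g [^]\<^bsub>FA\<^esub> n \<otimes>\<^bsub>FA\<^esub> h [^]\<^bsub>FA\<^esub> m)"
    let ?x = "syllable (cc g) (lam g * real n)" and ?y = "syllable (cc h) (lam h * real m)"
    have w: "0 \<le> ?w" using gh by (intro N.nu_nonneg) auto
    have xy: "?x \<in> carrier (FR FA)" "?y \<in> carrier (FR FA)" using ccF by (auto intro: syllable_closed)
    have one: "FR_norm FA wn (syllable c r) \<le> C * M * ?w" if "\<bar>r\<bar> \<le> C * ?w" "c \<in> P" for c r
    proof -
      have "FR_norm FA wn (syllable c r) \<le> \<bar>r\<bar> * wn c" using sy that PF by auto
      also have "\<dots> \<le> (C * ?w) * M" using that M C w N.nu_nonneg PF by (intro mult_mono) auto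
      finally show ?thesis by (simp add: mult_ac)
    qed
    have CMw: "0 \<le> C * M * ?w" using C M0 w by simp
    show "FR_norm FA wn (?x \<otimes>\<^bsub>FR FA\<^esub> ?y) \<le> 2 * C * M * ?w"
    proof (cases "E g \<and> E h \<and> cc g = cc h")
      case True
      then have c: "cc g \<in> P" "cc h = cc g" "lam g = l (cc g) g" "lam h = l (cc g) h"
        using ccE[of g] ccE[of h] by auto
      have "?x \<otimes>\<^bsub>FR FA\<^esub> ?y = syllable (cc g) (lam g * real n + lam h * real m)"
        unfolding c(2) by (rule syllable_add)
      moreover have "\<bar>lam g * real n + lam h * real m\<bar> \<le> C * ?w"
        using pair[OF c(1) gh, of n m] unfolding c(3,4) by (simp add: mult.commute)
      ultimately show ?thesis using one[OF _ c(1)] CMw by fastforce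
    next
      case False
      have "FR_norm FA wn ?x \<le> C * M * ?w"
      proof (cases "E g")
        case True
        then have c: "cc g \<in> P" "lam g = l (cc g) g" "l (cc g) g \<noteq> 0" using ccE by auto
        have "l (cc g) h = 0"
        proof (cases "E h")
          case Eh: True
          then show ?thesis using ld[of "cc g" "cc h" h] ccE[OF Eh] c(1) False True gh by auto
        qed (use nE c in auto)
        then show ?thesis using pair[OF c(1) gh, of n m] one[OF _ c(1), of "lam g * real n"]
          unfolding c(2) by (simp add: mult.commute)
      qed (use CMw in \<open>simp add: lam_def R.nu_one[unfolded fp_one]\<close>)
      moreover have "FR_norm FA wn ?y \<le> C * M * ?w"
      proof (cases "E h")
        case True
        then have c: "cc h \<in> P" "lam h = l (cc h) h" "l (cc h) h \<noteq> 0" using ccE by auto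
        have "l (cc h) g = 0"
        proof (cases "E g")
          case Eg: True
          then show ?thesis using ld[of "cc h" "cc g" g] ccE[OF Eg] c(1) False True gh by auto
        qed (use nE c in auto)
        then show ?thesis using pair[OF c(1) gh, of n m] one[OF _ c(1), of "lam h * real m"]
          unfolding c(2) by (simp add: mult.commute)
      qed (use CMw in \<open>simp add: lam_def R.nu_one[unfolded fp_one]\<close>)
      ultimately show ?thesis using R.nu_mult[OF xy] by simp
    qed
  next
    fix g assume gS: "g \<in> S"
    then have g: "g \<in> carrier FA" using S by auto
    show "\<exists>a\<ge>1. \<exists>b. \<exists>h\<in>carrier FA. lam g * real a = of_int b \<and>
       g [^]\<^bsub>FA\<^esub> (a::nat) = h \<otimes>\<^bsub>FA\<^esub> cc g [^]\<^bsub>FA\<^esub> (b::int) \<otimes>\<^bsub>FA\<^esub> inv\<^bsub>FA\<^esub> h"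
    proof (cases "g = \<one>\<^bsub>FA\<^esub>")
      case True
      have "l c g = 0" if "c \<in> P" for c using lp[OF that g, of 0] True by simp
      then have "lam g = 0" by (auto simp: lam_def E_def)
      then show ?thesis using True by (intro exI[of _ 1] conjI exI[of _ "0::int"] bexI[of _ "\<one>\<^bsub>FA\<^esub>"]) auto
    next
      case False
      then obtain c where cP: "c \<in> P" and "commensurable FA g c" using P(5) gS by blast
      then obtain a b h where ab: "1 \<le> (a::nat)" "h \<in> carrier FA"
        "g [^]\<^bsub>FA\<^esub> a = h \<otimes>\<^bsub>FA\<^esub> c [^]\<^bsub>FA\<^esub> (b::int) \<otimes>\<^bsub>FA\<^esub> inv\<^bsub>FA\<^esub> h" unfolding commensurable_def by blast
      have c: "c \<in> carrier FA" using cP PF by auto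
      have "real a * N.stable g > 0" using stable_pos[OF g False] ab(1) by simp
      then have "wn (g [^]\<^bsub>FA\<^esub> a) > 0" using N.stable_le[OF g, of a] by linarith
      then have b: "b \<noteq> 0" using ab(2,3) by auto
      have "l c (h \<otimes>\<^bsub>FA\<^esub> c [^]\<^bsub>FA\<^esub> b \<otimes>\<^bsub>FA\<^esub> inv\<^bsub>FA\<^esub> h) = l c (c [^]\<^bsub>FA\<^esub> b)"
        using lp[OF cP] ll[OF cP] ab(2) c C by (intro N.homogeneous_Lipschitz_conj[of "l c" C]) auto
      then have la: "real a * l c g = of_int b"
        using lp[OF cP g, of "int a"] lp[OF cP c, of b] lc[OF cP] ab(3) by (simp add: int_pow_int)
      then have "l c g \<noteq> 0" using b by auto
      then have Eg: "E g" using cP by (auto simp: E_def)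
      then have "cc g = c" using ccE[OF Eg] ld[OF _ cP _ g, of "cc g"] \<open>l c g \<noteq> 0\<close> by blast
      then show ?thesis using ab la ccE[OF Eg]
        by (intro exI[of _ a] conjI exI[of _ b] bexI[of _ h]) (auto simp: mult.commute)
    qed
  next
    fix g and r :: real assume g: "g \<in> carrier FA"
    have eq: "(\<lambda>c. c \<in> P \<and> l c (inv\<^bsub>FA\<^esub> g) \<noteq> 0) = (\<lambda>c. c \<in> P \<and> l c g \<noteq> 0)"
      using linv[OF _ g] by auto
    have E: "E (inv\<^bsub>FA\<^esub> g) = E g" unfolding E_def eq by (rule refl)
    have "cc (inv\<^bsub>FA\<^esub> g) = cc g" unfolding cc_def E eq by (rule refl)
    moreover from this E have "lam (inv\<^bsub>FA\<^esub> g) = - lam g"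
      using linv[OF _ g] ccE[of g] by (auto simp: lam_def)
    ultimately show "syllable (cc (inv\<^bsub>FA\<^esub> g)) (lam (inv\<^bsub>FA\<^esub> g) * r) = syllable (cc g) (lam g * - r)" by simp
  qed
qed

lemma nu_trim:
  assumes "fst ` set (u @ w @ v) \<subseteq> A"
  shows "wn (red (u @ w @ v)) \<le> real (length u) + wn (red w) + real (length v)"
proof -
  have cl: "red u \<in> carrier FA" "red w \<in> carrier FA" "red v \<in> carrier FA" "red (w @ v) \<in> carrier FA"
    using assms by (simp_all add: image_Un red_closed)
  have "wn (red (u @ w @ v)) \<le> wn (red u) + wn (red (w @ v))"
    using N.nu_mult[OF cl(1,4)] by (simp add: red_mult)
  also have "wn (red (w @ v)) \<le> wn (red w) + wn (red v)"
    using N.nu_mult[OF cl(2,3)] by (simp add: red_mult)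
  finally show ?thesis using word_norm_letters[of u A] word_norm_letters[of v A] assms
    by (simp add: image_Un)
qed

lemma power_word_letters: "fst ` set ps \<subseteq> carrier FA \<Longrightarrow> fst ` set (power_word ps) \<subseteq> A"
proof (induction ps)
  case (Cons p ps)
  obtain g n where p: "p = (g, n)" by (cases p)
  have "fst ` set (word_pow n g) \<subseteq> A"
    using Cons.prems by (intro order_trans[OF word_pow_set]) (simp add: p free_group_carrier)
  then show ?case using Cons by (simp add: p image_Un)
qed simp

lemma red_power_word: "fst ` set ps \<subseteq> carrier FA \<Longrightarrow> red (power_word ps) = list_mult FA (map (\<lambda>(g, n). g [^]\<^bsub>FA\<^esub> n) ps)"
proof (induction ps)
  case (Cons p ps)
  obtain g n where p: "p = (g, n)" by (cases p)
  have "g [^]\<^bsub>FA\<^esub> n = red (word_pow n g)" using red_pow[of g A n] Cons.prems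
    by (simp add: p free_group_carrier red_id)
  have "red (power_word (p # ps)) = red (word_pow n g) \<otimes>\<^bsub>FA\<^esub> red (power_word ps)" by (simp add: p red_mult)
  also have "red (power_word ps) = list_mult FA (map (\<lambda>(g, n). g [^]\<^bsub>FA\<^esub> n) ps)" using Cons by simp
  finally show ?case using \<open>g [^]\<^bsub>FA\<^esub> n = red (word_pow n g)\<close> by (simp add: p list_mult_def)
qed (simp add: list_mult_def free_group_one)

lemma power_word_pair:
  assumes "g \<in> carrier FA" "h \<in> carrier FA"
  shows "g [^]\<^bsub>FA\<^esub> n \<otimes>\<^bsub>FA\<^esub> h [^]\<^bsub>FA\<^esub> m = red (power_word [(g, n), (h, m)])"
  using red_power_word[of "[(g, n), (h, m)]"] assms by (simp add: list_mult_def del: power_word_simps)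

definition straight_word ::
  "(('a \<times> bool) list \<Rightarrow> ('a \<times> bool) list) \<Rightarrow> (('a \<times> bool) list \<Rightarrow> real) \<Rightarrow>
   (('a \<times> bool) list \<times> nat) list \<Rightarrow> (('a \<times> bool) list \<times> real) list" where
  "straight_word cc lam ps = list_mult (FR FA) (map (\<lambda>(g, n). syllable (cc g) (lam g * real n)) ps)"

context
  fixes cc :: "('a \<times> bool) list \<Rightarrow> ('a \<times> bool) list" and lam :: "('a \<times> bool) list \<Rightarrow> real" and K :: real
  assumes K: "0 \<le> K"
    and cc: "\<And>g. g \<in> carrier FA \<Longrightarrow> cc g \<in> carrier FA"
    and pair: "\<And>g h n m. g \<in> carrier FA \<Longrightarrow> h \<in> carrier FA \<Longrightarrow>
       FR_norm FA wn (syllable (cc g) (lam g * real n) \<otimes>\<^bsub>FR FA\<^esub> syllable (cc h) (lam h * real m))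
         \<le> K * wn (g [^]\<^bsub>FA\<^esub> n \<otimes>\<^bsub>FA\<^esub> h [^]\<^bsub>FA\<^esub> m)"
begin

private abbreviation (input) st where "st g n \<equiv> syllable (cc g) (lam g * real n)"

lemma st_closed: "g \<in> carrier FA \<Longrightarrow> st g n \<in> carrier (FR FA)"
  using cc by (simp add: syllable_closed)

lemma st_add: "st g (a + b) = st g a \<otimes>\<^bsub>FR FA\<^esub> st g b"
  by (simp add: syllable_add distrib_left)

lemma straight_word_simps: "straight_word cc lam [] = \<one>\<^bsub>FR FA\<^esub>" "straight_word cc lam ((g, n) # ps) = st g n \<otimes>\<^bsub>FR FA\<^esub> straight_word cc lam ps"
  by (simp_all add: straight_word_def list_mult_def)

lemma straight_word_closed: "fst ` set ps \<subseteq> carrier FA \<Longrightarrow> straight_word cc lam ps \<in> carrier (FR FA)"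
  by (induction ps) (auto simp: straight_word_simps st_closed)

lemma straight_word_append:
  "fst ` set ps \<subseteq> carrier FA \<Longrightarrow> fst ` set qs \<subseteq> carrier FA \<Longrightarrow>
   straight_word cc lam (ps @ qs) = straight_word cc lam ps \<otimes>\<^bsub>FR FA\<^esub> straight_word cc lam qs"
  by (induction ps) (auto simp: straight_word_simps st_closed straight_word_closed R.m_assoc)

text \<open>Induction over the number of sides. For up to two sides this is the hypothesis on bigons. A polygon
  with sides \<open>g\<^sub>1\<close>, \<open>g\<^sub>2\<close> and the chain of the others is a triangle; cutting it as a tripod
  divides \<open>g\<^sub>1\<close>, \<open>g\<^sub>2\<close> and one further side into two powers each, and leaves three polygons with fewer
  sides. Their words differ from the pieces by at most one period at each cut, and
  the straightened polygon is, up to conjugation, exactly the product of the three straightened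
  pieces. The constant depends on the sides only, as there are finitely many places for the third
  cut.\<close>

theorem polygon:
  "set gs \<subseteq> carrier FA \<Longrightarrow>
   \<exists>B\<ge>0. \<forall>ps. map fst ps = gs \<longrightarrow> FR_norm FA wn (straight_word cc lam ps) \<le> K * wn (red (power_word ps)) + B"
proof (induction gs rule: length_induct)
  case (1 gs)
  show ?case
  proof (cases "length gs \<le> 2")
    case True
    have "FR_norm FA wn (straight_word cc lam ps) \<le> K * wn (red (power_word ps))" if ps: "map fst ps = gs" for ps
    proof (cases ps)
      case Nil
      then show ?thesis by (simp add: straight_word_simps N.nu_one[unfolded free_group_one])
    next
      case (Cons p ps')
      obtain g n where p: "p = (g, n)" by (cases p)
      have g: "g \<in> carrier FA" using 1(2) ps by (auto simp: Cons p)
      show ?thesis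
      proof (cases ps')
        case Nil
        show ?thesis
          using pair[OF g N.one_closed, of n 0] power_word_pair[OF g N.one_closed, of n 0] g
            R.r_one[OF st_closed[OF g, of n]]
          by (simp add: Cons p Nil straight_word_simps fp_one)
      next
        case (Cons q ps'')
        obtain h m where q: "q = (h, m)" by (cases q)
        have e: "ps'' = []" using True ps \<open>ps = p # ps'\<close> Cons by auto
        have h: "h \<in> carrier FA" using 1(2) ps by (auto simp: \<open>ps = p # ps'\<close> Cons q)
        show ?thesis
          using pair[OF g h, of n m] st_closed[OF g, of n] st_closed[OF h, of m]
          unfolding power_word_pair[OF g h]
          by (simp add: \<open>ps = p # ps'\<close> p Cons q e straight_word_simps)
      qed
    qed
    then show ?thesis by (intro exI[of _ 0]) auto
  next
    case False
    then obtain g1 g2 zs where gs: "gs = g1 # g2 # zs" "zs \<noteq> []"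
      by (cases gs; cases "tl gs"; cases "tl (tl gs)") auto
    have gF: "g1 \<in> carrier FA" "g2 \<in> carrier FA" "set zs \<subseteq> carrier FA" using 1(2) gs by auto
    let ?Q = "\<lambda>gs B. 0 \<le> B \<and> (\<forall>ps. map fst ps = gs \<longrightarrow> FR_norm FA wn (straight_word cc lam ps) \<le> K * wn (red (power_word ps)) + B)"
    obtain b where b: "?Q gs' (b gs')" if "length gs' < length gs" "set gs' \<subseteq> carrier FA" for gs'
      using 1(1) by metis
    let ?l2 = "\<lambda>j. g2 # take (Suc j) zs" and ?l3 = "\<lambda>j. drop j zs @ [g1]"
    define B where "B = b [g1, g2] + (\<Sum>j<length zs. b (?l2 j) + b (?l3 j)) +
      2 * K * (real (length g1) + real (length g2) + (\<Sum>g\<leftarrow>zs. real (length g)))"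
    have b1: "?Q [g1, g2] (b [g1, g2])" using gs gF by (intro b) (auto simp: Suc_le_eq)
    have b23: "?Q (?l2 j) (b (?l2 j))" "?Q (?l3 j) (b (?l3 j))" if "j < length zs" for j
      using that gs gF by (intro b; force dest: in_set_takeD in_set_dropD)+
    have S0: "0 \<le> (\<Sum>j<length zs. b (?l2 j) + b (?l3 j))"
      using b23 by (intro sum_nonneg add_nonneg_nonneg) auto
    have B0: "0 \<le> B" unfolding B_def using S0 b1 K by (intro add_nonneg_nonneg mult_nonneg_nonneg sum_list_nonneg) auto
    have "FR_norm FA wn (straight_word cc lam ps) \<le> K * wn (red (power_word ps)) + B" if ps: "map fst ps = gs" for ps
    proof -
      obtain n1 n2 qs where qs: "ps = (g1, n1) # (g2, n2) # qs" "map fst qs = zs"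
        using ps unfolding gs(1) by (auto simp: map_eq_Cons_conv)
      have qne: "qs \<noteq> []" using qs gs by auto
      have lt: "fst ` set (word_pow n1 g1 @ word_pow n2 g2 @ power_word qs) \<subseteq> A"
      proof -
        have "fst ` set ps \<subseteq> carrier FA" using 1(2) unfolding ps[symmetric] by simp
        from power_word_letters[OF this] show ?thesis by (simp add: qs(1))
      qed
      obtain x1 x2 y1 y2 z1 z2 where t: "word_pow n1 g1 = x1 @ x2" "word_pow n2 g2 = y1 @ y2" "power_word qs = z1 @ z2"
        "wn (red (x2 @ y1)) + wn (red (y2 @ z1)) + wn (red (z2 @ x1)) \<le> wn (red (word_pow n1 g1 @ word_pow n2 g2 @ power_word qs))"
        by (rule tripod[OF lt])
      obtain a1 b1' u where u: "a1 + b1' = n1" "x1 = word_pow a1 g1 @ u" "u @ x2 = word_pow b1' g1" "length u \<le> length g1"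
        using word_pow_split[OF t(1)] .
      obtain a2 b2' v where v: "a2 + b2' = n2" "y1 = word_pow a2 g2 @ v" "v @ y2 = word_pow b2' g2" "length v \<le> length g2"
        using word_pow_split[OF t(2)] .
      obtain q1 g a3 b3 q2 w where w: "qs = q1 @ (g, a3 + b3) # q2" "z1 = power_word q1 @ word_pow a3 g @ w"
        "w @ z2 = word_pow b3 g @ power_word q2" "length w \<le> length g"
        using power_word_split[OF t(3) qne] .
      define j where "j = length q1"
      have j: "j < length zs" "take (Suc j) zs = map fst q1 @ [g]" "drop j zs = g # map fst q2"
        using qs(2) unfolding w(1) j_def by auto
      have g: "g \<in> carrier FA" "fst ` set q1 \<subseteq> carrier FA" "fst ` set q2 \<subseteq> carrier FA"
        using gF(3) unfolding qs(2)[symmetric] w(1) by simp_all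
      have lens: "real (length u) + real (length v) + real (length w)
          \<le> real (length g1) + real (length g2) + (\<Sum>g\<leftarrow>zs. real (length g))"
      proof -
        have "real (length g) \<le> (\<Sum>g\<leftarrow>zs. real (length g))"
          using qs(2) unfolding w(1) by (auto intro!: member_le_sum_list)
        then show ?thesis using u(4) v(4) w(4) by linarith
      qed
      let ?p1 = "[(g1, b1'), (g2, a2)]" and ?p2 = "(g2, b2') # q1 @ [(g, a3)]" and ?p3 = "(g, b3) # q2 @ [(g1, a1)]"
      have p: "fst ` set ?p1 \<subseteq> carrier FA" "fst ` set ?p2 \<subseteq> carrier FA" "fst ` set ?p3 \<subseteq> carrier FA"
        using g gF by simp_all
      have trim: "wn (red (power_word p)) \<le> real (length u) + wn (red m) + real (length v)"
        if "fst ` set p \<subseteq> carrier FA" "red (power_word p) = red (u @ m @ winv v)" "fst ` set (u @ m @ winv v) \<subseteq> A" for p u v m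
        using nu_trim[OF that(3)] that(2) by simp
      have ltu: "fst ` set u \<subseteq> A" "fst ` set v \<subseteq> A" "fst ` set w \<subseteq> A" "fst ` set x1 \<subseteq> A" "fst ` set x2 \<subseteq> A"
        "fst ` set y1 \<subseteq> A" "fst ` set y2 \<subseteq> A" "fst ` set z1 \<subseteq> A" "fst ` set z2 \<subseteq> A"
        using lt unfolding t(1-3) unfolding u(2) v(2) w(2) by (simp_all add: image_Un)
      have w1: "wn (red (power_word ?p1)) \<le> real (length u) + wn (red (x2 @ y1)) + real (length v)"
      proof (rule trim[OF p(1)])
        have "red (u @ (x2 @ y1) @ winv v) = red ((u @ x2 @ word_pow a2 g2) @ (v @ winv v))" unfolding v(2) by (simp only: append_assoc)
        also have "\<dots> = red ((u @ x2 @ word_pow a2 g2) @ red (v @ winv v))" by (rule red_append_red [symmetric])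
        also have "\<dots> = red (power_word ?p1)" using u(3) by (simp flip: append_assoc)
        finally show "red (power_word ?p1) = red (u @ (x2 @ y1) @ winv v)" by simp
      qed (use ltu in \<open>simp add: image_Un\<close>)
      have w2: "wn (red (power_word ?p2)) \<le> real (length v) + wn (red (y2 @ z1)) + real (length w)"
      proof (rule trim[OF p(2)])
        have "red (v @ (y2 @ z1) @ winv w) = red ((v @ y2 @ power_word q1 @ word_pow a3 g) @ (w @ winv w))" unfolding w(2) by (simp only: append_assoc)
        also have "\<dots> = red ((v @ y2 @ power_word q1 @ word_pow a3 g) @ red (w @ winv w))" by (rule red_append_red [symmetric])
        also have "\<dots> = red (power_word ?p2)" using v(3) by (simp flip: append_assoc)
        finally show "red (power_word ?p2) = red (v @ (y2 @ z1) @ winv w)" by simp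
      qed (use ltu in \<open>simp add: image_Un\<close>)
      have w3: "wn (red (power_word ?p3)) \<le> real (length w) + wn (red (z2 @ x1)) + real (length u)"
      proof (rule trim[OF p(3)])
        have "red (w @ (z2 @ x1) @ winv u) = red ((w @ z2 @ word_pow a1 g1) @ (u @ winv u))" unfolding u(2) by (simp only: append_assoc)
        also have "\<dots> = red ((w @ z2 @ word_pow a1 g1) @ red (u @ winv u))" by (rule red_append_red [symmetric])
        also have "\<dots> = red (power_word ?p3)" using w(3) by (simp flip: append_assoc)
        finally show "red (power_word ?p3) = red (w @ (z2 @ x1) @ winv u)" by simp
      qed (use ltu in \<open>simp add: image_Un\<close>)
      have f1: "FR_norm FA wn (straight_word cc lam ?p1) \<le> K * wn (red (power_word ?p1)) + b [g1, g2]" using b1[THEN conjunct2, rule_format, of ?p1] by (simp del: power_word_simps)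
      have f2: "FR_norm FA wn (straight_word cc lam ?p2) \<le> K * wn (red (power_word ?p2)) + b (?l2 j)" 
        using b23(1)[OF j(1), THEN conjunct2, rule_format, of ?p2] j(2) by (simp del: power_word_simps)
      have f3: "FR_norm FA wn (straight_word cc lam ?p3) \<le> K * wn (red (power_word ?p3)) + b (?l3 j)" 
        using b23(2)[OF j(1), THEN conjunct2, rule_format, of ?p3] j(3) by (simp del: power_word_simps)
      have bj: "b (?l2 j) + b (?l3 j) \<le> (\<Sum>j<length zs. b (?l2 j) + b (?l3 j))"
        using b23 j(1) by (intro member_le_sum) (auto intro!: add_nonneg_nonneg)
      have cl: "st g1 a1 \<in> carrier (FR FA)" "st g1 b1' \<in> carrier (FR FA)" "st g2 a2 \<in> carrier (FR FA)" "st g2 b2' \<in> carrier (FR FA)"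
        "st g a3 \<in> carrier (FR FA)" "st g b3 \<in> carrier (FR FA)" "straight_word cc lam q1 \<in> carrier (FR FA)" "straight_word cc lam q2 \<in> carrier (FR FA)"
        using g gF by (auto intro: st_closed straight_word_closed)
      have Pcl: "straight_word cc lam ?p1 \<in> carrier (FR FA)" "straight_word cc lam ?p2 \<in> carrier (FR FA)" "straight_word cc lam ?p3 \<in> carrier (FR FA)"
        using p by (auto intro: straight_word_closed simp del: list.set)
      \<comment> \<open>The first piece of \<open>g1\<close> is rotated to the end, where it completes the third polygon.\<close>
      let ?T = "st g1 b1' \<otimes>\<^bsub>FR FA\<^esub> (st g2 a2 \<otimes>\<^bsub>FR FA\<^esub> (st g2 b2' \<otimes>\<^bsub>FR FA\<^esub> (straight_word cc lam q1 \<otimes>\<^bsub>FR FA\<^esub> (st g a3 \<otimes>\<^bsub>FR FA\<^esub> (st g b3 \<otimes>\<^bsub>FR FA\<^esub> straight_word cc lam q2)))))"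
      have "straight_word cc lam ps = st g1 a1 \<otimes>\<^bsub>FR FA\<^esub> ?T"
        unfolding qs(1) w(1) u(1)[symmetric] v(1)[symmetric]
        using cl g by (simp add: straight_word_simps straight_word_append st_add R.m_assoc del: of_nat_add)
      then have "FR_norm FA wn (straight_word cc lam ps) = FR_norm FA wn (?T \<otimes>\<^bsub>FR FA\<^esub> st g1 a1)"
        using R.nu_commute[of "st g1 a1" ?T] cl by simp
      also have "?T \<otimes>\<^bsub>FR FA\<^esub> st g1 a1 = straight_word cc lam ?p1 \<otimes>\<^bsub>FR FA\<^esub> (straight_word cc lam ?p2 \<otimes>\<^bsub>FR FA\<^esub> straight_word cc lam ?p3)"
        using cl g gF by (simp add: straight_word_simps straight_word_append R.m_assoc)
      also have "FR_norm FA wn \<dots> \<le> FR_norm FA wn (straight_word cc lam ?p1) + (FR_norm FA wn (straight_word cc lam ?p2) + FR_norm FA wn (straight_word cc lam ?p3))"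
        using R.nu_mult[OF Pcl(1) R.m_closed[OF Pcl(2,3)]] R.nu_mult[OF Pcl(2,3)] by linarith
      also have "\<dots> \<le> K * (wn (red (power_word ?p1)) + wn (red (power_word ?p2)) + wn (red (power_word ?p3))) + (b [g1, g2] + (b (?l2 j) + b (?l3 j)))"
        using f1 f2 f3 by (simp add: algebra_simps)
      also have "K * (wn (red (power_word ?p1)) + wn (red (power_word ?p2)) + wn (red (power_word ?p3)))
          \<le> K * (wn (red (power_word ps)) + 2 * (real (length g1) + real (length g2) + (\<Sum>g\<leftarrow>zs. real (length g))))"
        using w1 w2 w3 t(4) lens K unfolding qs(1) by (intro mult_left_mono) auto
      finally show ?thesis using bj unfolding B_def by (simp add: algebra_simps)
    qed
    then show ?thesis using B0 by blast
  qed
qed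

end

end

lemma hom_fp_lift:
  assumes "\<Lambda> \<in> hom (FR G) (FR G)" "\<And>y. y \<in> set x \<Longrightarrow> f (fst y) (snd y) \<in> carrier (FR G)"
  shows "fp_lift (FR G) f x \<in> carrier (FR G) \<and>
    \<Lambda> (fp_lift (FR G) f x) = fp_lift (FR G) (\<lambda>g r. \<Lambda> (f g r)) x"
proof -
  interpret group "FR G" by (rule group_free_product_reals)
  interpret L: group_hom "FR G" "FR G" \<Lambda> using assms(1) by unfold_locales
  show ?thesis using assms(2)
  proof (induction x)
    case (Cons y x)
    then show ?case by (cases y) (auto simp: fp_lift_Cons)
  qed simp
qed

lemma fp_lift_cong: "(\<And>y. y \<in> set x \<Longrightarrow> f (fst y) (snd y) = f' (fst y) (snd y)) \<Longrightarrow> fp_lift H f x = fp_lift H f' x"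
  by (auto simp: fp_lift_def intro!: arg_cong[of _ _ "list_mult H"])

text \<open>A syllable with negative exponent is treated as a positive power of the inverse, so that the
  sides of the polygon do not depend on \<open>t\<close>. For the last property, if \<open>g\<^sup>a\<close> is conjugate by \<open>h\<close> to \<open>c\<^sup>b\<close>,
  then \<open>g\<^sup>n\<close> is lifted by dividing \<open>n\<close> by \<open>a\<close>: the quotient contributes a power of \<open>c\<close>, and the remainder
  and the syllables for \<open>h\<close> have bounded norm.\<close>

lemma free_group_straightens:
  assumes x: "x \<in> carrier (FR (free_group A))"
  shows "\<exists>\<Lambda> K. conj_pseudonorm.straightens (free_group A) (word_norm A) \<Lambda> K x"
proof -
  let ?F = "free_group A" and ?wn = "word_norm A"
  interpret N: conj_pseudonorm ?F ?wn by (rule word_norm_pseudonorm)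
  interpret R: conj_pseudonorm "FR ?F" "FR_norm ?F ?wn" by (rule N.FR_pseudonorm)
  have S: "finite (fst ` set x)" "fst ` set x \<subseteq> carrier ?F" using N.letters_of_FR[OF x] by auto
  obtain cc :: "('a \<times> bool) list \<Rightarrow> ('a \<times> bool) list" and lam :: "('a \<times> bool) list \<Rightarrow> real" and K :: real
    where K: "0 \<le> K"
    and cc: "\<And>g. g \<in> carrier ?F \<Longrightarrow> cc g \<in> carrier ?F \<and> \<bar>lam g\<bar> * ?wn (cc g) \<le> 2 * ?wn g"
    and pair: "\<And>g h n m. g \<in> carrier ?F \<Longrightarrow> h \<in> carrier ?F \<Longrightarrow>
       FR_norm ?F ?wn (syllable (cc g) (lam g * real n) \<otimes>\<^bsub>FR ?F\<^esub> syllable (cc h) (lam h * real m))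
         \<le> K * ?wn (g [^]\<^bsub>?F\<^esub> n \<otimes>\<^bsub>?F\<^esub> h [^]\<^bsub>?F\<^esub> m)"
    and com: "\<And>g. g \<in> fst ` set x \<Longrightarrow> \<exists>a\<ge>1. \<exists>b. \<exists>h\<in>carrier ?F. lam g * real a = of_int b \<and>
       g [^]\<^bsub>?F\<^esub> (a::nat) = h \<otimes>\<^bsub>?F\<^esub> cc g [^]\<^bsub>?F\<^esub> (b::int) \<otimes>\<^bsub>?F\<^esub> inv\<^bsub>?F\<^esub> h"
    and sign: "\<And>g r. g \<in> carrier ?F \<Longrightarrow> syllable (cc (inv\<^bsub>?F\<^esub> g)) (lam (inv\<^bsub>?F\<^esub> g) * r) = syllable (cc g) (lam g * - r)"
    by (rule straightening_data[OF S]) (assumption | rule that)+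
  have ccF: "cc g \<in> carrier ?F" if "g \<in> carrier ?F" for g using cc[OF that] by simp
  define f where "f g r = syllable (cc g) (lam g * r)" for g r
  define \<Lambda> where "\<Lambda> = fp_lift (FR ?F) f"
  have f_closed: "f g r \<in> carrier (FR ?F)" if "g \<in> carrier ?F" for g r
    using ccF[OF that] by (simp add: f_def syllable_closed)
  have f_add: "f g (r + s) = f g r \<otimes>\<^bsub>FR ?F\<^esub> f g s" for g r s
    by (simp add: f_def syllable_add distrib_left)
  have hom: "\<Lambda> \<in> hom (FR ?F) (FR ?F)" unfolding \<Lambda>_def by (rule fp_lift_hom(1)[OF R.group_axioms f_closed f_add])
  have gen: "\<Lambda> (syllable g r) = f g r" if "g \<in> carrier ?F" for g r
    unfolding \<Lambda>_def by (rule fp_lift_hom(2)[OF R.group_axioms f_closed f_add that])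
  interpret L: group_hom "FR ?F" "FR ?F" \<Lambda> using hom by unfold_locales
  have lip: "FR_norm ?F ?wn (\<Lambda> y) \<le> 2 * FR_norm ?F ?wn y" if y: "y \<in> carrier (FR ?F)" for y
  proof (rule N.FR_hom_Lipschitz[OF N.FR_pseudonorm hom _ _ y])
    fix g r assume g: "g \<in> carrier ?F"
    have "FR_norm ?F ?wn (\<Lambda> (syllable g r)) \<le> \<bar>lam g * r\<bar> * ?wn (cc g)"
      unfolding gen[OF g] f_def by (rule N.FR_norm_syllable[OF ccF[OF g]])
    also have "\<dots> = \<bar>r\<bar> * (\<bar>lam g\<bar> * ?wn (cc g))" by (simp add: abs_mult)
    also have "\<dots> \<le> \<bar>r\<bar> * (2 * ?wn g)" using cc[OF g] by (intro mult_left_mono) auto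
    finally show "FR_norm ?F ?wn (\<Lambda> (syllable g r)) \<le> 2 * (\<bar>r\<bar> * ?wn g)" by simp
  qed simp
  have lip_dst: "R.dst (\<Lambda> y) (\<Lambda> z) \<le> 2 * R.dst y z" if "y \<in> carrier (FR ?F)" "z \<in> carrier (FR ?F)" for y z
    using lip[of "inv\<^bsub>FR ?F\<^esub> y \<otimes>\<^bsub>FR ?F\<^esub> z"] that by (simp add: norm_dist_def)
  have comm: "\<Lambda> (psi ?F t y) = psi ?F t (\<Lambda> y)" if y: "y \<in> carrier (FR ?F)" for t y
  proof -
    have "(\<Lambda> \<circ> psi ?F t) y = (psi ?F t \<circ> \<Lambda>) y"
    proof (rule fp_hom_eqI[OF R.group_axioms _ _ _ y])
      show "\<Lambda> \<circ> psi ?F t \<in> hom (FR ?F) (FR ?F)" by (rule hom_compose[OF psi_hom hom])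
      show "psi ?F t \<circ> \<Lambda> \<in> hom (FR ?F) (FR ?F)" by (rule hom_compose[OF hom psi_hom])
      show "(\<Lambda> \<circ> psi ?F t) (syllable i r) = (psi ?F t \<circ> \<Lambda>) (syllable i r)" if "i \<in> carrier ?F" for i r
        using that ccF[OF that] by (simp add: psi_syllable gen f_def mult.left_commute)
    qed
    then show ?thesis by simp
  qed
  have est: "\<exists>B. \<forall>t>0. t * FR_norm ?F ?wn (\<Lambda> y) \<le> K * ?wn (proj ?F (floor_word ?F t y)) + B"
    if y: "y \<in> carrier (FR ?F)" for y
  proof -
    let ?g = "\<lambda>(g, r::real). if r \<ge> 0 then g else inv\<^bsub>?F\<^esub> g"
    have yF: "fst p \<in> carrier ?F" if "p \<in> set y" for p by (rule N.letters_of_FR[OF y that])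
    have "set (map ?g y) \<subseteq> carrier ?F" using yF by auto
    from polygon[OF K ccF pair this] obtain B where
      B: "\<And>ps. map fst ps = map ?g y \<Longrightarrow> FR_norm ?F ?wn (straight_word A cc lam ps) \<le> K * ?wn (red (power_word ps)) + B"
      by blast
    define B0 where "B0 = (\<Sum>p\<leftarrow>y. ?wn (fst p))"
    have "t * FR_norm ?F ?wn (\<Lambda> y) \<le> K * ?wn (proj ?F (floor_word ?F t y)) + (B + 2 * B0)" if t: "t > 0" for t
    proof -
      let ?n = "\<lambda>(g, r::real). nat (if r \<ge> 0 then \<lfloor>t * r\<rfloor> else - \<lfloor>t * r\<rfloor>)"
      define ps where "ps = map (\<lambda>p. (?g p, ?n p)) y"
      have psF: "fst ` set ps \<subseteq> carrier ?F" using yF by (auto simp: ps_def)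
      have neg: "\<lfloor>t * r\<rfloor> \<le> 0" if "\<not> r \<ge> 0" for r
      proof -
        have "t * r \<le> 0" using that t by (simp add: mult_le_0_iff)
        then show ?thesis by (simp add: floor_le_iff)
      qed
      have n: "real (?n (g, r)) = (if r \<ge> 0 then of_int \<lfloor>t * r\<rfloor> else - of_int \<lfloor>t * r\<rfloor>)" for g :: "('a \<times> bool) list" and r
        using neg[of r] t by auto
      have 1: "syllable (cc (?g (g, r))) (lam (?g (g, r)) * real (?n (g, r))) = f g (of_int \<lfloor>t * r\<rfloor>)"
        if "g \<in> carrier ?F" for g r
        unfolding n f_def using sign[OF that, of "- of_int \<lfloor>t * r\<rfloor>"] by simp
      have "straight_word A cc lam ps = fp_lift (FR ?F) (\<lambda>g r. f g (of_int \<lfloor>t * r\<rfloor>)) y"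
        unfolding straight_word_def fp_lift_def ps_def map_map
        by (rule arg_cong[of _ _ "list_mult (FR ?F)"], rule map_cong[OF refl])
          (use 1 yF in \<open>force split: prod.splits\<close>)
      also have "\<dots> = fp_lift (FR ?F) (\<lambda>g r. \<Lambda> (syllable g (of_int \<lfloor>t * r\<rfloor>))) y"
        by (rule fp_lift_cong) (simp add: gen yF)
      also have "\<dots> = \<Lambda> (floor_word ?F t y)"
        unfolding floor_word_def using hom_fp_lift[OF hom, of y "\<lambda>g r. syllable g (of_int \<lfloor>t * r\<rfloor>)"] yF
        by (simp add: syllable_closed)
      finally have straight_word: "straight_word A cc lam ps = \<Lambda> (floor_word ?F t y)" .
      have 2: "?g (g, r) [^]\<^bsub>?F\<^esub> ?n (g, r) = g [^]\<^bsub>?F\<^esub> \<lfloor>t * r\<rfloor>" if g: "g \<in> carrier ?F" for g r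
      proof (cases "r \<ge> 0")
        case True
        then have "int (?n (g, r)) = \<lfloor>t * r\<rfloor>" using t by simp
        then show ?thesis using True by (metis (mono_tags, lifting) case_prod_conv int_pow_int)
      next
        case False
        then have "\<lfloor>t * r\<rfloor> = - int (nat (- \<lfloor>t * r\<rfloor>))" using neg[OF False] by simp
        then have "g [^]\<^bsub>?F\<^esub> \<lfloor>t * r\<rfloor> = inv\<^bsub>?F\<^esub> (g [^]\<^bsub>?F\<^esub> nat (- \<lfloor>t * r\<rfloor>))"
          using g by (metis N.int_pow_neg int_pow_int)
        then show ?thesis using False g by (simp add: N.nat_pow_inv)
      qed
      have "red (power_word ps) = fp_lift ?F (\<lambda>g r. g [^]\<^bsub>?F\<^esub> \<lfloor>t * r\<rfloor>) y"
        unfolding red_power_word[OF psF] unfolding fp_lift_def ps_def map_map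
        by (rule arg_cong[of _ _ "list_mult ?F"], rule map_cong[OF refl])
          (use 2 yF in \<open>force split: prod.splits\<close>)
      then have power_word: "red (power_word ps) = proj ?F (floor_word ?F t y)" using N.floor_word_FZ(2)[OF y] by simp
      have "map fst ps = map ?g y" by (simp add: ps_def comp_def)
      from B[OF this] have 3: "FR_norm ?F ?wn (\<Lambda> (floor_word ?F t y)) \<le> K * ?wn (proj ?F (floor_word ?F t y)) + B"
        unfolding straight_word power_word .
      have fc: "floor_word ?F t y \<in> carrier (FR ?F)" using N.floor_word_FZ(1)[OF y] FZ_carrier_subset by blast
      have "t * FR_norm ?F ?wn (\<Lambda> y) = FR_norm ?F ?wn (\<Lambda> (psi ?F t y))"
        using N.FR_norm_psi[OF _ t, of "\<Lambda> y"] y by (simp add: comm)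
      also have "\<dots> \<le> FR_norm ?F ?wn (\<Lambda> (floor_word ?F t y)) + R.dst (\<Lambda> (psi ?F t y)) (\<Lambda> (floor_word ?F t y))"
        using fc y by (intro R.nu_le_dst L.hom_closed psi_closed)
      also have "R.dst (\<Lambda> (psi ?F t y)) (\<Lambda> (floor_word ?F t y)) \<le> 2 * R.dst (psi ?F t y) (floor_word ?F t y)"
        using fc y by (intro lip_dst psi_closed)
      also have "R.dst (psi ?F t y) (floor_word ?F t y) \<le> B0"
        using N.dst_floor_word_psi[OF y, of t] R.dst_sym[OF fc psi_closed[OF y, of t]] by (simp add: B0_def)
      finally show ?thesis using 3 by simp
    qed
    then show ?thesis by blast
  qed
  obtain a b h where ab: "\<And>g. g \<in> fst ` set x \<Longrightarrow> (1::nat) \<le> a g \<and> h g \<in> carrier ?F \<and> lam g * real (a g) = of_int (b g) \<and>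
     g [^]\<^bsub>?F\<^esub> a g = h g \<otimes>\<^bsub>?F\<^esub> cc g [^]\<^bsub>?F\<^esub> (b g :: int) \<otimes>\<^bsub>?F\<^esub> inv\<^bsub>?F\<^esub> h g"
    using com by metis
  define W where "W g n = syllable (h g) (of_int 1) \<otimes>\<^bsub>FR ?F\<^esub> (syllable (cc g) (of_int (b g * (n div int (a g)))) \<otimes>\<^bsub>FR ?F\<^esub>
    (syllable (h g) (of_int (- 1)) \<otimes>\<^bsub>FR ?F\<^esub> syllable g (of_int (n mod int (a g)))))" for g and n :: int
  have W: "W g n \<in> carrier (FZ ?F) \<and> proj ?F (W g n) = g [^]\<^bsub>?F\<^esub> n" if "g \<in> fst ` set x" for g n
  proof -
    have g: "g \<in> carrier ?F" using that S by auto
    note abg = ab[OF that]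
    let ?q = "n div int (a g)"
    have FZ: "syllable (h g) (of_int 1) \<in> carrier (FZ ?F)" "syllable (cc g) (of_int (b g * ?q)) \<in> carrier (FZ ?F)"
      "syllable (h g) (of_int (- 1)) \<in> carrier (FZ ?F)" "syllable g (of_int (n mod int (a g))) \<in> carrier (FZ ?F)"
      using abg g ccF[OF g] by (blast intro: syllable_FZ)+
    have conj: "(h g \<otimes>\<^bsub>?F\<^esub> cc g [^]\<^bsub>?F\<^esub> b g \<otimes>\<^bsub>?F\<^esub> inv\<^bsub>?F\<^esub> h g) [^]\<^bsub>?F\<^esub> ?q
        = h g \<otimes>\<^bsub>?F\<^esub> cc g [^]\<^bsub>?F\<^esub> (b g * ?q) \<otimes>\<^bsub>?F\<^esub> inv\<^bsub>?F\<^esub> h g"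
      using conj_int_pow[of "h g" A "cc g [^]\<^bsub>?F\<^esub> b g" ?q] abg ccF[OF g] by (simp add: N.int_pow_pow)
    have "g [^]\<^bsub>?F\<^esub> n = g [^]\<^bsub>?F\<^esub> (int (a g) * ?q + n mod int (a g))" by simp
    also have "\<dots> = (g [^]\<^bsub>?F\<^esub> a g) [^]\<^bsub>?F\<^esub> ?q \<otimes>\<^bsub>?F\<^esub> g [^]\<^bsub>?F\<^esub> (n mod int (a g))"
      using g by (simp only: N.int_pow_mult N.int_pow_pow[symmetric] int_pow_int)
    also have "g [^]\<^bsub>?F\<^esub> a g = h g \<otimes>\<^bsub>?F\<^esub> cc g [^]\<^bsub>?F\<^esub> b g \<otimes>\<^bsub>?F\<^esub> inv\<^bsub>?F\<^esub> h g" using abg by blast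
    finally have gn: "g [^]\<^bsub>?F\<^esub> n = h g \<otimes>\<^bsub>?F\<^esub> cc g [^]\<^bsub>?F\<^esub> (b g * ?q) \<otimes>\<^bsub>?F\<^esub> inv\<^bsub>?F\<^esub> h g \<otimes>\<^bsub>?F\<^esub> g [^]\<^bsub>?F\<^esub> (n mod int (a g))"
      unfolding conj .
    have "proj ?F (W g n) = h g \<otimes>\<^bsub>?F\<^esub> (cc g [^]\<^bsub>?F\<^esub> (b g * ?q) \<otimes>\<^bsub>?F\<^esub> (inv\<^bsub>?F\<^esub> h g \<otimes>\<^bsub>?F\<^esub> g [^]\<^bsub>?F\<^esub> (n mod int (a g))))"
      unfolding W_def using FZ abg g ccF[OF g]
      by (simp only: N.proj_mult FZ_closed proj_syllable_int[OF group_free_group] N.int_pow_neg N.int_pow_1)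
    then show ?thesis
      unfolding gn using FZ abg g ccF[OF g] by (simp add: W_def FZ_closed N.m_assoc)
  qed
  define Bg where "Bg g = ?wn (h g) + ?wn (h g) + real (a g) * ?wn g + \<bar>lam g\<bar> * (real (a g) + 1) * ?wn (cc g)" for g
  have Wd: "R.dst (W g \<lfloor>r\<rfloor>) (f g r) \<le> Bg g" if "g \<in> fst ` set x" for g r
  proof -
    have g: "g \<in> carrier ?F" using that S by auto
    note abg = ab[OF that] and c = ccF[OF g]
    let ?n = "\<lfloor>r\<rfloor>"
    let ?q = "?n div int (a g)"
    let ?h = "syllable (h g) (of_int 1)" and ?c = "syllable (cc g) (of_int (b g * ?q))"
      and ?h' = "syllable (h g) (of_int (- 1))" and ?m = "syllable g (of_int (?n mod int (a g)))"
    have cl: "?h \<in> carrier (FR ?F)" "?c \<in> carrier (FR ?F)" "?h' \<in> carrier (FR ?F)" "?m \<in> carrier (FR ?F)"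
      using abg g c by (auto intro: syllable_closed)
    have m: "0 \<le> ?n mod int (a g)" "?n mod int (a g) < int (a g)" using abg by auto
    then have m': "0 \<le> real_of_int (?n mod int (a g))" "real_of_int (?n mod int (a g)) \<le> real (a g)" by linarith+
    have "R.dst (W g ?n) (\<one>\<^bsub>FR ?F\<^esub> \<otimes>\<^bsub>FR ?F\<^esub> (?c \<otimes>\<^bsub>FR ?F\<^esub> (\<one>\<^bsub>FR ?F\<^esub> \<otimes>\<^bsub>FR ?F\<^esub> \<one>\<^bsub>FR ?F\<^esub>)))
        \<le> R.dst ?h \<one>\<^bsub>FR ?F\<^esub> + (R.dst ?c ?c + (R.dst ?h' \<one>\<^bsub>FR ?F\<^esub> + R.dst ?m \<one>\<^bsub>FR ?F\<^esub>))"
      unfolding W_def using cl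
      by (intro order_trans[OF R.dst_mult] add_left_mono add_mono order_refl R.m_closed R.one_closed)
    also have "\<dots> = FR_norm ?F ?wn ?h + (FR_norm ?F ?wn ?h' + FR_norm ?F ?wn ?m)"
      using cl R.dst_sym[OF _ R.one_closed] by simp
    also have "\<dots> \<le> ?wn (h g) + (?wn (h g) + real (a g) * ?wn g)"
    proof (intro add_mono)
      show "FR_norm ?F ?wn ?h \<le> ?wn (h g)" "FR_norm ?F ?wn ?h' \<le> ?wn (h g)"
        using N.FR_norm_syllable[of "h g" 1] N.FR_norm_syllable[of "h g" "-1"] abg by simp_all
      have "FR_norm ?F ?wn ?m \<le> \<bar>of_int (?n mod int (a g))\<bar> * ?wn g" by (rule N.FR_norm_syllable[OF g])
      also have "\<dots> \<le> real (a g) * ?wn g" using m' N.nu_nonneg[OF g] by (intro mult_right_mono) auto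
      finally show "FR_norm ?F ?wn ?m \<le> real (a g) * ?wn g" .
    qed
    finally have 1: "R.dst (W g ?n) ?c \<le> ?wn (h g) + (?wn (h g) + real (a g) * ?wn g)" using cl by simp
    have "R.dst ?c (f g r) \<le> \<bar>of_int (b g * ?q) - lam g * r\<bar> * ?wn (cc g)"
      unfolding f_def by (rule N.dst_syllable[OF c])
    also have "\<dots> \<le> \<bar>lam g\<bar> * (real (a g) + 1) * ?wn (cc g)"
    proof (intro mult_right_mono N.nu_nonneg[OF c])
      have "int (a g) * ?q = ?n - ?n mod int (a g)" by (simp add: minus_mod_eq_mult_div)
      then have "real (a g) * of_int ?q = of_int ?n - of_int (?n mod int (a g))"
        by (metis of_int_diff of_int_mult of_int_of_nat_eq)
      moreover have "real_of_int (b g * ?q) = lam g * (real (a g) * of_int ?q)" using abg by (simp add: mult.assoc)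
      ultimately have "of_int (b g * ?q) - lam g * r = lam g * (of_int ?n - of_int (?n mod int (a g)) - r)"
        by (simp add: right_diff_distrib)
      moreover have "\<bar>of_int ?n - of_int (?n mod int (a g)) - r\<bar> \<le> real (a g) + 1"
        using m' floor_correct[of r] by linarith
      ultimately show "\<bar>of_int (b g * ?q) - lam g * r\<bar> \<le> \<bar>lam g\<bar> * (real (a g) + 1)"
        by (simp add: abs_mult mult_left_mono)
    qed
    finally have 2: "R.dst ?c (f g r) \<le> \<bar>lam g\<bar> * (real (a g) + 1) * ?wn (cc g)" .
    have "W g ?n \<in> carrier (FR ?F)" using W[OF that] FZ_carrier_subset by blast
    then show ?thesis
      using R.dst_triangle[of "W g ?n" ?c "f g r"] 1 2 cl f_closed[OF g] by (simp add: Bg_def)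
  qed
  have lift: "\<exists>w B. \<forall>t>0. w t \<in> carrier (FZ ?F) \<and> proj ?F (w t) = proj ?F (floor_word ?F t x) \<and>
        R.dst (w t) (psi ?F t (\<Lambda> x)) \<le> B"
  proof (intro exI allI impI)
    fix t :: real assume "t > 0"
    let ?w = "fp_lift (FR ?F) (\<lambda>g r. W g \<lfloor>t * r\<rfloor>) x"
    have xF: "fst p \<in> carrier ?F" if "p \<in> set x" for p by (rule N.letters_of_FR[OF x that])
    have "?w \<in> carrier (FZ ?F) \<and> proj ?F ?w = fp_lift ?F (\<lambda>g r. g [^]\<^bsub>?F\<^esub> \<lfloor>t * r\<rfloor>) x"
      by (rule N.fp_lift_FZ) (use W in auto)
    moreover have "psi ?F t (\<Lambda> x) = fp_lift (FR ?F) (\<lambda>g r. f g (t * r)) x"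
    proof -
      have "psi ?F t (\<Lambda> x) = \<Lambda> (psi ?F t x)" using comm[OF x] by simp
      also have "\<dots> = fp_lift (FR ?F) (\<lambda>g r. \<Lambda> (syllable g (t * r))) x"
        unfolding psi_def using hom_fp_lift[OF hom, of x "\<lambda>g r. syllable g (t * r)"] xF
        by (simp add: syllable_closed)
      also have "\<dots> = fp_lift (FR ?F) (\<lambda>g r. f g (t * r)) x"
        by (rule fp_lift_cong) (simp add: gen xF)
      finally show ?thesis .
    qed
    moreover have "R.dst ?w (fp_lift (FR ?F) (\<lambda>g r. f g (t * r)) x) \<le> (\<Sum>p\<leftarrow>x. Bg (fst p))"
    proof (rule N.dst_fp_lift)
      fix p assume p: "p \<in> set x"
      then have p': "fst p \<in> fst ` set x" by simp
      show "W (fst p) \<lfloor>t * snd p\<rfloor> \<in> carrier (FR ?F) \<and> f (fst p) (t * snd p) \<in> carrier (FR ?F) \<and>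
          R.dst (W (fst p) \<lfloor>t * snd p\<rfloor>) (f (fst p) (t * snd p)) \<le> Bg (fst p)"
        using W[OF p'] Wd[OF p'] f_closed[OF xF[OF p]] FZ_carrier_subset by blast
    qed
    ultimately show "?w \<in> carrier (FZ ?F) \<and> proj ?F ?w = proj ?F (floor_word ?F t x) \<and>
        R.dst ?w (psi ?F t (\<Lambda> x)) \<le> (\<Sum>p\<leftarrow>x. Bg (fst p))"
      using N.floor_word_FZ(2)[OF x] by simp
  qed
  show ?thesis
    unfolding N.straightens_def using hom lip K est lift by blast
qed


section \<open>Groups of functions and limits of norms\<close>

text \<open>Both the norm of a directional word and the norm in an ultrafilter cone are limits of rescaled
  norms of values.\<close>

lemma limit_pseudonorm:
  fixes s :: "'i \<Rightarrow> real" and N :: "'p \<Rightarrow> real"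
  assumes P: "group P" and H: "subgroup H P" and F: "F \<noteq> bot" and K: "conj_pseudonorm K \<mu>"
    and T: "eventually (\<lambda>i. i \<in> T) F" and s: "\<And>i. i \<in> T \<Longrightarrow> 0 \<le> s i"
    and e: "\<And>i. i \<in> T \<Longrightarrow> e i \<in> hom P K"
    and lim: "\<And>x. x \<in> H \<Longrightarrow> ((\<lambda>i. s i * \<mu> (e i x)) \<longlongrightarrow> N x) F"
  shows "conj_pseudonorm (P\<lparr>carrier := H\<rparr>) N"
proof -
  interpret P: group P by (rule P)
  interpret K: conj_pseudonorm K \<mu> by (rule K)
  interpret H: subgroup H P by (rule H)
  have hom: "group_hom P K (e i)" if "i \<in> T" for i
    using e[OF that] by unfold_locales
  have eq: "N x = N y" if "x \<in> H" "y \<in> H" "\<And>i. i \<in> T \<Longrightarrow> \<mu> (e i x) = \<mu> (e i y)" for x y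
  proof (rule tendsto_unique[OF F lim[OF that(1)]])
    show "((\<lambda>i. s i * \<mu> (e i x)) \<longlongrightarrow> N y) F"
      using lim[OF that(2)] by (rule Lim_transform_eventually) (use T that(3) in \<open>auto elim: eventually_mono\<close>)
  qed
  show ?thesis
  proof (intro conj_pseudonorm.intro conj_pseudonorm_axioms.intro)
    show "group (P\<lparr>carrier := H\<rparr>)" by (rule H.subgroup_is_group[OF P])
    have "((\<lambda>i. s i * \<mu> (e i \<one>\<^bsub>P\<^esub>)) \<longlongrightarrow> 0) F"
      by (rule tendsto_eventually, rule eventually_mono[OF T])
        (simp add: group_hom.hom_one[OF hom])
    then show "N \<one>\<^bsub>P\<lparr>carrier := H\<rparr>\<^esub> = 0" using tendsto_unique[OF F lim[OF H.one_closed]] by simp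
  next
    fix x assume "x \<in> carrier (P\<lparr>carrier := H\<rparr>)"
    then have x: "x \<in> H" by simp
    have "N (inv\<^bsub>P\<^esub> x) = N x"
    proof (rule eq)
      fix i assume "i \<in> T"
      then interpret group_hom P K "e i" by (rule hom)
      show "\<mu> (e i (inv\<^bsub>P\<^esub> x)) = \<mu> (e i x)" using x by simp
    qed (use x in auto)
    then show "N (inv\<^bsub>P\<lparr>carrier := H\<rparr>\<^esub> x) = N x" using x H by simp
    fix h assume "h \<in> carrier (P\<lparr>carrier := H\<rparr>)"
    then have h: "h \<in> H" by simp
    have "N (h \<otimes>\<^bsub>P\<^esub> x \<otimes>\<^bsub>P\<^esub> inv\<^bsub>P\<^esub> h) = N x"
    proof (rule eq)
      fix i assume "i \<in> T"
      then interpret group_hom P K "e i" by (rule hom)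
      show "\<mu> (e i (h \<otimes>\<^bsub>P\<^esub> x \<otimes>\<^bsub>P\<^esub> inv\<^bsub>P\<^esub> h)) = \<mu> (e i x)" using x h by (simp add: K.nu_conj)
    qed (use x h in auto)
    then show "N (h \<otimes>\<^bsub>P\<lparr>carrier := H\<rparr>\<^esub> x \<otimes>\<^bsub>P\<lparr>carrier := H\<rparr>\<^esub> inv\<^bsub>P\<lparr>carrier := H\<rparr>\<^esub> h) = N x" using h H by simp
  next
    fix x y assume "x \<in> carrier (P\<lparr>carrier := H\<rparr>)" "y \<in> carrier (P\<lparr>carrier := H\<rparr>)"
    then have xy: "x \<in> H" "y \<in> H" by auto
    have "N (x \<otimes>\<^bsub>P\<^esub> y) \<le> N x + N y"
    proof (rule tendsto_le[OF F tendsto_add[OF lim[OF xy(1)] lim[OF xy(2)]] lim])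
      show "x \<otimes>\<^bsub>P\<^esub> y \<in> H" using xy by simp
      have "s i * \<mu> (e i (x \<otimes>\<^bsub>P\<^esub> y)) \<le> s i * \<mu> (e i x) + s i * \<mu> (e i y)" if i: "i \<in> T" for i
      proof -
        interpret group_hom P K "e i" using i by (rule hom)
        show ?thesis
          using mult_left_mono[OF K.nu_mult s[OF i], of "e i x" "e i y"] xy by (simp add: distrib_left)
      qed
      then show "\<forall>\<^sub>F i in F. s i * \<mu> (e i (x \<otimes>\<^bsub>P\<^esub> y)) \<le> s i * \<mu> (e i x) + s i * \<mu> (e i y)"
        using T by (auto elim: eventually_mono)
    qed
    then show "N (x \<otimes>\<^bsub>P\<lparr>carrier := H\<rparr>\<^esub> y) \<le> N x + N y" by simp
  qed
qed

lemma image_pseudonorm: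
  assumes H: "conj_pseudonorm H \<mu>" and K: "group K" and f: "f \<in> hom H K"
    and onto: "f ` carrier H = carrier K"
  shows "conj_pseudonorm K (\<lambda>k. Inf {\<mu> h | h. h \<in> carrier H \<and> f h = k})"
proof -
  interpret H: conj_pseudonorm H \<mu> by (rule H)
  interpret K: group K by (rule K)
  interpret f: group_hom H K f using f by unfold_locales
  let ?N = "\<lambda>k. Inf {\<mu> h | h. h \<in> carrier H \<and> f h = k}"
  have le: "?N k \<le> \<mu> h" if "h \<in> carrier H" "f h = k" for h k
    using that H.nu_nonneg by (intro cInf_lower) (auto intro!: bdd_belowI[of _ 0])
  have ge: "b \<le> ?N k" if "k \<in> carrier K" "\<And>h. h \<in> carrier H \<Longrightarrow> f h = k \<Longrightarrow> b \<le> \<mu> h" for b k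
  proof (rule cInf_greatest)
    have "k \<in> f ` carrier H" using that(1) onto by simp
    then show "{\<mu> h | h. h \<in> carrier H \<and> f h = k} \<noteq> {}" by blast
  qed (use that(2) in blast)
  show ?thesis
  proof (intro conj_pseudonorm.intro conj_pseudonorm_axioms.intro)
    show "group K" by (rule K)
    show "?N \<one>\<^bsub>K\<^esub> = 0"
      using le[of "\<one>\<^bsub>H\<^esub>" "\<one>\<^bsub>K\<^esub>"] ge[of "\<one>\<^bsub>K\<^esub>" 0] H.nu_nonneg by fastforce
  next
    have inv: "?N (inv\<^bsub>K\<^esub> x) \<le> ?N x" if "x \<in> carrier K" for x
    proof (rule ge[OF that])
      fix h assume "h \<in> carrier H" "f h = x"
      then show "?N (inv\<^bsub>K\<^esub> x) \<le> \<mu> h" using le[of "inv\<^bsub>H\<^esub> h" "inv\<^bsub>K\<^esub> x"] by simp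
    qed
    show "?N (inv\<^bsub>K\<^esub> x) = ?N x" if "x \<in> carrier K" for x
      using inv[OF that] inv[of "inv\<^bsub>K\<^esub> x"] that by simp
    have conj: "?N (h \<otimes>\<^bsub>K\<^esub> x \<otimes>\<^bsub>K\<^esub> inv\<^bsub>K\<^esub> h) \<le> ?N x" if "h \<in> carrier K" "x \<in> carrier K" for h x
    proof (rule ge[OF that(2)])
      fix y assume y: "y \<in> carrier H" "f y = x"
      have "h \<in> f ` carrier H" using that(1) onto by simp
      then obtain g where g: "g \<in> carrier H" "h = f g" by (rule imageE)
      show "?N (h \<otimes>\<^bsub>K\<^esub> x \<otimes>\<^bsub>K\<^esub> inv\<^bsub>K\<^esub> h) \<le> \<mu> y"
        using le[of "g \<otimes>\<^bsub>H\<^esub> y \<otimes>\<^bsub>H\<^esub> inv\<^bsub>H\<^esub> g" "h \<otimes>\<^bsub>K\<^esub> x \<otimes>\<^bsub>K\<^esub> inv\<^bsub>K\<^esub> h"] y g by (simp add: H.nu_conj)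
    qed
    show "?N (h \<otimes>\<^bsub>K\<^esub> x \<otimes>\<^bsub>K\<^esub> inv\<^bsub>K\<^esub> h) = ?N x" if hx: "h \<in> carrier K" "x \<in> carrier K" for h x
    proof -
      have "inv\<^bsub>K\<^esub> h \<otimes>\<^bsub>K\<^esub> (h \<otimes>\<^bsub>K\<^esub> x \<otimes>\<^bsub>K\<^esub> inv\<^bsub>K\<^esub> h) \<otimes>\<^bsub>K\<^esub> inv\<^bsub>K\<^esub> (inv\<^bsub>K\<^esub> h) = x"
        using hx by (simp add: K.m_assoc) (simp add: K.m_assoc [symmetric])
      then show ?thesis using conj[OF hx] conj[of "inv\<^bsub>K\<^esub> h" "h \<otimes>\<^bsub>K\<^esub> x \<otimes>\<^bsub>K\<^esub> inv\<^bsub>K\<^esub> h"] hx by simp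
    qed
  next
    fix x y assume xy: "x \<in> carrier K" "y \<in> carrier K"
    have "?N (x \<otimes>\<^bsub>K\<^esub> y) - \<mu> h \<le> ?N x" if h: "h \<in> carrier H" "f h = y" for h
    proof (rule ge[OF xy(1)])
      fix g assume "g \<in> carrier H" "f g = x"
      then show "?N (x \<otimes>\<^bsub>K\<^esub> y) - \<mu> h \<le> \<mu> g"
        using le[of "g \<otimes>\<^bsub>H\<^esub> h" "x \<otimes>\<^bsub>K\<^esub> y"] H.nu_mult[of g h] h by simp
    qed
    then have "?N (x \<otimes>\<^bsub>K\<^esub> y) - ?N x \<le> \<mu> h" if "h \<in> carrier H" "f h = y" for h
      using that by (simp add: diff_le_eq add.commute)
    then have "?N (x \<otimes>\<^bsub>K\<^esub> y) - ?N x \<le> ?N y" by (rule ge[OF xy(2)])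
    then show "?N (x \<otimes>\<^bsub>K\<^esub> y) \<le> ?N x + ?N y" by simp
  qed
qed


section \<open>Directional cones\<close>

abbreviation at_inf :: "real set \<Rightarrow> real filter" where "at_inf T \<equiv> inf at_top (principal T)"

lemma eventually_at_inf: "eventually P (at_inf T) \<longleftrightarrow> (\<exists>M. \<forall>t\<in>T. M \<le> t \<longrightarrow> P t)"
  by (auto simp: eventually_inf_principal eventually_at_top_linorder)

lemma scaling_setD:
  assumes "scaling_set T"
  shows "at_inf T \<noteq> bot" "t \<in> T \<Longrightarrow> 0 < t" "\<exists>t\<in>T. M \<le> t"
proof -
  show "t \<in> T \<Longrightarrow> 0 < t" using assms by (auto simp: scaling_set_def)
  show ex: "\<exists>t\<in>T. M \<le> t" for M
    using assms unfolding scaling_set_def bdd_above_def by (meson linear)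
  show "at_inf T \<noteq> bot"
    using ex by (auto simp: trivial_limit_def eventually_at_inf)
qed

lemma restrict_in_PiE: "(\<lambda>t\<in>T. f t) \<in> T \<rightarrow>\<^sub>E B \<longleftrightarrow> (\<forall>t\<in>T. f t \<in> B)"
  by auto

context conj_pseudonorm
begin

interpretation R: conj_pseudonorm "FR G" "FR_norm G \<nu>" by (rule FR_pseudonorm)

abbreviation (input) Dw where "Dw T \<equiv> carrier (dir_words G \<nu> T)"

definition vanishing :: "real set \<Rightarrow> (real \<Rightarrow> real) \<Rightarrow> bool" where
  "vanishing T f \<longleftrightarrow> (\<forall>\<epsilon>>0. \<exists>M. \<forall>t\<in>T. M \<le> t \<longrightarrow> f t < \<epsilon>)"

definition cauchy_on :: "real set \<Rightarrow> (real \<Rightarrow> ('a \<times> real) list) \<Rightarrow> bool" where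
  "cauchy_on T y \<longleftrightarrow> (\<forall>t\<in>T. y t \<in> carrier (FR G)) \<and>
     (\<forall>\<epsilon>>0. \<exists>M. \<forall>t\<in>T. \<forall>t'\<in>T. M \<le> t \<longrightarrow> M \<le> t' \<longrightarrow> R.dst (y t) (y t') < \<epsilon>)"

lemma FZ_FR: "x \<in> carrier (FZ G) \<Longrightarrow> x \<in> carrier (FR G)"
  using FZ_carrier_subset by blast

lemma Dw_iff: "w \<in> Dw T \<longleftrightarrow> w \<in> T \<rightarrow>\<^sub>E carrier (FZ G) \<and> cauchy_on T (\<lambda>t. psi G (1 / t) (w t))"
  by (auto simp: dir_words_def cauchy_on_def PiE_iff FZ_FR psi_closed)

lemma cauchy_on_close:
  assumes y: "cauchy_on T y" and z: "\<And>t. t \<in> T \<Longrightarrow> z t \<in> carrier (FR G)"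
    and "vanishing T (\<lambda>t. R.dst (z t) (y t))"
  shows "cauchy_on T z"
  unfolding cauchy_on_def
proof (intro conjI ballI allI impI z)
  fix \<epsilon> :: real assume "\<epsilon> > 0"
  then have e: "\<epsilon> / 3 > 0" by simp
  obtain M where M: "\<And>t t'. t \<in> T \<Longrightarrow> t' \<in> T \<Longrightarrow> M \<le> t \<Longrightarrow> M \<le> t' \<Longrightarrow> R.dst (y t) (y t') < \<epsilon> / 3"
    using y e unfolding cauchy_on_def by meson
  obtain M' where M': "\<And>t. t \<in> T \<Longrightarrow> M' \<le> t \<Longrightarrow> R.dst (z t) (y t) < \<epsilon> / 3"
    using assms(3) e unfolding vanishing_def by meson
  have yc: "t \<in> T \<Longrightarrow> y t \<in> carrier (FR G)" for t using y unfolding cauchy_on_def by blast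
  show "\<exists>M. \<forall>t\<in>T. \<forall>t'\<in>T. M \<le> t \<longrightarrow> M \<le> t' \<longrightarrow> R.dst (z t) (z t') < \<epsilon>"
  proof (intro exI[of _ "max M M'"] ballI impI)
    fix t t' assume t: "t \<in> T" "t' \<in> T" "max M M' \<le> t" "max M M' \<le> t'"
    show "R.dst (z t) (z t') < \<epsilon>"
      using R.dst_triangle[OF z[OF t(1)] yc[OF t(1)] z[OF t(2)]] R.dst_triangle[OF yc[OF t(1)] yc[OF t(2)] z[OF t(2)]]
        M[OF t(1,2)] M'[OF t(1)] M'[OF t(2)] R.dst_sym[OF yc[OF t(2)] z[OF t(2)]] t(3,4) by auto
  qed
qed

lemma cauchy_on_mult:
  assumes "cauchy_on T y" "cauchy_on T z" shows "cauchy_on T (\<lambda>t. y t \<otimes>\<^bsub>FR G\<^esub> z t)"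
  unfolding cauchy_on_def
proof (intro conjI ballI allI impI)
  have c: "t \<in> T \<Longrightarrow> y t \<in> carrier (FR G)" "t \<in> T \<Longrightarrow> z t \<in> carrier (FR G)" for t
    using assms unfolding cauchy_on_def by auto
  show "t \<in> T \<Longrightarrow> y t \<otimes>\<^bsub>FR G\<^esub> z t \<in> carrier (FR G)" for t using c by simp
  fix \<epsilon> :: real assume "\<epsilon> > 0"
  then have e: "\<epsilon> / 2 > 0" by simp
  obtain M where M: "\<And>t t'. t \<in> T \<Longrightarrow> t' \<in> T \<Longrightarrow> M \<le> t \<Longrightarrow> M \<le> t' \<Longrightarrow> R.dst (y t) (y t') < \<epsilon> / 2"
    using assms(1) e unfolding cauchy_on_def by meson
  obtain M' where M': "\<And>t t'. t \<in> T \<Longrightarrow> t' \<in> T \<Longrightarrow> M' \<le> t \<Longrightarrow> M' \<le> t' \<Longrightarrow> R.dst (z t) (z t') < \<epsilon> / 2"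
    using assms(2) e unfolding cauchy_on_def by meson
  show "\<exists>M. \<forall>t\<in>T. \<forall>t'\<in>T. M \<le> t \<longrightarrow> M \<le> t' \<longrightarrow> R.dst (y t \<otimes>\<^bsub>FR G\<^esub> z t) (y t' \<otimes>\<^bsub>FR G\<^esub> z t') < \<epsilon>"
  proof (intro exI[of _ "max M M'"] ballI impI)
    fix t t' assume t: "t \<in> T" "t' \<in> T" "max M M' \<le> t" "max M M' \<le> t'"
    have "R.dst (y t) (y t') < \<epsilon> / 2" "R.dst (z t) (z t') < \<epsilon> / 2" using M M' t by auto
    then show "R.dst (y t \<otimes>\<^bsub>FR G\<^esub> z t) (y t' \<otimes>\<^bsub>FR G\<^esub> z t') < \<epsilon>"
      using R.dst_mult[OF c(1)[OF t(1)] c(2)[OF t(1)] c(1)[OF t(2)] c(2)[OF t(2)]] by linarith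
  qed
qed

lemma cauchy_on_inv: "cauchy_on T y \<Longrightarrow> cauchy_on T (\<lambda>t. inv\<^bsub>FR G\<^esub> y t)"
  unfolding cauchy_on_def by (simp add: R.dst_inv)

lemma cauchy_on_const: "x \<in> carrier (FR G) \<Longrightarrow> cauchy_on T (\<lambda>t. x)"
  by (simp add: cauchy_on_def)

lemma cauchy_on_subset: "cauchy_on T' y \<Longrightarrow> T \<subseteq> T' \<Longrightarrow> cauchy_on T y"
  unfolding cauchy_on_def by (meson subsetD)

lemma cauchy_on_cong: "(\<And>t. t \<in> T \<Longrightarrow> y t = z t) \<Longrightarrow> cauchy_on T y \<longleftrightarrow> cauchy_on T z"
  by (simp add: cauchy_on_def)

lemma psi_mult: "x \<in> carrier (FR G) \<Longrightarrow> y \<in> carrier (FR G) \<Longrightarrow> psi G t (x \<otimes>\<^bsub>FR G\<^esub> y) = psi G t x \<otimes>\<^bsub>FR G\<^esub> psi G t y"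
  by (rule hom_mult[OF psi_hom])

lemma psi_inv: "x \<in> carrier (FR G) \<Longrightarrow> psi G t (inv\<^bsub>FR G\<^esub> x) = inv\<^bsub>FR G\<^esub> psi G t x"
  using group_hom.hom_inv[of "FR G" "FR G" "psi G t" x] psi_hom[of G t] R.group_axioms
  by (simp add: group_hom_def group_hom_axioms_def)

lemma dst_psi:
  "x \<in> carrier (FR G) \<Longrightarrow> y \<in> carrier (FR G) \<Longrightarrow> 0 < t \<Longrightarrow> R.dst (psi G t x) (psi G t y) = t * R.dst x y"
  using FR_norm_psi[of "inv\<^bsub>FR G\<^esub> x \<otimes>\<^bsub>FR G\<^esub> y" t] by (simp add: norm_dist_def psi_mult psi_inv)

lemma psi_cancel: "x \<in> carrier (FR G) \<Longrightarrow> 0 < t \<Longrightarrow> psi G t (psi G (1 / t) x) = x"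
  by (simp add: psi_psi psi_one)

lemma Dw_subgroup: "subgroup (Dw T) (product_group T (\<lambda>_. FZ G))"
proof -
  interpret P: group "product_group T (\<lambda>_. FZ G)" by (simp add: FZ_group)
  show ?thesis
  proof (rule P.subgroupI)
    show "Dw T \<subseteq> carrier (product_group T (\<lambda>_. FZ G))" by (auto simp: Dw_iff)
    have "(\<lambda>t\<in>T. \<one>\<^bsub>FR G\<^esub>) \<in> Dw T"
      unfolding Dw_iff restrict_in_PiE
      using group_hom.hom_one[of "FR G" "FR G" "psi G _"] psi_hom[of G] R.group_axioms
      by (auto simp: FZ_closed(3) cauchy_on_def group_hom_def group_hom_axioms_def)
    then show "Dw T \<noteq> {}" by blast
  next
    fix w assume w: "w \<in> Dw T"
    then have wp: "w \<in> T \<rightarrow>\<^sub>E carrier (FZ G)" and wt: "\<And>t. t \<in> T \<Longrightarrow> w t \<in> carrier (FZ G)" by (auto simp: Dw_iff)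
    have "inv\<^bsub>product_group T (\<lambda>_. FZ G)\<^esub> w = (\<lambda>t\<in>T. inv\<^bsub>FR G\<^esub> w t)"
      using inv_product_group[OF wp FZ_group] wt by (auto simp: FZ_inv)
    moreover have "(\<lambda>t\<in>T. inv\<^bsub>FR G\<^esub> w t) \<in> Dw T"
      unfolding Dw_iff restrict_in_PiE
      using cauchy_on_inv[of T "\<lambda>t. psi G (1 / t) (w t)"] w wt
      by (auto simp: FZ_closed(2) Dw_iff psi_inv FZ_FR cong: cauchy_on_cong)
    ultimately show "inv\<^bsub>product_group T (\<lambda>_. FZ G)\<^esub> w \<in> Dw T" by simp
  next
    fix v w assume vw: "v \<in> Dw T" "w \<in> Dw T"
    then have t: "\<And>t. t \<in> T \<Longrightarrow> v t \<in> carrier (FZ G)" "\<And>t. t \<in> T \<Longrightarrow> w t \<in> carrier (FZ G)" by (auto simp: Dw_iff)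
    have "(\<lambda>t\<in>T. v t \<otimes>\<^bsub>FR G\<^esub> w t) \<in> Dw T"
      unfolding Dw_iff restrict_in_PiE
      using cauchy_on_mult[of T "\<lambda>t. psi G (1 / t) (v t)" "\<lambda>t. psi G (1 / t) (w t)"] vw t
      by (auto simp: FZ_closed(1) Dw_iff psi_mult FZ_FR cong: cauchy_on_cong)
    then show "v \<otimes>\<^bsub>product_group T (\<lambda>_. FZ G)\<^esub> w \<in> Dw T" by (simp add: FZ_mult)
  qed
qed

lemma dir_words_eq: "dir_words G \<nu> T = (product_group T (\<lambda>_. FZ G))\<lparr>carrier := Dw T\<rparr>"
  by (simp add: dir_words_def)

lemma dir_words_mult: "v \<otimes>\<^bsub>dir_words G \<nu> T\<^esub> w = (\<lambda>t\<in>T. v t \<otimes>\<^bsub>FR G\<^esub> w t)"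
  by (simp add: dir_words_def FZ_mult)

lemma dir_words_norm_tendsto:
  assumes T: "scaling_set T" and w: "w \<in> Dw T"
  shows "((\<lambda>t. FR_norm G \<nu> (psi G (1 / t) (w t))) \<longlongrightarrow> dir_words_norm G \<nu> T w) (at_inf T)"
proof -
  let ?f = "\<lambda>t. FR_norm G \<nu> (psi G (1 / t) (w t))"
  note F = scaling_setD(1)[OF T]
  have c: "cauchy_on T (\<lambda>t. psi G (1 / t) (w t))" using w by (simp add: Dw_iff)
  have "cauchy_filter (filtermap ?f (at_inf T))"
    unfolding cauchy_filter_metric_filtermap
  proof (intro allI impI)
    fix e :: real assume "0 < e"
    then obtain M where M: "\<And>t t'. t \<in> T \<Longrightarrow> t' \<in> T \<Longrightarrow> M \<le> t \<Longrightarrow> M \<le> t' \<Longrightarrow>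
        R.dst (psi G (1 / t) (w t)) (psi G (1 / t') (w t')) < e"
      using c unfolding cauchy_on_def by meson
    have yc: "t \<in> T \<Longrightarrow> psi G (1 / t) (w t) \<in> carrier (FR G)" for t using c unfolding cauchy_on_def by blast
    have "dist (?f t) (?f t') < e" if "t \<in> T \<and> M \<le> t" "t' \<in> T \<and> M \<le> t'" for t t'
      using R.nu_diff_le[OF yc yc, of t t'] M[of t t'] that by (simp add: dist_real_def)
    moreover have "eventually (\<lambda>t. t \<in> T \<and> M \<le> t) (at_inf T)" by (auto simp: eventually_at_inf)
    ultimately show "\<exists>P. eventually P (at_inf T) \<and> (\<forall>x y. P x \<and> P y \<longrightarrow> dist (?f x) (?f y) < e)" by blast
  qed
  moreover have "filtermap ?f (at_inf T) \<noteq> bot" using F by (simp add: filtermap_bot_iff)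
  ultimately obtain l where "filtermap ?f (at_inf T) \<le> nhds l"
    using cauchy_filter_complete_converges[of "filtermap ?f (at_inf T)" UNIV] complete_UNIV by auto
  then have "(?f \<longlongrightarrow> l) (at_inf T)" by (simp add: filterlim_def)
  with tendsto_Lim[OF F this] show ?thesis by (simp add: dir_words_norm_def)
qed

lemma dir_words_pseudonorm:
  assumes T: "scaling_set T"
  shows "conj_pseudonorm (dir_words G \<nu> T) (dir_words_norm G \<nu> T)"
proof (subst dir_words_eq, rule limit_pseudonorm[OF _ Dw_subgroup scaling_setD(1)[OF T] FR_pseudonorm])
  show "group (product_group T (\<lambda>_. FZ G))" by (simp add: FZ_group)
  show "\<forall>\<^sub>F t in at_inf T. t \<in> T" by (auto simp: eventually_at_inf)
  show "t \<in> T \<Longrightarrow> 0 \<le> 1 / t" for t using scaling_setD(2)[OF T] by (simp add: less_imp_le)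
  show "t \<in> T \<Longrightarrow> (\<lambda>w. w t) \<in> hom (product_group T (\<lambda>_. FZ G)) (FR G)" for t
    by (rule homI) (auto simp: FZ_mult intro!: FZ_FR dest: PiE_mem)
  fix w assume w: "w \<in> Dw T"
  show "((\<lambda>t. 1 / t * FR_norm G \<nu> (w t)) \<longlongrightarrow> dir_words_norm G \<nu> T w) (at_inf T)"
  proof (rule Lim_transform_eventually[OF dir_words_norm_tendsto[OF T w]])
    have "FR_norm G \<nu> (psi G (1 / t) (w t)) = 1 / t * FR_norm G \<nu> (w t)" if "t \<in> T" for t
    proof -
      have "w t \<in> carrier (FZ G)" using w that by (auto simp: Dw_iff)
      from FR_norm_psi[OF FZ_FR[OF this], of "1 / t"] show ?thesis using scaling_setD(2)[OF T that] by simp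
    qed
    then show "\<forall>\<^sub>F t in at_inf T. FR_norm G \<nu> (psi G (1 / t) (w t)) = 1 / t * FR_norm G \<nu> (w t)"
      by (auto simp: eventually_at_inf)
  qed
qed

abbreviation (input) pr where "pr T w \<equiv> restrict (proj G \<circ> w) T"

lemma pr_hom: "pr T \<in> hom (dir_words G \<nu> T) (product_group T (\<lambda>_. G))"
proof (rule homI)
  fix v w assume "v \<in> Dw T" "w \<in> Dw T"
  then have t: "\<And>t. t \<in> T \<Longrightarrow> v t \<in> carrier (FZ G)" "\<And>t. t \<in> T \<Longrightarrow> w t \<in> carrier (FZ G)" by (auto simp: Dw_iff)
  then show "pr T v \<in> carrier (product_group T (\<lambda>_. G))" by (auto simp: proj_closed)
  show "pr T (v \<otimes>\<^bsub>dir_words G \<nu> T\<^esub> w) = pr T v \<otimes>\<^bsub>product_group T (\<lambda>_. G)\<^esub> pr T w"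
    using t by (auto simp: dir_words_mult proj_mult)
qed

lemma dir_group_eq: "dir_group G \<nu> T = (product_group T (\<lambda>_. G))\<lparr>carrier := pr T ` Dw T\<rparr>"
  by (simp add: dir_group_def)

lemma dir_group_subgroup:
  assumes T: "scaling_set T" shows "subgroup (carrier (dir_group G \<nu> T)) (product_group T (\<lambda>_. G))"
proof -
  interpret D: conj_pseudonorm "dir_words G \<nu> T" "dir_words_norm G \<nu> T" by (rule dir_words_pseudonorm[OF T])
  interpret P: group "product_group T (\<lambda>_. G)" by (simp add: group_axioms)
  interpret h: group_hom "dir_words G \<nu> T" "product_group T (\<lambda>_. G)" "pr T" using pr_hom by unfold_locales
  show ?thesis using h.img_is_subgroup by (simp add: dir_group_eq)
qed

lemma pr_hom': "pr T \<in> hom (dir_words G \<nu> T) (dir_group G \<nu> T)"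
  using pr_hom[of T] by (auto simp: hom_def dir_group_eq)

lemma dir_group_pseudonorm:
  assumes T: "scaling_set T"
  shows "conj_pseudonorm (dir_group G \<nu> T) (dir_norm G \<nu> T)"
proof -
  have eq: "dir_norm G \<nu> T = (\<lambda>k. Inf {dir_words_norm G \<nu> T h | h. h \<in> Dw T \<and> pr T h = k})"
    by (simp add: dir_norm_def fun_eq_iff)
  have "group ((product_group T (\<lambda>_. G))\<lparr>carrier := carrier (dir_group G \<nu> T)\<rparr>)"
    using subgroup.subgroup_is_group[OF dir_group_subgroup[OF T]] by (simp add: group_axioms)
  then have "group (dir_group G \<nu> T)" by (simp add: dir_group_eq)
  then show ?thesis
    unfolding eq by (rule image_pseudonorm[OF dir_words_pseudonorm[OF T] _ pr_hom']) (simp add: dir_group_eq)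
qed

lemma dir_norm_le:
  assumes T: "scaling_set T" and w: "w \<in> Dw T"
  shows "dir_norm G \<nu> T (pr T w) \<le> dir_words_norm G \<nu> T w"
proof -
  interpret D: conj_pseudonorm "dir_words G \<nu> T" "dir_words_norm G \<nu> T" by (rule dir_words_pseudonorm[OF T])
  show ?thesis unfolding dir_norm_def using w D.nu_nonneg
    by (intro cInf_lower) (auto intro!: bdd_belowI[of _ 0])
qed

lemma dir_norm_greatest:
  assumes "g \<in> carrier (dir_group G \<nu> T)" "\<And>w. w \<in> Dw T \<Longrightarrow> pr T w = g \<Longrightarrow> b \<le> dir_words_norm G \<nu> T w"
  shows "b \<le> dir_norm G \<nu> T g"
  unfolding dir_norm_def using assms by (intro cInf_greatest) (auto simp: dir_group_eq)

lemma dir_words_norm_le: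
  assumes T: "scaling_set T" and w: "w \<in> Dw T"
    and b: "\<And>t. t \<in> T \<Longrightarrow> M \<le> t \<Longrightarrow> FR_norm G \<nu> (psi G (1 / t) (w t)) \<le> b"
  shows "dir_words_norm G \<nu> T w \<le> b"
  by (rule tendsto_upperbound[OF dir_words_norm_tendsto[OF T w] _ scaling_setD(1)[OF T]])
    (use b in \<open>auto simp: eventually_at_inf\<close>)


subsection \<open>Sublinear projections\<close>

text \<open>Let \<open>x\<close> be a value of the rescaled word, within \<open>\<epsilon>\<close> of all later ones, and let \<open>\<Lambda>\<close> straighten \<open>x\<close>.
  For a much later value \<open>Y\<close> the projections of its multiples grow at rate at most \<open>2\<eta>\<close>, because
  rounding \<open>t Y\<close> gives almost \<open>w(t)\<close>. So \<open>\<Lambda> Y\<close> has norm of order \<open>\<eta>\<close>, and \<open>\<Lambda> x\<close> has norm at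
  most \<open>2\<epsilon>\<close>, since \<open>\<eta>\<close> is arbitrary while \<open>\<Lambda>\<close> and \<open>K\<close> are fixed. Replacing in \<open>w\<close> the rounded
  multiples of \<open>x\<close> by those of \<open>\<Lambda> x\<close> does not change the projection and leaves a word of norm at most
  \<open>4\<epsilon>\<close>.\<close>

lemma sublinear_imp_null:
  assumes T: "scaling_set T" and w: "w \<in> Dw T"
    and straight: "\<And>x. x \<in> carrier (FR G) \<Longrightarrow> \<exists>\<Lambda> K. straightens \<Lambda> K x"
    and small: "\<And>\<epsilon> M. 0 < \<epsilon> \<Longrightarrow> \<exists>t\<in>T. M \<le> t \<and> \<nu> (proj G (w t)) < \<epsilon> * t"
  shows "dir_norm G \<nu> T (pr T w) = 0"
proof -
  interpret Q: conj_pseudonorm "dir_group G \<nu> T" "dir_norm G \<nu> T" by (rule dir_group_pseudonorm[OF T])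
  have wt: "w t \<in> carrier (FZ G)" if "t \<in> T" for t using w that by (auto simp: Dw_iff)
  note pos = scaling_setD(2)[OF T]
  let ?y = "\<lambda>t. psi G (1 / t) (w t)"
  have yc: "?y t \<in> carrier (FR G)" if "t \<in> T" for t using wt[OF that] by (simp add: FZ_FR psi_closed)
  have cau: "\<exists>M. \<forall>t\<in>T. \<forall>t'\<in>T. M \<le> t \<longrightarrow> M \<le> t' \<longrightarrow> R.dst (?y t) (?y t') < \<epsilon>" if "0 < \<epsilon>" for \<epsilon>
    using w that unfolding Dw_iff cauchy_on_def by blast
  have flc: "floor_word G t y \<in> carrier (FZ G)" "floor_word G t y \<in> carrier (FR G)" if "y \<in> carrier (FR G)" for t y
    using floor_word_FZ(1)[OF that] FZ_FR by auto
  have "dir_norm G \<nu> T (pr T w) \<le> 4 * \<epsilon>" if \<epsilon>: "0 < \<epsilon>" for \<epsilon>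
  proof -
    obtain M0 where M0: "\<And>t t'. t \<in> T \<Longrightarrow> t' \<in> T \<Longrightarrow> M0 \<le> t \<Longrightarrow> M0 \<le> t' \<Longrightarrow> R.dst (?y t) (?y t') < \<epsilon>"
      using cau[OF \<epsilon>] by blast
    obtain t0 where t0: "t0 \<in> T" "M0 \<le> t0" using scaling_setD(3)[OF T] by blast
    define x where "x = ?y t0"
    have x: "x \<in> carrier (FR G)" using yc[OF t0(1)] by (simp add: x_def)
    obtain \<Lambda> K where L: "straightens \<Lambda> K x" using straight[OF x] by blast
    then have hom: "\<Lambda> \<in> hom (FR G) (FR G)" and K: "0 \<le> K"
      and lip: "\<And>y. y \<in> carrier (FR G) \<Longrightarrow> FR_norm G \<nu> (\<Lambda> y) \<le> 2 * FR_norm G \<nu> y"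
      and est: "\<And>y. y \<in> carrier (FR G) \<Longrightarrow> \<exists>B. \<forall>t>0. t * FR_norm G \<nu> (\<Lambda> y) \<le> K * \<nu> (proj G (floor_word G t y)) + B"
      unfolding straightens_def by auto
    obtain w1 B1 where w1: "\<And>t. 0 < t \<Longrightarrow> w1 t \<in> carrier (FZ G)" "\<And>t. 0 < t \<Longrightarrow> proj G (w1 t) = proj G (floor_word G t x)"
      "\<And>t. 0 < t \<Longrightarrow> R.dst (w1 t) (psi G t (\<Lambda> x)) \<le> B1"
      using L unfolding straightens_def by blast
    interpret L: group_hom "FR G" "FR G" \<Lambda> using hom by unfold_locales
    have lip_dst: "R.dst (\<Lambda> y) (\<Lambda> z) \<le> 2 * R.dst y z" if "y \<in> carrier (FR G)" "z \<in> carrier (FR G)" for y z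
      using lip[of "inv\<^bsub>FR G\<^esub> y \<otimes>\<^bsub>FR G\<^esub> z"] that by (simp add: norm_dist_def)
    have bound: "FR_norm G \<nu> (\<Lambda> x) \<le> 2 * \<epsilon> + (2 * K + 1) * \<eta>" if \<eta>: "0 < \<eta>" for \<eta>
    proof -
      obtain M1 where M1: "\<And>t t'. t \<in> T \<Longrightarrow> t' \<in> T \<Longrightarrow> M1 \<le> t \<Longrightarrow> M1 \<le> t' \<Longrightarrow> R.dst (?y t) (?y t') < \<eta>"
        using cau[OF \<eta>] by blast
      obtain t1 where t1: "t1 \<in> T" "max M0 M1 \<le> t1" using scaling_setD(3)[OF T] by blast
      define Y where "Y = ?y t1"
      have Y: "Y \<in> carrier (FR G)" using yc[OF t1(1)] by (simp add: Y_def)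
      obtain B where B: "\<And>t. 0 < t \<Longrightarrow> t * FR_norm G \<nu> (\<Lambda> Y) \<le> K * \<nu> (proj G (floor_word G t Y)) + B"
        using est[OF Y] by blast
      define B0 where "B0 = (\<Sum>y\<leftarrow>Y. \<nu> (fst y))"
      \<comment> \<open>The second lower bound for \<open>t\<close> makes the additive constants at most \<open>\<eta> t\<close>.\<close>
      obtain t where t: "t \<in> T" "max M1 ((K * B0 + B) / \<eta>) \<le> t" "\<nu> (proj G (w t)) < \<eta> * t"
        using small[OF \<eta>] by blast
      have tp: "0 < t" by (rule pos[OF t(1)])
      have "R.dst (psi G t Y) (w t) = t * R.dst Y (?y t)"
        using dst_psi[OF Y yc[OF t(1)] tp] psi_cancel[OF FZ_FR[OF wt[OF t(1)]] tp] by simp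
      also have "\<dots> \<le> t * \<eta>"
        using M1[OF t1(1) t(1)] t1(2) t(2) tp by (intro mult_left_mono) (auto simp: Y_def)
      finally have "R.dst (floor_word G t Y) (w t) \<le> B0 + t * \<eta>"
        using dst_floor_word_psi[OF Y, of t, folded B0_def]
          R.dst_triangle[OF flc(2)[OF Y, of t] psi_closed[OF Y, of t] FZ_FR[OF wt[OF t(1)]]] by simp
      moreover have "\<nu> (proj G (floor_word G t Y)) \<le> \<nu> (proj G (w t)) + R.dst (floor_word G t Y) (w t)"
      proof -
        have "dst (proj G (floor_word G t Y)) (proj G (w t)) = \<nu> (proj G (inv\<^bsub>FR G\<^esub> floor_word G t Y \<otimes>\<^bsub>FR G\<^esub> w t))"
          using flc(1)[OF Y, of t] wt[OF t(1)] by (simp add: norm_dist_def proj_mult proj_inv FZ_closed)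
        also have "\<dots> \<le> FR_norm G \<nu> (inv\<^bsub>FR G\<^esub> floor_word G t Y \<otimes>\<^bsub>FR G\<^esub> w t)"
          using flc(1)[OF Y, of t] wt[OF t(1)] by (intro nu_proj_le FZ_closed)
        also have "\<dots> = R.dst (floor_word G t Y) (w t)" by (simp add: norm_dist_def)
        finally show ?thesis
          using nu_le_dst[OF proj_closed[OF flc(1)[OF Y, of t]] proj_closed[OF wt[OF t(1)]]] by simp
      qed
      ultimately have "\<nu> (proj G (floor_word G t Y)) \<le> 2 * (\<eta> * t) + B0" using t(3) by (simp add: mult.commute)
      then have "K * \<nu> (proj G (floor_word G t Y)) \<le> K * (2 * (\<eta> * t) + B0)" using K by (intro mult_left_mono) auto
      then have "t * FR_norm G \<nu> (\<Lambda> Y) \<le> K * (2 * (\<eta> * t) + B0) + B" using B[OF tp] by linarith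
      also have "\<dots> = t * (2 * K * \<eta>) + (K * B0 + B)" by (simp add: algebra_simps)
      also have "K * B0 + B \<le> t * \<eta>" using t(2) \<eta> by (simp add: field_simps)
      finally have "t * FR_norm G \<nu> (\<Lambda> Y) \<le> t * (2 * K * \<eta> + \<eta>)" by (simp add: algebra_simps)
      then have "FR_norm G \<nu> (\<Lambda> Y) \<le> 2 * K * \<eta> + \<eta>" using tp by simp
      moreover have "R.dst x Y < \<epsilon>" using M0[OF t0(1) t1(1)] t0 t1 by (simp add: x_def Y_def)
      then have "R.dst (\<Lambda> x) (\<Lambda> Y) \<le> 2 * \<epsilon>" using lip_dst[OF x Y] by simp
      moreover have "FR_norm G \<nu> (\<Lambda> x) \<le> FR_norm G \<nu> (\<Lambda> Y) + R.dst (\<Lambda> x) (\<Lambda> Y)"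
        using x Y by (intro R.nu_le_dst L.hom_closed)
      ultimately show ?thesis by (simp add: algebra_simps)
    qed
    have Lx: "FR_norm G \<nu> (\<Lambda> x) \<le> 2 * \<epsilon>"
    proof (rule field_le_epsilon)
      fix e :: real assume "0 < e"
      then have "0 < e / (2 * K + 1)" using K by (intro divide_pos_pos) auto
      from bound[OF this] show "FR_norm G \<nu> (\<Lambda> x) \<le> 2 * \<epsilon> + e" using K by simp
    qed
    define B0 where "B0 = (\<Sum>y\<leftarrow>x. \<nu> (fst y))"
    have cl: "psi G (1 / t) (floor_word G t x) \<in> carrier (FR G)" "psi G (1 / t) (w1 t) \<in> carrier (FR G)"
      "w1 t \<in> carrier (FR G)" if "0 < t" for t
      using w1(1)[OF that] flc[OF x] by (auto simp: psi_closed FZ_FR)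
    have Lc: "\<Lambda> x \<in> carrier (FR G)" using x by simp
    define v where "v = (\<lambda>t\<in>T. w t \<otimes>\<^bsub>FR G\<^esub> inv\<^bsub>FR G\<^esub> floor_word G t x \<otimes>\<^bsub>FR G\<^esub> w1 t)"
    let ?Y = "\<lambda>t. ?y t \<otimes>\<^bsub>FR G\<^esub> inv\<^bsub>FR G\<^esub> x \<otimes>\<^bsub>FR G\<^esub> \<Lambda> x"
    have vFZ: "v t \<in> carrier (FZ G)" if "t \<in> T" for t
      using that wt[OF that] flc(1)[OF x] w1(1)[OF pos[OF that]] by (simp add: v_def FZ_closed)
    have prv: "pr T v = pr T w"
    proof (rule restrict_ext)
      fix t assume t: "t \<in> T"
      show "(proj G \<circ> v) t = (proj G \<circ> w) t"
        using t wt[OF t] flc(1)[OF x, of t] w1(1,2)[OF pos[OF t]]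
        by (simp add: v_def proj_mult proj_inv FZ_closed proj_closed m_assoc)
    qed
    have close: "R.dst (psi G (1 / t) (v t)) (?Y t) \<le> (B0 + B1) / t" if t: "t \<in> T" for t
    proof -
      note tp = pos[OF t]
      have sc: "R.dst (psi G (1 / t) z) z' \<le> B / t" if "z \<in> carrier (FR G)" "z' \<in> carrier (FR G)" "R.dst z (psi G t z') \<le> B" for z z' B
      proof -
        have "R.dst (psi G (1 / t) z) z' = R.dst (psi G (1 / t) z) (psi G (1 / t) (psi G t z'))"
          using that tp psi_cancel[of z' "1 / t"] by simp
        also have "\<dots> = 1 / t * R.dst z (psi G t z')" using that tp by (intro dst_psi) (auto simp: psi_closed)
        finally show ?thesis using that(3) tp by (simp add: divide_right_mono)
      qed
      have a: "R.dst (psi G (1 / t) (floor_word G t x)) x \<le> B0 / t"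
        using flc(2)[OF x] x dst_floor_word_psi[OF x, of t] by (intro sc) (auto simp: B0_def)
      have b: "R.dst (psi G (1 / t) (w1 t)) (\<Lambda> x) \<le> B1 / t"
        using cl(3)[OF tp] Lc w1(3)[OF tp] by (intro sc)
      have e1: "psi G (1 / t) (v t) = ?y t \<otimes>\<^bsub>FR G\<^esub> inv\<^bsub>FR G\<^esub> psi G (1 / t) (floor_word G t x) \<otimes>\<^bsub>FR G\<^esub> psi G (1 / t) (w1 t)"
        using t FZ_FR[OF wt[OF t]] flc(2)[OF x, of t] cl(3)[OF tp] by (simp add: v_def psi_mult psi_inv)
      have e2: "R.dst (?y t \<otimes>\<^bsub>FR G\<^esub> inv\<^bsub>FR G\<^esub> psi G (1 / t) (floor_word G t x) \<otimes>\<^bsub>FR G\<^esub> psi G (1 / t) (w1 t)) (?Y t) \<le> R.dst (?y t \<otimes>\<^bsub>FR G\<^esub> inv\<^bsub>FR G\<^esub> psi G (1 / t) (floor_word G t x)) (?y t \<otimes>\<^bsub>FR G\<^esub> inv\<^bsub>FR G\<^esub> x)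
          + R.dst (psi G (1 / t) (w1 t)) (\<Lambda> x)"
        using yc[OF t] cl[OF tp] x Lc by (intro R.dst_mult) auto
      have "R.dst (?y t \<otimes>\<^bsub>FR G\<^esub> inv\<^bsub>FR G\<^esub> psi G (1 / t) (floor_word G t x)) (?y t \<otimes>\<^bsub>FR G\<^esub> inv\<^bsub>FR G\<^esub> x)
          \<le> R.dst (?y t) (?y t) + R.dst (inv\<^bsub>FR G\<^esub> psi G (1 / t) (floor_word G t x)) (inv\<^bsub>FR G\<^esub> x)"
        using yc[OF t] cl[OF tp] x by (intro R.dst_mult) auto
      also have "\<dots> = R.dst (psi G (1 / t) (floor_word G t x)) x" using yc[OF t] cl(1)[OF tp] x by (simp add: R.dst_inv)
      finally show ?thesis using a b e2 unfolding e1 add_divide_distrib by linarith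
    qed
    have eventually_small: "\<exists>M. \<forall>t\<in>T. M \<le> t \<longrightarrow> (B0 + B1) / t < e" if "0 < e" for e
    proof (intro exI[of _ "(\<bar>B0 + B1\<bar> + 1) / e"] ballI impI)
      fix t assume t: "t \<in> T" "(\<bar>B0 + B1\<bar> + 1) / e \<le> t"
      then have "\<bar>B0 + B1\<bar> + 1 \<le> t * e" using that by (simp add: field_simps)
      then show "(B0 + B1) / t < e" using pos[OF t(1)] by (simp add: field_simps)
    qed
    have "cauchy_on T (\<lambda>t. psi G (1 / t) (v t))"
    proof (rule cauchy_on_close)
      show "cauchy_on T ?Y"
        using w x by (intro cauchy_on_mult cauchy_on_const) (auto simp: Dw_iff)
      show "psi G (1 / t) (v t) \<in> carrier (FR G)" if "t \<in> T" for t
        using vFZ[OF that] by (simp add: FZ_FR psi_closed)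
      show "vanishing T (\<lambda>t. R.dst (psi G (1 / t) (v t)) (?Y t))"
        unfolding vanishing_def
      proof (intro allI impI)
        fix e :: real assume "0 < e"
        then obtain M where "\<And>t. t \<in> T \<Longrightarrow> M \<le> t \<Longrightarrow> (B0 + B1) / t < e" using eventually_small by blast
        then show "\<exists>M. \<forall>t\<in>T. M \<le> t \<longrightarrow> R.dst (psi G (1 / t) (v t)) (?Y t) < e"
          using close by (meson le_less_trans)
      qed
    qed
    then have vD: "v \<in> Dw T"
      unfolding Dw_iff using vFZ by (auto simp: v_def)
    obtain M2 where M2: "\<And>t. t \<in> T \<Longrightarrow> M2 \<le> t \<Longrightarrow> (B0 + B1) / t < \<epsilon>" using eventually_small[OF \<epsilon>] by blast
    have "dir_words_norm G \<nu> T v \<le> 4 * \<epsilon>"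
    proof (rule dir_words_norm_le[OF T vD])
      fix t assume t: "t \<in> T" "max M0 M2 \<le> t"
      have Yc: "?Y t \<in> carrier (FR G)" using yc[OF t(1)] x Lc by simp
      have "FR_norm G \<nu> (?y t \<otimes>\<^bsub>FR G\<^esub> inv\<^bsub>FR G\<^esub> x) < \<epsilon>"
        using M0[OF t(1) t0(1)] t t0 R.dst_alt[OF yc[OF t(1)] x] by (simp add: x_def)
      then have "FR_norm G \<nu> (?Y t) \<le> 3 * \<epsilon>"
        using R.nu_mult[of "?y t \<otimes>\<^bsub>FR G\<^esub> inv\<^bsub>FR G\<^esub> x" "\<Lambda> x"] Lx yc[OF t(1)] x Lc by simp
      then show "FR_norm G \<nu> (psi G (1 / t) (v t)) \<le> 4 * \<epsilon>"
        using R.nu_le_dst[OF psi_closed[OF FZ_FR[OF vFZ[OF t(1)]]] Yc, of "1 / t"] close[OF t(1)] M2[OF t(1)] t(2) by simp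
    qed
    then show ?thesis using dir_norm_le[OF T vD] unfolding prv by linarith
  qed
  then have "dir_norm G \<nu> T (pr T w) \<le> 0 + e" if "0 < e" for e
    using that by (metis add_0 mult.commute nonzero_divide_eq_eq zero_less_divide_iff zero_less_numeral zero_neq_numeral)
  then have "dir_norm G \<nu> T (pr T w) \<le> 0" by (rule field_le_epsilon)
  moreover have "pr T w \<in> carrier (dir_group G \<nu> T)" using w by (simp add: dir_group_eq)
  ultimately show ?thesis using Q.nu_nonneg by force
qed

end


section \<open>Independence of scaling\<close>

context conj_pseudonorm
begin

interpretation R: conj_pseudonorm "FR G" "FR_norm G \<nu>" by (rule FR_pseudonorm)

lemma Dw_restrict:
  assumes "w \<in> Dw T'" "T \<subseteq> T'" shows "restrict w T \<in> Dw T"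
proof -
  have "cauchy_on T (\<lambda>t. psi G (1 / t) (w t))"
    using assms cauchy_on_subset by (auto simp: Dw_iff)
  moreover have "\<forall>t\<in>T. w t \<in> carrier (FZ G)" using assms by (auto simp: Dw_iff)
  ultimately show ?thesis
    unfolding Dw_iff restrict_in_PiE by (simp cong: cauchy_on_cong)
qed

lemma dir_words_norm_restrict:
  assumes T: "scaling_set T" and T': "scaling_set T'" and sub: "T \<subseteq> T'" and w: "w \<in> Dw T'"
  shows "dir_words_norm G \<nu> T (restrict w T) = dir_words_norm G \<nu> T' w"
proof (rule tendsto_unique[OF scaling_setD(1)[OF T]])
  show "((\<lambda>t. FR_norm G \<nu> (psi G (1 / t) (restrict w T t))) \<longlongrightarrow> dir_words_norm G \<nu> T (restrict w T)) (at_inf T)"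
    by (rule dir_words_norm_tendsto[OF T Dw_restrict[OF w sub]])
  have "at_inf T \<le> at_inf T'" using sub by (intro inf_mono) auto
  from tendsto_mono[OF this dir_words_norm_tendsto[OF T' w]]
  show "((\<lambda>t. FR_norm G \<nu> (psi G (1 / t) (restrict w T t))) \<longlongrightarrow> dir_words_norm G \<nu> T' w) (at_inf T)"
    by (rule Lim_transform_eventually) (auto simp: eventually_at_inf)
qed

lemma pr_restrict: "T \<subseteq> T' \<Longrightarrow> restrict (pr T' w) T = pr T (restrict w T)"
  by (auto simp: fun_eq_iff restrict_def)

text \<open>The values at new points are roundings of multiples of the values \<open>x n\<close> of the given word at the
  points \<open>s n\<close>. Every fixed \<open>x n\<close> can be rounded well once \<open>t\<close> is large, so at \<open>t\<close> one takes the largest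
  \<open>n\<close> up to \<open>t\<close> for which this works; this \<open>n\<close> tends to infinity with \<open>t\<close>.\<close>

lemma Dw_extend:
  assumes T: "scaling_set T" and T': "scaling_set T'" and sub: "T \<subseteq> T'" and v: "v \<in> Dw T"
  shows "\<exists>v'\<in>Dw T'. restrict v' T = v"
proof -
  let ?y = "\<lambda>t. psi G (1 / t) (v t)"
  have c: "cauchy_on T ?y" and vt: "\<And>t. t \<in> T \<Longrightarrow> v t \<in> carrier (FZ G)" and vE: "v \<in> extensional T"
    using v by (auto simp: Dw_iff PiE_iff)
  have "\<exists>M. \<forall>t\<in>T. \<forall>t'\<in>T. M \<le> t \<longrightarrow> M \<le> t' \<longrightarrow> R.dst (?y t) (?y t') < 1 / real (Suc n)" for n
    using c unfolding cauchy_on_def by simp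
  then obtain M where M: "\<And>n t t'. t \<in> T \<Longrightarrow> t' \<in> T \<Longrightarrow> M n \<le> t \<Longrightarrow> M n \<le> t' \<Longrightarrow> R.dst (?y t) (?y t') < 1 / real (Suc n)"
    by metis
  have "\<exists>t\<in>T. \<forall>j\<le>n. M j \<le> t" for n
  proof -
    obtain t where t: "t \<in> T" "Max (M ` {..n}) \<le> t" using scaling_setD(3)[OF T] by blast
    have "M j \<le> t" if "j \<le> n" for j using Max_ge[of "M ` {..n}" "M j"] that t(2) by simp
    then show ?thesis using t(1) by blast
  qed
  then obtain s where s: "\<And>n. s n \<in> T" "\<And>n j. j \<le> n \<Longrightarrow> M j \<le> s n" by metis
  define x where "x n = ?y (s n)" for n
  have x: "x n \<in> carrier (FR G)" for n using vt[OF s(1)] by (simp add: x_def FZ_FR psi_closed)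
  have xx: "R.dst (x n) (x k) < 1 / real (Suc k)" if "k \<le> n" for n k
    unfolding x_def using M[OF s(1) s(1), of k n k] s(2)[OF that] s(2)[of k k] by simp
  let ?good = "\<lambda>t n. \<exists>z\<in>carrier (FZ G). R.dst (psi G (1 / t) z) (x n) \<le> 1 / real (Suc n)"
  define I where "I t = {n. n \<le> nat \<lfloor>t\<rfloor> \<and> ?good t n}" for t
  have good: "\<exists>N. \<forall>t\<ge>N. k \<in> I t" for k
  proof -
    define B where "B = (\<Sum>y\<leftarrow>x k. \<nu> (fst y))"
    have "k \<in> I t" if t: "max (max 1 (real k)) (B * real (Suc k)) \<le> t" for t
    proof -
      have tp: "t > 0" using t by simp
      note f = floor_word_FZ(1)[OF x[of k], of t]
      have "R.dst (psi G (1 / t) (floor_word G t (x k))) (x k)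
          = R.dst (psi G (1 / t) (floor_word G t (x k))) (psi G (1 / t) (psi G t (x k)))"
        using psi_cancel[OF x[of k], of "1 / t"] tp by simp
      also have "\<dots> = 1 / t * R.dst (floor_word G t (x k)) (psi G t (x k))"
        using f x[of k] tp by (intro dst_psi) (auto simp: FZ_FR psi_closed)
      also have "\<dots> \<le> 1 / t * B" using dst_floor_word_psi[OF x[of k], of t] tp by (intro mult_left_mono) (auto simp: B_def)
      also have "\<dots> \<le> 1 / real (Suc k)" using t tp by (simp add: field_simps)
      finally have "?good t k" using f by blast
      moreover have "k \<le> nat \<lfloor>t\<rfloor>" using t by (simp add: le_nat_floor)
      ultimately show ?thesis by (simp add: I_def)
    qed
    then show ?thesis by blast
  qed
  define u where "u t = (SOME z. z \<in> carrier (FZ G) \<and> (I t \<noteq> {} \<longrightarrow> R.dst (psi G (1 / t) z) (x (Max (I t))) \<le> 1 / real (Suc (Max (I t)))))" for t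
  have u: "u t \<in> carrier (FZ G) \<and> (I t \<noteq> {} \<longrightarrow> R.dst (psi G (1 / t) (u t)) (x (Max (I t))) \<le> 1 / real (Suc (Max (I t))))" for t
    unfolding u_def
  proof (rule someI_ex)
    show "\<exists>z. z \<in> carrier (FZ G) \<and> (I t \<noteq> {} \<longrightarrow> R.dst (psi G (1 / t) z) (x (Max (I t))) \<le> 1 / real (Suc (Max (I t))))"
    proof (cases "I t = {}")
      case False
      have "finite (I t)" unfolding I_def by (rule finite_subset[of _ "{..nat \<lfloor>t\<rfloor>}"]) auto
      then have "Max (I t) \<in> I t" using False by (rule Max_in)
      then show ?thesis by (auto simp: I_def)
    qed (use FZ_closed(3) in auto)
  qed
  define v' where "v' = (\<lambda>t\<in>T'. if t \<in> T then v t else u t)"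
  have v'FZ: "v' t \<in> carrier (FZ G)" if "t \<in> T'" for t using that vt u by (simp add: v'_def)
  have near: "\<exists>N. \<forall>t\<in>T'. N \<le> t \<longrightarrow> R.dst (psi G (1 / t) (v' t)) (x k) < 2 / real (Suc k)" for k
  proof -
    obtain N where N: "\<And>t. N \<le> t \<Longrightarrow> k \<in> I t" using good by blast
    show ?thesis
    proof (intro exI[of _ "max N (M k)"] ballI impI)
      fix t assume t: "t \<in> T'" "max N (M k) \<le> t"
      show "R.dst (psi G (1 / t) (v' t)) (x k) < 2 / real (Suc k)"
      proof (cases "t \<in> T")
        case True
        have "R.dst (?y t) (x k) < 1 / real (Suc k)"
          unfolding x_def using M[OF True s(1), of k k] t(2) s(2)[of k k] by simp
        also have "\<dots> \<le> 2 / real (Suc k)" by (rule divide_right_mono) auto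
        finally show ?thesis using True t(1) by (simp add: v'_def)
      next
        case False
        have fin: "finite (I t)" unfolding I_def by (rule finite_subset[of _ "{..nat \<lfloor>t\<rfloor>}"]) auto
        have kI: "k \<in> I t" using N t(2) by simp
        let ?n = "Max (I t)"
        have kn: "k \<le> ?n" using Max_ge[OF fin kI] .
        have "R.dst (psi G (1 / t) (u t)) (x ?n) \<le> 1 / real (Suc ?n)" using u kI by blast
        also have "\<dots> \<le> 1 / real (Suc k)" using kn by (intro divide_left_mono) auto
        finally have "R.dst (psi G (1 / t) (u t)) (x k) < 1 / real (Suc k) + 1 / real (Suc k)"
          using xx[OF kn] R.dst_triangle[OF psi_closed[OF FZ_FR[OF conjunct1[OF u[of t]]], of "1 / t"] x[of ?n] x[of k]]
          by linarith
        then show ?thesis using False t(1) by (simp add: v'_def)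
      qed
    qed
  qed
  have "cauchy_on T' (\<lambda>t. psi G (1 / t) (v' t))"
    unfolding cauchy_on_def
  proof (intro conjI ballI allI impI)
    show vc: "psi G (1 / t) (v' t) \<in> carrier (FR G)" if "t \<in> T'" for t using v'FZ[OF that] by (simp add: FZ_FR psi_closed)
    fix \<epsilon> :: real assume "0 < \<epsilon>"
    then obtain k where k: "inverse (real (Suc k)) < \<epsilon> / 4" using reals_Archimedean[of "\<epsilon> / 4"] by auto
    obtain N where N: "\<And>t. t \<in> T' \<Longrightarrow> N \<le> t \<Longrightarrow> R.dst (psi G (1 / t) (v' t)) (x k) < 2 / real (Suc k)"
      using near by blast
    show "\<exists>M. \<forall>t\<in>T'. \<forall>t'\<in>T'. M \<le> t \<longrightarrow> M \<le> t' \<longrightarrow> R.dst (psi G (1 / t) (v' t)) (psi G (1 / t') (v' t')) < \<epsilon>"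
    proof (intro exI[of _ N] ballI impI)
      fix t t' assume t: "t \<in> T'" "t' \<in> T'" "N \<le> t" "N \<le> t'"
      have "4 / real (Suc k) < \<epsilon>" using k by (simp add: inverse_eq_divide field_simps)
      then show "R.dst (psi G (1 / t) (v' t)) (psi G (1 / t') (v' t')) < \<epsilon>"
        using R.dst_triangle[OF vc[OF t(1)] x vc[OF t(2)], of k] N[OF t(1,3)] N[OF t(2,4)]
          R.dst_sym[OF vc[OF t(2)] x, of k] by linarith
    qed
  qed
  then have "v' \<in> Dw T'" unfolding Dw_iff using v'FZ by (auto simp: v'_def)
  moreover have "restrict v' T = v"
  proof
    fix t show "restrict v' T t = v t" using sub vE by (auto simp: v'_def extensional_def)
  qed
  ultimately show ?thesis by blast
qed

text \<open>Restriction never increases norms. Conversely, a directional word over \<open>T\<close> that lifts the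
  restriction of \<open>g\<close> extends to \<open>T'\<close> with the same norm, and its projection differs from \<open>g\<close> by
  an element that is trivial on the unbounded set \<open>T\<close>, hence null.\<close>

theorem independence:
  assumes straight: "\<And>x. x \<in> carrier (FR G) \<Longrightarrow> \<exists>\<Lambda> K. straightens \<Lambda> K x"
  shows "independent_of_scaling G \<nu>"
  unfolding independent_of_scaling_def
proof (intro allI impI)
  fix T T' assume T: "scaling_set T" and T': "scaling_set T'" and sub: "T \<subseteq> T'"
  interpret D: conj_pseudonorm "dir_words G \<nu> T'" "dir_words_norm G \<nu> T'" by (rule dir_words_pseudonorm[OF T'])
  interpret Q': conj_pseudonorm "dir_group G \<nu> T'" "dir_norm G \<nu> T'" by (rule dir_group_pseudonorm[OF T'])
  interpret Q: conj_pseudonorm "dir_group G \<nu> T" "dir_norm G \<nu> T" by (rule dir_group_pseudonorm[OF T])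
  have closed: "restrict g T \<in> carrier (dir_group G \<nu> T)" if g: "g \<in> carrier (dir_group G \<nu> T')" for g
  proof -
    obtain w where w: "w \<in> Dw T'" "g = pr T' w" using g by (auto simp: dir_group_eq)
    show ?thesis unfolding w(2) pr_restrict[OF sub] using Dw_restrict[OF w(1) sub] by (simp add: dir_group_eq)
  qed
  have hom: "(\<lambda>g. restrict g T) \<in> hom (dir_group G \<nu> T') (dir_group G \<nu> T)"
    using closed sub by (intro homI) (auto simp: dir_group_def fun_eq_iff restrict_def)
  have iso: "dir_norm G \<nu> T (restrict g T) = dir_norm G \<nu> T' g" if g: "g \<in> carrier (dir_group G \<nu> T')" for g
  proof (rule antisym)
    show "dir_norm G \<nu> T (restrict g T) \<le> dir_norm G \<nu> T' g"
    proof (rule dir_norm_greatest[OF g])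
      fix w assume w: "w \<in> Dw T'" "pr T' w = g"
      show "dir_norm G \<nu> T (restrict g T) \<le> dir_words_norm G \<nu> T' w"
        using dir_norm_le[OF T Dw_restrict[OF w(1) sub]]
        unfolding w(2)[symmetric] pr_restrict[OF sub] dir_words_norm_restrict[OF T T' sub w(1)] .
    qed
    show "dir_norm G \<nu> T' g \<le> dir_norm G \<nu> T (restrict g T)"
    proof (rule dir_norm_greatest[OF closed[OF g]])
      fix v assume v: "v \<in> Dw T" "pr T v = restrict g T"
      obtain v' where v': "v' \<in> Dw T'" "restrict v' T = v" using Dw_extend[OF T T' sub v(1)] by blast
      obtain w where w: "w \<in> Dw T'" "g = pr T' w" using g by (auto simp: dir_group_eq)
      let ?z = "inv\<^bsub>dir_words G \<nu> T'\<^esub> v' \<otimes>\<^bsub>dir_words G \<nu> T'\<^esub> w"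
      interpret h: group_hom "dir_words G \<nu> T'" "dir_group G \<nu> T'" "pr T'"
        using pr_hom' by unfold_locales
      have z: "?z \<in> Dw T'" using v'(1) w(1) by simp
      have prz: "pr T' ?z = inv\<^bsub>dir_group G \<nu> T'\<^esub> pr T' v' \<otimes>\<^bsub>dir_group G \<nu> T'\<^esub> g"
        using v'(1) w by simp
      have "dir_norm G \<nu> T' (pr T' ?z) = 0"
      proof (rule sublinear_imp_null[OF T' z straight])
        fix \<epsilon> M :: real assume "0 < \<epsilon>"
        obtain t where t: "t \<in> T" "M \<le> t" using scaling_setD(3)[OF T] by blast
        have t': "t \<in> T'" using t sub by auto
        interpret r: group_hom "dir_group G \<nu> T'" "dir_group G \<nu> T" "\<lambda>g. restrict g T"
          using hom by unfold_locales
        have "restrict (pr T' v') T = restrict g T" unfolding pr_restrict[OF sub] v'(2) v(2) ..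
        then have "restrict (pr T' ?z) T = \<one>\<^bsub>dir_group G \<nu> T\<^esub>"
          unfolding prz using g h.hom_closed[OF v'(1)] closed[OF g] by simp
        then have "restrict (pr T' ?z) T t = \<one>\<^bsub>dir_group G \<nu> T\<^esub> t" by (rule fun_cong)
        then have "proj G (?z t) = \<one>" using t t' by (simp add: dir_group_def)
        then show "\<exists>t\<in>T'. M \<le> t \<and> \<nu> (proj G (?z t)) < \<epsilon> * t"
          using t t' \<open>0 < \<epsilon>\<close> scaling_setD(2)[OF T' t'] by (intro bexI[of _ t]) auto
      qed (assumption)
      then have "Q'.dst (pr T' v') g = 0" unfolding prz norm_dist_def .
      then have "dir_norm G \<nu> T' g \<le> dir_norm G \<nu> T' (pr T' v')"
        using Q'.nu_le_dst[OF g h.hom_closed[OF v'(1)]] Q'.dst_sym[OF g h.hom_closed[OF v'(1)]] by simp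
      also have "\<dots> \<le> dir_words_norm G \<nu> T' v'" by (rule dir_norm_le[OF T' v'(1)])
      also have "\<dots> = dir_words_norm G \<nu> T v" using dir_words_norm_restrict[OF T T' sub v'(1)] v'(2) by simp
      finally show "dir_norm G \<nu> T' g \<le> dir_words_norm G \<nu> T v" .
    qed
  qed
  interpret N: null_hom "dir_group G \<nu> T'" "dir_norm G \<nu> T'" "dir_group G \<nu> T" "dir_norm G \<nu> T" "\<lambda>g. restrict g T"
    by unfold_locales (use hom iso in auto)
  have nulls: "dir_null G \<nu> T = Q.null" "dir_null G \<nu> T' = Q'.null"
    by (simp_all add: dir_null_def Q.null_def Q'.null_def)
  have "is_isometry (dir_group G \<nu> T' Mod Q'.null) (\<lambda>P. the_elem (dir_norm G \<nu> T' ` P))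
      (dir_group G \<nu> T Mod Q.null) (\<lambda>P. the_elem (dir_norm G \<nu> T ` P)) N.fquot"
  proof (rule N.fquot_isometry[OF iso])
    fix h assume h: "h \<in> carrier (dir_group G \<nu> T)"
    then obtain v where v: "v \<in> Dw T" "h = pr T v" by (auto simp: dir_group_eq)
    obtain v' where v': "v' \<in> Dw T'" "restrict v' T = v" using Dw_extend[OF T T' sub v(1)] by blast
    have "restrict (pr T' v') T = h" unfolding pr_restrict[OF sub] v'(2) v(2) ..
    then have "Q.dst (restrict (pr T' v') T) h = 0" using Q.dst_self[OF h] by simp
    moreover have "pr T' v' \<in> carrier (dir_group G \<nu> T')" using v'(1) by (simp add: dir_group_eq)
    ultimately show "\<exists>g\<in>carrier (dir_group G \<nu> T'). Q.dst (restrict g T) h = 0" by blast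
  qed
  moreover have "N.fquot = dir_restrict G \<nu> T"
    by (simp add: fun_eq_iff N.fquot_def dir_restrict_def dir_class_def nulls)
  ultimately show "is_isometry (dir_cone G \<nu> T') (dir_cone_norm G \<nu> T') (dir_cone G \<nu> T) (dir_cone_norm G \<nu> T) (dir_restrict G \<nu> T)"
    by (simp add: dir_cone_def nulls dir_cone_norm_def [abs_def])
qed

end


section \<open>Ultrafilter cones\<close>

text \<open>An ultrafilter that contains a finite set contains one of its points.\<close>

lemma nonprincipal_le_sequentially:
  fixes \<omega> :: "nat filter"
  assumes "nonprincipal_ultrafilter \<omega>" shows "\<omega> \<le> sequentially"
proof -
  have nb: "\<omega> \<noteq> bot" and ult: "\<And>Q. eventually Q \<omega> \<or> eventually (\<lambda>x. \<not> Q x) \<omega>"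
    and np: "\<And>a. \<omega> \<noteq> principal {a}" using assms by (auto simp: nonprincipal_ultrafilter_def)
  have ne: "eventually (\<lambda>n. n \<noteq> a) \<omega>" for a
  proof (rule ccontr)
    assume "\<not> ?thesis"
    then have ev: "eventually (\<lambda>n. n = a) \<omega>" using ult[of "\<lambda>n. n \<noteq> a"] by simp
    have "eventually P \<omega> \<longleftrightarrow> P a" for P
    proof
      assume "eventually P \<omega>"
      then have "eventually (\<lambda>n. P a) \<omega>" using ev by eventually_elim auto
      then show "P a" using nb by (cases "P a") (auto simp: trivial_limit_def)
    next
      assume "P a"
      with ev show "eventually P \<omega>" by (auto elim: eventually_mono)
    qed
    then have "\<omega> = principal {a}" by (simp add: filter_eq_iff eventually_principal)
    then show False using np by blast
  qed
  have "eventually (\<lambda>n. N \<le> n) \<omega>" for N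
  proof (induction N)
    case (Suc N)
    then show ?case using ne[of N] by eventually_elim auto
  qed simp
  then show ?thesis
    unfolding le_filter_def eventually_sequentially by (metis (mono_tags, lifting) eventually_mono)
qed

text \<open>By compactness there is a cluster point, and an ultrafilter converges to each of its cluster
  points.\<close>

lemma ultrafilter_bounded_convergent:
  fixes f :: "'b \<Rightarrow> real"
  assumes \<omega>: "\<omega> \<noteq> bot" "\<And>Q. eventually Q \<omega> \<or> eventually (\<lambda>x. \<not> Q x) \<omega>"
    and b: "eventually (\<lambda>n. \<bar>f n\<bar> \<le> B) \<omega>"
  shows "\<exists>l. (f \<longlongrightarrow> l) \<omega>"
proof -
  let ?F = "filtermap f \<omega>"
  have "compact {-B..B}" by simp
  moreover have "?F \<noteq> bot" using \<omega>(1) by (simp add: filtermap_bot_iff)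
  moreover have "eventually (\<lambda>x. x \<in> {-B..B}) ?F"
    using b by (simp add: eventually_filtermap abs_le_iff) (auto elim: eventually_mono)
  ultimately obtain l where l: "inf (nhds l) ?F \<noteq> bot" unfolding compact_filter by blast
  have "(f \<longlongrightarrow> l) \<omega>"
  proof (rule topological_tendstoI)
    fix S assume S: "open S" "l \<in> S"
    show "eventually (\<lambda>x. f x \<in> S) \<omega>"
    proof (rule ccontr)
      assume "\<not> ?thesis"
      then have "eventually (\<lambda>x. x \<notin> S) ?F" using \<omega>(2)[of "\<lambda>x. f x \<in> S"] by (simp add: eventually_filtermap)
      moreover have "eventually (\<lambda>x. x \<in> S) (nhds l)" using S by (auto simp: eventually_nhds)
      ultimately have "eventually (\<lambda>x. False) (inf (nhds l) ?F)" unfolding eventually_inf by blast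
      then show False using l by (simp add: trivial_limit_def)
    qed
  qed
  then show ?thesis ..
qed

lemma limsup_finite_iff: "limsup (\<lambda>n. ereal (f n)) < \<infinity> \<longleftrightarrow> (\<exists>B. eventually (\<lambda>n. f n \<le> B) sequentially)"
proof
  assume "limsup (\<lambda>n. ereal (f n)) < \<infinity>"
  then obtain B where "limsup (\<lambda>n. ereal (f n)) < ereal B" using ereal_dense2 by blast
  from Limsup_lessD[OF this] show "\<exists>B. eventually (\<lambda>n. f n \<le> B) sequentially"
    by (intro exI[of _ B]) (auto elim: eventually_mono)
next
  assume "\<exists>B. eventually (\<lambda>n. f n \<le> B) sequentially"
  then obtain B where "eventually (\<lambda>n. ereal (f n) \<le> ereal B) sequentially" by auto
  from Limsup_bounded[OF this] show "limsup (\<lambda>n. ereal (f n)) < \<infinity>" by (auto simp: le_less_trans)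
qed

context conj_pseudonorm
begin

interpretation R: conj_pseudonorm "FR G" "FR_norm G \<nu>" by (rule FR_pseudonorm)

lemma linear_seqs_iff:
  "g \<in> carrier (linear_seqs G \<nu> d) \<longleftrightarrow>
     (\<forall>n. g n \<in> carrier G) \<and> (\<exists>B. eventually (\<lambda>n. \<nu> (g n) / d n \<le> B) sequentially)"
  by (auto simp: linear_seqs_def limsup_finite_iff [simplified] PiE_UNIV_domain)

lemma linear_seqs_eq:
  "linear_seqs G \<nu> d = (product_group UNIV (\<lambda>_. G))\<lparr>carrier := carrier (linear_seqs G \<nu> d)\<rparr>"
  by (simp add: linear_seqs_def)

lemma linear_seqs_subgroup:
  assumes d: "scaling_sequence d"
  shows "subgroup (carrier (linear_seqs G \<nu> d)) (product_group UNIV (\<lambda>_. G))"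
proof -
  interpret P: group "product_group UNIV (\<lambda>_::nat. G)" by (simp add: group_axioms)
  have dp: "d n > 0" for n using d by (simp add: scaling_sequence_def)
  show ?thesis
  proof (rule P.subgroupI)
    show "carrier (linear_seqs G \<nu> d) \<subseteq> carrier (product_group UNIV (\<lambda>_. G))"
      by (auto simp: linear_seqs_iff)
    have "(\<lambda>n. \<one>) \<in> carrier (linear_seqs G \<nu> d)" by (auto simp: linear_seqs_iff intro!: exI[of _ 0])
    then show "carrier (linear_seqs G \<nu> d) \<noteq> {}" by blast
  next
    fix g assume g: "g \<in> carrier (linear_seqs G \<nu> d)"
    then have gP: "g \<in> UNIV \<rightarrow>\<^sub>E carrier G" by (auto simp: linear_seqs_iff)
    show "inv\<^bsub>product_group UNIV (\<lambda>_. G)\<^esub> g \<in> carrier (linear_seqs G \<nu> d)"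
      using g inv_product_group[OF gP group_axioms] by (simp add: linear_seqs_iff)
  next
    fix g h assume gh: "g \<in> carrier (linear_seqs G \<nu> d)" "h \<in> carrier (linear_seqs G \<nu> d)"
    then obtain B C where BC: "eventually (\<lambda>n. \<nu> (g n) / d n \<le> B) sequentially" "eventually (\<lambda>n. \<nu> (h n) / d n \<le> C) sequentially"
      by (auto simp: linear_seqs_iff)
    have "eventually (\<lambda>n. \<nu> (g n \<otimes> h n) / d n \<le> B + C) sequentially"
      using BC
    proof eventually_elim
      case (elim n)
      have "\<nu> (g n \<otimes> h n) / d n \<le> (\<nu> (g n) + \<nu> (h n)) / d n"
        using gh nu_mult dp[of n] by (intro divide_right_mono) (auto simp: linear_seqs_iff less_imp_le)
      then show ?case using elim by (simp add: add_divide_distrib)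
    qed
    then show "g \<otimes>\<^bsub>product_group UNIV (\<lambda>_. G)\<^esub> h \<in> carrier (linear_seqs G \<nu> d)"
      using gh by (auto simp: linear_seqs_iff)
  qed
qed

lemma ultra_norm_tendsto:
  assumes d: "scaling_sequence d" and \<omega>: "nonprincipal_ultrafilter \<omega>" and g: "g \<in> carrier (linear_seqs G \<nu> d)"
  shows "((\<lambda>n. \<nu> (g n) / d n) \<longlongrightarrow> ultra_norm \<nu> \<omega> d g) \<omega>"
proof -
  have w: "\<omega> \<noteq> bot" "\<And>Q. eventually Q \<omega> \<or> eventually (\<lambda>x. \<not> Q x) \<omega>"
    using \<omega> by (auto simp: nonprincipal_ultrafilter_def)
  obtain B where "eventually (\<lambda>n. \<nu> (g n) / d n \<le> B) sequentially" using g by (auto simp: linear_seqs_iff)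
  then have ev: "eventually (\<lambda>n. \<nu> (g n) / d n \<le> B) \<omega>"
    by (rule filter_leD[OF nonprincipal_le_sequentially[OF \<omega>]])
  have nn: "0 \<le> \<nu> (g n) / d n" for n
    using g d nu_nonneg by (auto simp: linear_seqs_iff scaling_sequence_def less_imp_le)
  from ev have "eventually (\<lambda>n. \<bar>\<nu> (g n) / d n\<bar> \<le> B) \<omega>"
    by (rule eventually_mono) (simp only: abs_of_nonneg[OF nn])
  from ultrafilter_bounded_convergent[OF w this] obtain l where "((\<lambda>n. \<nu> (g n) / d n) \<longlongrightarrow> l) \<omega>" by blast
  with tendsto_Lim[OF w(1) this] show ?thesis by (simp add: ultra_norm_def)
qed

lemma linear_seqs_pseudonorm:
  assumes d: "scaling_sequence d" and \<omega>: "nonprincipal_ultrafilter \<omega>"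
  shows "conj_pseudonorm (linear_seqs G \<nu> d) (ultra_norm \<nu> \<omega> d)"
proof (subst linear_seqs_eq, rule limit_pseudonorm[OF _ linear_seqs_subgroup[OF d] _ conj_pseudonorm_axioms])
  show "group (product_group UNIV (\<lambda>_. G))" by (simp add: group_axioms)
  show "\<omega> \<noteq> bot" using \<omega> by (simp add: nonprincipal_ultrafilter_def)
  show "\<forall>\<^sub>F n in \<omega>. n \<in> UNIV" by simp
  show "0 \<le> 1 / d n" for n using d by (simp add: scaling_sequence_def less_imp_le)
  show "(\<lambda>g. g n) \<in> hom (product_group UNIV (\<lambda>_. G)) G" for n by (rule homI) auto
  show "((\<lambda>n. 1 / d n * \<nu> (g n)) \<longlongrightarrow> ultra_norm \<nu> \<omega> d g) \<omega>" if "g \<in> carrier (linear_seqs G \<nu> d)" for g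
    using ultra_norm_tendsto[OF d \<omega> that] by simp
qed

text \<open>The map is well defined since projections do not increase norms. For injectivity, if
  the norms of \<open>g(d\<^sub>n)\<close> relative to \<open>d\<^sub>n\<close> tend to \<open>0\<close> along the ultrafilter, then they are small for
  arbitrarily large \<open>d\<^sub>n\<close>.\<close>

theorem rho_hom_inj:
  assumes straight: "\<And>x. x \<in> carrier (FR G) \<Longrightarrow> \<exists>\<Lambda> K. straightens \<Lambda> K x"
    and d: "scaling_sequence d" and \<omega>: "nonprincipal_ultrafilter \<omega>"
  shows "rho G \<nu> \<omega> d \<in> hom (dir_cone G \<nu> {0<..}) (ultra_cone G \<nu> \<omega> d)"
    and "inj_on (rho G \<nu> \<omega> d) (carrier (dir_cone G \<nu> {0<..}))"
proof -
  let ?T = "{0<..} :: real set"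
  have T: "scaling_set ?T"
    unfolding scaling_set_def
  proof (intro conjI notI order_refl)
    assume "bdd_above ?T"
    then obtain M where "\<And>x. x \<in> ?T \<Longrightarrow> x \<le> M" unfolding bdd_above_def by blast
    moreover have "\<bar>M\<bar> + 1 \<in> ?T" by simp
    ultimately have "\<bar>M\<bar> + 1 \<le> M" by blast
    then show False by linarith
  qed
  interpret Q: conj_pseudonorm "dir_group G \<nu> ?T" "dir_norm G \<nu> ?T" by (rule dir_group_pseudonorm[OF T])
  interpret U: conj_pseudonorm "linear_seqs G \<nu> d" "ultra_norm \<nu> \<omega> d" by (rule linear_seqs_pseudonorm[OF d \<omega>])
  have nb: "\<omega> \<noteq> bot" using \<omega> by (simp add: nonprincipal_ultrafilter_def)
  have dp: "d n > 0" for n using d by (simp add: scaling_sequence_def)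
  have dt: "filterlim d at_top sequentially" using d by (simp add: scaling_sequence_def)
  have dT: "filterlim d (at_inf ?T) sequentially"
    using dt dp by (simp add: filterlim_inf filterlim_principal)
  let ?f = "\<lambda>g n. g (d n)"
  have le: "\<nu> (pr ?T w (d n)) / d n \<le> FR_norm G \<nu> (psi G (1 / d n) (w (d n)))" if w: "w \<in> Dw ?T" for w n
  proof -
    have wn: "w (d n) \<in> carrier (FZ G)" using w dp[of n] by (auto simp: Dw_iff)
    have "\<nu> (pr ?T w (d n)) \<le> FR_norm G \<nu> (w (d n))" using nu_proj_le[OF wn] dp[of n] by simp
    then show ?thesis using FR_norm_psi[OF FZ_FR[OF wn], of "1 / d n"] dp[of n] by (simp add: divide_right_mono)
  qed
  have lim: "((\<lambda>n. FR_norm G \<nu> (psi G (1 / d n) (w (d n)))) \<longlongrightarrow> dir_words_norm G \<nu> ?T w) sequentially" if w: "w \<in> Dw ?T" for w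
    by (rule filterlim_compose[OF dir_words_norm_tendsto[OF T w] dT])
  have closed: "?f g \<in> carrier (linear_seqs G \<nu> d)" if g: "g \<in> carrier (dir_group G \<nu> ?T)" for g
  proof -
    obtain w where w: "w \<in> Dw ?T" "g = pr ?T w" using g by (auto simp: dir_group_eq)
    have "g (d n) \<in> carrier G" for n
      using w dp[of n] by (auto simp: Dw_iff intro!: proj_closed)
    moreover have "eventually (\<lambda>n. FR_norm G \<nu> (psi G (1 / d n) (w (d n))) < dir_words_norm G \<nu> ?T w + 1) sequentially"
      using order_tendstoD(2)[OF lim[OF w(1)]] by simp
    then have "eventually (\<lambda>n. \<nu> (g (d n)) / d n \<le> dir_words_norm G \<nu> ?T w + 1) sequentially"
    proof eventually_elim
      case (elim n)
      then show ?case using le[OF w(1), of n] unfolding w(2) by linarith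
    qed
    ultimately show ?thesis by (auto simp: linear_seqs_iff)
  qed
  have hom: "?f \<in> hom (dir_group G \<nu> ?T) (linear_seqs G \<nu> d)"
    using closed dp by (intro homI) (auto simp: dir_group_def linear_seqs_def)
  have null: "ultra_norm \<nu> \<omega> d (?f g) = 0" if g: "g \<in> carrier (dir_group G \<nu> ?T)" "dir_norm G \<nu> ?T g = 0" for g
  proof -
    have "ultra_norm \<nu> \<omega> d (?f g) \<le> dir_norm G \<nu> ?T g"
    proof (rule dir_norm_greatest[OF g(1)])
      fix w assume w: "w \<in> Dw ?T" "pr ?T w = g"
      show "ultra_norm \<nu> \<omega> d (?f g) \<le> dir_words_norm G \<nu> ?T w"
      proof (rule tendsto_le[OF nb tendsto_mono[OF nonprincipal_le_sequentially[OF \<omega>] lim[OF w(1)]] ultra_norm_tendsto[OF d \<omega> closed[OF g(1)]]])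
        show "\<forall>\<^sub>F n in \<omega>. \<nu> (g (d n)) / d n \<le> FR_norm G \<nu> (psi G (1 / d n) (w (d n)))"
          using le[OF w(1)] unfolding w(2) by simp
      qed
    qed
    then show ?thesis using g U.nu_nonneg[OF closed[OF g(1)]] by simp
  qed
  interpret N: null_hom "dir_group G \<nu> ?T" "dir_norm G \<nu> ?T" "linear_seqs G \<nu> d" "ultra_norm \<nu> \<omega> d" ?f
    by unfold_locales (use hom null in auto)
  have nulls: "dir_null G \<nu> ?T = Q.null" "ultra_null G \<nu> \<omega> d = U.null"
    by (simp_all add: dir_null_def Q.null_def ultra_null_def U.null_def)
  have rho: "rho G \<nu> \<omega> d = N.fquot"
    by (simp add: fun_eq_iff N.fquot_def rho_def ultra_class_def nulls)
  show "rho G \<nu> \<omega> d \<in> hom (dir_cone G \<nu> ?T) (ultra_cone G \<nu> \<omega> d)"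
    using N.fquot_hom by (simp add: rho dir_cone_def ultra_cone_def nulls)
  have "inj_on N.fquot (carrier (dir_group G \<nu> ?T Mod Q.null))"
  proof (rule N.fquot_inj)
    fix g assume g: "g \<in> carrier (dir_group G \<nu> ?T)" "ultra_norm \<nu> \<omega> d (?f g) = 0"
    obtain w where w: "w \<in> Dw ?T" "g = pr ?T w" using g(1) by (auto simp: dir_group_eq)
    show "dir_norm G \<nu> ?T g = 0"
      unfolding w(2)
    proof (rule sublinear_imp_null[OF T w(1) straight])
      fix \<epsilon> M :: real assume e: "0 < \<epsilon>"
      have "eventually (\<lambda>n. \<nu> (g (d n)) / d n < \<epsilon>) \<omega>"
        using order_tendstoD(2)[OF ultra_norm_tendsto[OF d \<omega> closed[OF g(1)]]] g(2) e by simp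
      moreover have "eventually (\<lambda>n. M \<le> d n) \<omega>"
        using dt by (intro filter_leD[OF nonprincipal_le_sequentially[OF \<omega>]]) (simp add: filterlim_at_top)
      ultimately have "eventually (\<lambda>n. \<nu> (g (d n)) / d n < \<epsilon> \<and> M \<le> d n) \<omega>" by eventually_elim simp
      then obtain n where n: "\<nu> (g (d n)) / d n < \<epsilon>" "M \<le> d n"
        using eventually_happens'[OF nb] by blast
      have "\<nu> (proj G (w (d n))) < \<epsilon> * d n"
        using n(1) dp[of n] unfolding w(2) by (simp add: field_simps)
      then show "\<exists>t\<in>?T. M \<le> t \<and> \<nu> (proj G (w t)) < \<epsilon> * t"
        using n(2) dp[of n] by (intro bexI[of _ "d n"]) auto
    qed (assumption)
  qed
  then show "inj_on (rho G \<nu> \<omega> d) (carrier (dir_cone G \<nu> ?T))"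
    by (simp add: rho dir_cone_def nulls)
qed

end

theorem theorem11p1:
  fixes A :: "'a set"
  shows "independent_of_scaling (free_group A) (word_norm A) \<and>
    (\<forall>(\<omega> :: nat filter) (d :: nat \<Rightarrow> real). nonprincipal_ultrafilter \<omega> \<longrightarrow> scaling_sequence d \<longrightarrow>
       rho (free_group A) (word_norm A) \<omega> d
         \<in> hom (dir_cone (free_group A) (word_norm A) {0<..})
               (ultra_cone (free_group A) (word_norm A) \<omega> d) \<and>
       inj_on (rho (free_group A) (word_norm A) \<omega> d)
         (carrier (dir_cone (free_group A) (word_norm A) {0<..})))"
proof -
  interpret N: conj_pseudonorm "free_group A" "word_norm A" by (rule word_norm_pseudonorm)
  show ?thesis
    using N.independence[OF free_group_straightens] N.rho_hom_inj[OF free_group_straightens] by blast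
qed

end
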